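(* Let $K$ be a differential field with algebraically closed field of constants $C$, let $L/K$ be a Picard-Vessiot extension, and let $n\ge 1$ be an integer. Then there is a natural bijection between $Z_n(L/K)$ and $\mathrm{Rep}_n(L/K)$, namely the (well-defined) map $$Z_n(L/K)\longrightarrow \mathrm{Rep}_n(L/K),\qquad [A]\longmapsto \rho_{[A]} .$$
   Context: All differential fields considered have algebraically closed field of constants, denoted $C$; the derivation is denoted by a dash, and for a matrix $U=(u_{i,j})$ one puts $U'=(u'_{i,j})$. For a differential field $K$, the group $\mathrm{GL}_n(K)$ acts on the set $\mathrm{M}_n(K)$ of $n\times n$ matrices by $(U,A)\mapsto U'U^{-1}+UAU^{-1}$. Let $Z_n(K)=\mathrm{GL}_n(K)\backslash \mathrm{M}_n(K)$ be the set of orbits, and let $[A]$ denote the orbit of $A$. (Equivalently, $Z_n(K)$ is the set of double cosets $\Delta_n(K)\backslash H_n(K)/(\{0\}\times \mathrm{GL}_n(K))$, where $H_n(K)=\mathrm{M}_n(K)\times \mathrm{GL}_n(K)$ is the group with law $(A,F)(B,G)=(A+FBF^{-1},FG)$ and $\Delta_n(K)=\{(U'U^{-1},U) : U\in \mathrm{GL}_n(K)\}$.) A Picard-Vessiot extension $L/K$ is a Picard-Vessiot field extension for some linear differential equation $Y'=BY$ with $B\in \mathrm{M}_m(K)$ for some $m$: $L$ is generated over $K$ by the entries of a fundamental matrix $F\in\mathrm{GL}_m(L)$, $F'=BF$, and $L$ has the same field of constants $C$ as $K$. Its differential Galois group $dGal(L/K)$ is the group of $K$-linear differential automorphisms of $L$,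 viewed as a linear algebraic group over $C$. The inclusion $K\subseteq L$ induces a map $\alpha(L/K):Z_n(K)\to Z_n(L)$, and $Z_n(L/K)=\{a\in Z_n(K) : \alpha(L/K)(a)=[0]\}$. Thus $[A]\in Z_n(L/K)$ if and only if there is $U\in \mathrm{GL}_n(L)$ with $A=U'U^{-1}$. $\mathrm{Rep}_n(L/K)$ is the set of equivalence classes (under conjugation by $\mathrm{GL}_n(C)$) of rational representations $dGal(L/K)\to \mathrm{GL}_n(C)$, i.e. homomorphisms of algebraic groups over $C$. For $[A]\in Z_n(L/K)$, choose $U\in \mathrm{GL}_n(L)$ with $A=U'U^{-1}$; then $\rho_{[A]}$ denotes the class in $\mathrm{Rep}_n(L/K)$ of the representation $\sigma\mapsto U^{-1}\sigma(U)$, i.e. $\sigma(U)=U\rho_{[A]}(\sigma)$ for $\sigma\in dGal(L/K)$. *)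

theory Defs
  imports
    "Jordan_Normal_Form.Gauss_Jordan_Elimination"
    "Jordan_Normal_Form.Determinant"
    "HOL-Library.FuncSet"
begin

text \<open>
  The extension field \<open>L\<close> is the whole type \<open>'a :: field\<close> with derivation \<open>D\<close>; the base
  field \<open>K\<close> is a subset of it, so that the inclusion of \<open>K\<close> in \<open>L\<close> is the inclusion of sets.
  No assumption is made on the characteristic.
\<close>

section \<open>Differential fields\<close>

definition derivation :: "('a::field \<Rightarrow> 'a) \<Rightarrow> bool" where
  "derivation D \<longleftrightarrow> (\<forall>x y. D (x + y) = D x + D y) \<and> (\<forall>x y. D (x * y) = D x * y + x * D y)"

definition is_subfield :: "'a::field set \<Rightarrow> bool" where
  "is_subfield S \<longleftrightarrow> 0 \<in> S \<and> 1 \<in> S \<and>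
     (\<forall>x\<in>S. \<forall>y\<in>S. x + y \<in> S \<and> x * y \<in> S) \<and> (\<forall>x\<in>S. - x \<in> S \<and> inverse x \<in> S)"

definition diff_subfield :: "('a::field \<Rightarrow> 'a) \<Rightarrow> 'a set \<Rightarrow> bool" where
  "diff_subfield D S \<longleftrightarrow> is_subfield S \<and> (\<forall>x\<in>S. D x \<in> S)"

definition constants :: "('a::field \<Rightarrow> 'a) \<Rightarrow> 'a set \<Rightarrow> 'a set" where
  "constants D S = {x \<in> S. D x = 0}"

definition algebraically_closed_subfield :: "'a::field set \<Rightarrow> bool" where
  "algebraically_closed_subfield C \<longleftrightarrow> is_subfield C \<and>
     (\<forall>p :: 'a poly. (\<forall>i. coeff p i \<in> C) \<and> degree p > 0 \<longrightarrow> (\<exists>x\<in>C. poly p x = 0))"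

section \<open>Matrices and the gauge action\<close>

definition Mat :: "'a::field set \<Rightarrow> nat \<Rightarrow> 'a mat set" where
  "Mat S n = {A \<in> carrier_mat n n. elements_mat A \<subseteq> S}"

definition GL :: "'a::field set \<Rightarrow> nat \<Rightarrow> 'a mat set" where
  "GL S n = {U \<in> Mat S n. \<exists>V \<in> Mat S n. U * V = 1\<^sub>m n \<and> V * U = 1\<^sub>m n}"

abbreviation minv :: "'a::field mat \<Rightarrow> 'a mat" where
  "minv U \<equiv> the (mat_inverse U)"

definition gauge :: "('a::field \<Rightarrow> 'a) \<Rightarrow> 'a mat \<Rightarrow> 'a mat \<Rightarrow> 'a mat" where
  "gauge D U A = map_mat D U * minv U + U * A * minv U"

definition gauge_rel :: "('a::field \<Rightarrow> 'a) \<Rightarrow> 'a set \<Rightarrow> nat \<Rightarrow> ('a mat \<times> 'a mat) set" where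
  "gauge_rel D S n =
     {(A, B). A \<in> Mat S n \<and> B \<in> Mat S n \<and> (\<exists>U \<in> GL S n. B = gauge D U A)}"

definition gauge_orbit :: "('a::field \<Rightarrow> 'a) \<Rightarrow> 'a set \<Rightarrow> nat \<Rightarrow> 'a mat \<Rightarrow> 'a mat set" where
  "gauge_orbit D S n A = gauge_rel D S n `` {A}"

definition Z :: "('a::field \<Rightarrow> 'a) \<Rightarrow> 'a set \<Rightarrow> nat \<Rightarrow> 'a mat set set" where
  "Z D S n = Mat S n // gauge_rel D S n"

text \<open>The map \<open>\<alpha>(L/K)\<close>: a \<open>GL\<^sub>n(K)\<close>-orbit is sent to the \<open>GL\<^sub>n(L)\<close>-orbit containing it.\<close>

definition Z_extend :: "('a::field \<Rightarrow> 'a) \<Rightarrow> nat \<Rightarrow> 'a mat set \<Rightarrow> 'a mat set" where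
  "Z_extend D n a = gauge_rel D UNIV n `` a"

definition Z_rel :: "('a::field \<Rightarrow> 'a) \<Rightarrow> 'a set \<Rightarrow> nat \<Rightarrow> 'a mat set set" where
  "Z_rel D K n = {a \<in> Z D K n. Z_extend D n a = gauge_orbit D UNIV n (0\<^sub>m n n)}"

section \<open>Picard-Vessiot extensions and their Galois groups\<close>

text \<open>
  \<open>L/K\<close> is a Picard-Vessiot extension for some equation \<open>Y' = BY\<close> of size \<open>m\<close> over \<open>K\<close>,
  with fundamental matrix \<open>F\<close>.
\<close>

definition picard_vessiot :: "('a::field \<Rightarrow> 'a) \<Rightarrow> 'a set \<Rightarrow> nat \<Rightarrow> 'a mat \<Rightarrow> bool" where
  "picard_vessiot D K m F \<longleftrightarrow>
     F \<in> GL UNIV m \<and> (\<exists>B \<in> Mat K m. map_mat D F = B * F) \<and>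
     is_subfield hull (K \<union> elements_mat F) = UNIV \<and>
     constants D UNIV = constants D K"

definition dGal :: "('a::field \<Rightarrow> 'a) \<Rightarrow> 'a set \<Rightarrow> ('a \<Rightarrow> 'a) set" where
  "dGal D K = {\<sigma>. bij \<sigma> \<and> (\<forall>x y. \<sigma> (x + y) = \<sigma> x + \<sigma> y) \<and> (\<forall>x y. \<sigma> (x * y) = \<sigma> x * \<sigma> y) \<and>
     (\<forall>x\<in>K. \<sigma> x = x) \<and> (\<forall>x. \<sigma> (D x) = D (\<sigma> x))}"

text \<open>The coordinate ring of \<open>GL\<^sub>m\<close> over \<open>C\<close>, generated by the entries and \<open>1/det\<close>.\<close>

inductive_set GL_regular :: "'a::field set \<Rightarrow> nat \<Rightarrow> ('a mat \<Rightarrow> 'a) set"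
  for C :: "'a set" and m :: nat where
  const: "c \<in> C \<Longrightarrow> (\<lambda>X. c) \<in> GL_regular C m"
| entry: "i < m \<Longrightarrow> j < m \<Longrightarrow> (\<lambda>X. X $$ (i, j)) \<in> GL_regular C m"
| inverse_det: "(\<lambda>X. inverse (det X)) \<in> GL_regular C m"
| add: "f \<in> GL_regular C m \<Longrightarrow> g \<in> GL_regular C m \<Longrightarrow> (\<lambda>X. f X + g X) \<in> GL_regular C m"
| mult: "f \<in> GL_regular C m \<Longrightarrow> g \<in> GL_regular C m \<Longrightarrow> (\<lambda>X. f X * g X) \<in> GL_regular C m"

text \<open>
  The algebraic group structure on the differential Galois group is transported along the
  embedding \<open>\<sigma> \<mapsto> F\<^sup>-\<^sup>1 \<sigma>(F)\<close> onto a Zariski closed subgroup of \<open>GL\<^sub>m(C)\<close>; accordingly the regular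
  functions on it are the restrictions of regular functions on \<open>GL\<^sub>m(C)\<close>.
\<close>

definition dGal_regular ::
  "('a::field \<Rightarrow> 'a) \<Rightarrow> 'a set \<Rightarrow> nat \<Rightarrow> 'a mat \<Rightarrow> (('a \<Rightarrow> 'a) \<Rightarrow> 'a) \<Rightarrow> bool" where
  "dGal_regular D K m F \<phi> \<longleftrightarrow>
     (\<exists>f \<in> GL_regular (constants D K) m. \<forall>\<sigma> \<in> dGal D K. \<phi> \<sigma> = f (minv F * map_mat \<sigma> F))"

section \<open>Rational representations up to conjugation\<close>

text \<open>Representations are taken extensional, i.e. \<open>undefined\<close> outside the Galois group.\<close>

definition rational_reps ::
  "('a::field \<Rightarrow> 'a) \<Rightarrow> 'a set \<Rightarrow> nat \<Rightarrow> 'a mat \<Rightarrow> nat \<Rightarrow> (('a \<Rightarrow> 'a) \<Rightarrow> 'a mat) set" where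
  "rational_reps D K m F n =
     {\<rho> \<in> dGal D K \<rightarrow>\<^sub>E GL (constants D K) n.
        (\<forall>\<sigma> \<in> dGal D K. \<forall>\<tau> \<in> dGal D K. \<rho> (\<sigma> \<circ> \<tau>) = \<rho> \<sigma> * \<rho> \<tau>) \<and>
        (\<forall>i<n. \<forall>j<n. dGal_regular D K m F (\<lambda>\<sigma>. \<rho> \<sigma> $$ (i, j)))}"

definition conj_rel ::
  "('a::field \<Rightarrow> 'a) \<Rightarrow> 'a set \<Rightarrow> nat \<Rightarrow> 'a mat \<Rightarrow> nat \<Rightarrow>
     ((('a \<Rightarrow> 'a) \<Rightarrow> 'a mat) \<times> (('a \<Rightarrow> 'a) \<Rightarrow> 'a mat)) set" where
  "conj_rel D K m F n =
     {(\<rho>, \<rho>'). \<rho> \<in> rational_reps D K m F n \<and> \<rho>' \<in> rational_reps D K m F n \<and>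
        (\<exists>T \<in> GL (constants D K) n. \<forall>\<sigma> \<in> dGal D K. \<rho>' \<sigma> = T * \<rho> \<sigma> * minv T)}"

definition Rep ::
  "('a::field \<Rightarrow> 'a) \<Rightarrow> 'a set \<Rightarrow> nat \<Rightarrow> 'a mat \<Rightarrow> nat \<Rightarrow> (('a \<Rightarrow> 'a) \<Rightarrow> 'a mat) set set" where
  "Rep D K m F n = rational_reps D K m F n // conj_rel D K m F n"

definition rep_of :: "('a::field \<Rightarrow> 'a) \<Rightarrow> 'a set \<Rightarrow> 'a mat \<Rightarrow> ('a \<Rightarrow> 'a) \<Rightarrow> 'a mat" where
  "rep_of D K U = (\<lambda>\<sigma> \<in> dGal D K. minv U * map_mat \<sigma> U)"

definition rep_class ::
  "('a::field \<Rightarrow> 'a) \<Rightarrow> 'a set \<Rightarrow> nat \<Rightarrow> 'a mat \<Rightarrow> nat \<Rightarrow> 'a mat set \<Rightarrow> (('a \<Rightarrow> 'a) \<Rightarrow> 'a mat) set" where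
  "rep_class D K m F n a =
     conj_rel D K m F n `` {rep_of D K (SOME U. U \<in> GL UNIV n \<and> map_mat D U * minv U \<in> a)}"

end

theory Submission
  imports Defs "Jordan_Normal_Form.Char_Poly" "HOL-Library.Function_Algebras"
begin

text \<open>
  Write \<open>G\<close> for the differential Galois group and \<open>X\<^sub>\<sigma> = F\<^sup>-\<^sup>1 \<sigma>(F)\<close>.

  Everything rests on \<open>L\<^sup>G = K\<close>. The relations \<open>p(F) = 0\<close> over \<open>K\<close> become conditions \<open>p(F X) = 0\<close>
  on a constant matrix \<open>X\<close>. Their \<open>L\<close>-span is stable under the derivation, hence spanned by
  polynomials with constant coefficients, and the invertible constant solutions are the
  \<open>X\<^sub>\<sigma>\<close>. If \<open>a\<close> is fixed by \<open>G\<close>, the Nullstellensatz over \<open>C\<close> makes \<open>a \<otimes> 1 - 1 \<otimes> a\<close> nilpotent in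
  \<open>L \<otimes>\<^sub>K L\<close>, which forces \<open>a \<in> K\<close>. This also covers positive characteristic, where
  \<open>L = K = C\<close>.

  Injectivity: if \<open>U\<close> and \<open>V\<close> have conjugate representations via \<open>T\<close>, then \<open>V T U\<^sup>-\<^sup>1\<close> is fixed by
  \<open>G\<close>, hence lies in \<open>GL\<^sub>n(K)\<close>. Surjectivity: a rational representation has the form
  \<open>\<rho>(\<tau>) = \<Sum>\<^sub>k e\<^sub>k \<tau>(R\<^sub>k)\<close> with \<open>e\<^sub>k\<close> independent over \<open>K\<close>, each \<open>R\<^sub>k\<close> satisfies
  \<open>\<sigma>(R\<^sub>k) = R\<^sub>k \<rho>(\<sigma>)\<close>, and some \<open>K\<close>-combination of the \<open>R\<^sub>k\<close> is invertible. That \<open>U\<^sup>-\<^sup>1 \<sigma>(U)\<close> is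
  a regular function of \<open>X\<^sub>\<sigma>\<close> follows because the denominators of the entries of \<open>U\<close> form a
  \<open>G\<close>-stable space.
\<close>

section \<open>Prime ideals and points of polynomial systems\<close>

text \<open>What makes \<open>L^G = K\<close> hard is that automorphisms come only from constant
  points: a matrix \<open>X\<close> over \<open>C\<close> has to satisfy relations with coefficients
  in \<open>K\<close>, while the Nullstellensatz over \<open>C\<close> sees only polynomials with
  coefficients in \<open>C\<close>. Passing to the coordinates of \<open>X\<close> brings in
  coefficients from \<open>L\<close>; the derivation is what leads them back to \<open>C\<close>.
  Points determine an ideal only up to its radical. Hence, for \<open>a = p(F)/q(F)\<close> fixed by
  the group, one learns only that a power of \<open>p(FX) - a q(FX)\<close> times
  \<open>det X\<close> is a combination of relations, and this is why nilpotence appears where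
  vanishing is wanted. The tensor product itself is never formed: its identities are tested by
  applying \<open>K\<close>-linear forms \<open>L \<rightarrow> K\<close> to coefficients in
  \<open>L\<close>. Polynomials in several variables are likewise handled as functions, which is
  faithful because \<open>C\<close> is infinite; an identity between them then needs checking only
  at points over \<open>C\<close> or over \<open>K\<close>. Rings are subsets of a type, so that
  functions with coefficients in \<open>C\<close>, \<open>K\<close> and \<open>L\<close> can be
  compared directly.\<close>

definition is_subring :: "'b::comm_ring_1 set \<Rightarrow> bool" where
  "is_subring A \<longleftrightarrow> 1 \<in> A \<and> (\<forall>x\<in>A. \<forall>y\<in>A. x - y \<in> A \<and> x * y \<in> A)"

lemma is_subringD:
  assumes "is_subring A"
  shows "0 \<in> A" "1 \<in> A" "x \<in> A \<Longrightarrow> y \<in> A \<Longrightarrow> x - y \<in> A" "x \<in> A \<Longrightarrow> y \<in> A \<Longrightarrow> x * y \<in> A"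
    "x \<in> A \<Longrightarrow> - x \<in> A" "x \<in> A \<Longrightarrow> y \<in> A \<Longrightarrow> x + y \<in> A" "x \<in> A \<Longrightarrow> x ^ k \<in> A"
proof -
  have D: "1 \<in> A" "\<And>x y. x \<in> A \<Longrightarrow> y \<in> A \<Longrightarrow> x - y \<in> A" "\<And>x y. x \<in> A \<Longrightarrow> y \<in> A \<Longrightarrow> x * y \<in> A"
    using assms unfolding is_subring_def by auto
  show z: "0 \<in> A" using D(2)[OF D(1) D(1)] by simp
  have m: "- x \<in> A" if "x \<in> A" for x using D(2)[OF z that] by simp
  show "x \<in> A \<Longrightarrow> y \<in> A \<Longrightarrow> x + y \<in> A" using D(2)[of x "- y"] m by simp
  show "x \<in> A \<Longrightarrow> x ^ k \<in> A" by (induction k) (use D in auto)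
  show "x \<in> A \<Longrightarrow> - x \<in> A" by (rule m)
  show "1 \<in> A" "x \<in> A \<Longrightarrow> y \<in> A \<Longrightarrow> x - y \<in> A" "x \<in> A \<Longrightarrow> y \<in> A \<Longrightarrow> x * y \<in> A"
    using D by auto
qed

lemma is_subring_sum:
  assumes "is_subring A" "\<And>i. i \<in> I \<Longrightarrow> f i \<in> A"
  shows "sum f I \<in> A"
  using assms(2) by (induction I rule: infinite_finite_induct) (auto simp: is_subringD[OF assms(1)])

lemma is_subring_prod:
  assumes "is_subring A" "\<And>i. i \<in> I \<Longrightarrow> f i \<in> A"
  shows "prod f I \<in> A"
  using assms(2) by (induction I rule: infinite_finite_induct) (auto simp: is_subringD[OF assms(1)])

definition ideal_in :: "'b::comm_ring_1 set \<Rightarrow> 'b set \<Rightarrow> bool" where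
  "ideal_in Q A \<longleftrightarrow> Q \<subseteq> A \<and> 0 \<in> Q \<and> (\<forall>x\<in>Q. \<forall>y\<in>Q. x + y \<in> Q) \<and> (\<forall>x\<in>A. \<forall>y\<in>Q. x * y \<in> Q)"

lemma ideal_inD:
  assumes "ideal_in Q A"
  shows "Q \<subseteq> A" "0 \<in> Q" "x \<in> Q \<Longrightarrow> y \<in> Q \<Longrightarrow> x + y \<in> Q" "x \<in> A \<Longrightarrow> y \<in> Q \<Longrightarrow> x * y \<in> Q"
    "y \<in> A \<Longrightarrow> x \<in> Q \<Longrightarrow> x * y \<in> Q"
  using assms unfolding ideal_in_def by (auto simp: mult.commute)

lemma ideal_in_diff:
  assumes "is_subring A" "ideal_in Q A" "x \<in> Q" "y \<in> Q"
  shows "x - y \<in> Q"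
  using ideal_inD(3)[OF assms(2,3) ideal_inD(4)[OF assms(2) _ assms(4), of "- 1"]]
    is_subringD[OF assms(1)] by auto

definition prime_in :: "'b::comm_ring_1 set \<Rightarrow> 'b set \<Rightarrow> bool" where
  "prime_in Q A \<longleftrightarrow> ideal_in Q A \<and> 1 \<notin> Q \<and> (\<forall>x\<in>A. \<forall>y\<in>A. x * y \<in> Q \<longrightarrow> x \<in> Q \<or> y \<in> Q)"

text \<open>By Zorn there is an ideal \<open>M\<close> maximal among those containing
  \<open>I\<close> and avoiding all powers of \<open>s\<close>. If \<open>x\<close> and
  \<open>y\<close> lie outside \<open>M\<close>, the ideals generated by \<open>M\<close> with
  \<open>x\<close> and by \<open>M\<close> with \<open>y\<close> each contain a power of
  \<open>s\<close>; the product of these powers lies in \<open>M\<close> as soon as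
  \<open>x * y\<close> does. Non-nilpotence modulo an ideal is thereby reduced to prime
  ideals.\<close>

lemma prime_in_exists:
  fixes A :: "'b::comm_ring_1 set"
  assumes A: "is_subring A" and I: "ideal_in I A" and s: "s \<in> A" "\<And>k. s ^ k \<notin> I"
  obtains Q where "prime_in Q A" "I \<subseteq> Q" "s \<notin> Q"
proof -
  note AD = is_subringD[OF A]
  let ?S = "{J. ideal_in J A \<and> I \<subseteq> J \<and> (\<forall>k. s ^ k \<notin> J)}"
  have "\<exists>M\<in>?S. \<forall>X\<in>?S. M \<subseteq> X \<longrightarrow> X = M"
  proof (rule subset_Zorn_nonempty)
    show "?S \<noteq> {}" using I s by auto
    fix c assume c: "c \<noteq> {}" "subset.chain ?S c"
    have cS: "\<And>J. J \<in> c \<Longrightarrow> J \<in> ?S" using c(2) unfolding subset_chain_def by (meson subsetD)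
    then have cI: "\<And>J. J \<in> c \<Longrightarrow> ideal_in J A" by auto
    note cD = ideal_inD[OF cI]
    have tot: "\<And>J J'. J \<in> c \<Longrightarrow> J' \<in> c \<Longrightarrow> J \<subseteq> J' \<or> J' \<subseteq> J"
      using c(2) unfolding subset_chain_def by blast
    have add: "x + y \<in> \<Union>c" if xy: "x \<in> \<Union>c" "y \<in> \<Union>c" for x y
    proof -
      obtain J J' where "x \<in> J" "J \<in> c" "y \<in> J'" "J' \<in> c" using xy by auto
      with tot[of J J'] have "\<exists>J\<in>c. x \<in> J \<and> y \<in> J" by blast
      then show ?thesis using cD(3) by blast
    qed
    obtain J0 where "J0 \<in> c" using c by auto
    then have "0 \<in> \<Union>c" "I \<subseteq> \<Union>c" using cD(2) cS by auto
    moreover have "\<Union>c \<subseteq> A" using cD(1) by blast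
    moreover have "x * y \<in> \<Union>c" if "x \<in> A" "y \<in> \<Union>c" for x y
      using that cD(4) by blast
    ultimately have "ideal_in (\<Union>c) A" using add unfolding ideal_in_def by (intro conjI ballI)
    moreover have "s ^ k \<notin> \<Union>c" for k using cS by auto
    ultimately show "\<Union>c \<in> ?S" using \<open>I \<subseteq> \<Union>c\<close> by simp
  qed
  then obtain M where M: "M \<in> ?S" and max: "\<And>X. X \<in> ?S \<Longrightarrow> M \<subseteq> X \<Longrightarrow> X = M" by (elim bexE) auto
  from M have MI: "ideal_in M A" and MI2: "I \<subseteq> M" and Ms: "\<And>k. s ^ k \<notin> M" by auto
  have ex: "\<exists>k a m. a \<in> A \<and> m \<in> M \<and> s ^ k = a * x + m" if x: "x \<in> A" "x \<notin> M" for x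
  proof -
    define X where "X = {a * x + m | a m. a \<in> A \<and> m \<in> M}"
    have XI: "a * x + m \<in> X" if "a \<in> A" "m \<in> M" for a m using that unfolding X_def by blast
    have XE: "\<exists>a m. a \<in> A \<and> m \<in> M \<and> z = a * x + m" if "z \<in> X" for z using that unfolding X_def by blast
    have "M \<subseteq> X" 
    proof
      fix m assume "m \<in> M" then show "m \<in> X" using XI[OF AD(1)] by simp
    qed
    have "x \<in> X" using XI[OF AD(2) ideal_inD(2)[OF MI]] by simp
    have "ideal_in X A"
      unfolding ideal_in_def
    proof (intro conjI ballI)
      show "X \<subseteq> A" using ideal_inD(1)[OF MI] x AD(4,6) by (auto dest!: XE)
      show "0 \<in> X" using \<open>M \<subseteq> X\<close> ideal_inD(2)[OF MI] by (rule subsetD)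
      fix y z assume "y \<in> X" "z \<in> X"
      then obtain a m b k where "y = a * x + m" "z = b * x + k" "a \<in> A" "b \<in> A" "m \<in> M" "k \<in> M" by (auto dest!: XE)
      then have "y + z = (a + b) * x + (m + k)" "a + b \<in> A" "m + k \<in> M"
        using ideal_inD[OF MI] AD by (auto simp: distrib_right)
      then show "y + z \<in> X" using XI by simp
    next
      fix y z assume "y \<in> A" "z \<in> X"
      then obtain b k where "z = b * x + k" "b \<in> A" "k \<in> M" by (auto dest!: XE)
      then have "y * z = (y * b) * x + (y * k)" "y * b \<in> A" "y * k \<in> M"
        using ideal_inD[OF MI] AD \<open>y \<in> A\<close> by (auto simp: distrib_left mult.assoc)
      then show "y * z \<in> X" using XI by simp
    qed
    have "\<exists>k. s ^ k \<in> X"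
    proof (rule ccontr)
      assume "\<not> ?thesis"
      then have "X \<in> ?S" using \<open>ideal_in X A\<close> MI2 \<open>M \<subseteq> X\<close> by simp
      then have "X = M" by (rule max) fact
      then show False using \<open>x \<in> X\<close> x by simp
    qed
    then show ?thesis using XE by blast
  qed
  have "x \<in> M \<or> y \<in> M" if xy: "x \<in> A" "y \<in> A" "x * y \<in> M" for x y
  proof (rule ccontr)
    assume "\<not> ?thesis"
    then have "x \<notin> M" "y \<notin> M" by auto
    with ex[OF xy(1)] ex[OF xy(2)] obtain k a m l b n where
      1: "a \<in> A" "m \<in> M" "s ^ k = a * x + m" "b \<in> A" "n \<in> M" "s ^ l = b * y + n" by auto
    have "s ^ (k + l) = (a * b) * (x * y) + (a * x) * n + (b * y) * m + n * m"
      by (simp add: 1 power_add algebra_simps)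
    moreover have "n \<in> A" using MI 1 by (auto simp: ideal_in_def)
    ultimately have "s ^ (k + l) \<in> M" using ideal_inD[OF MI] 1 xy AD by simp
    then show False using Ms by blast
  qed
  then have "prime_in M A" using MI Ms[of 0] by (auto simp: prime_in_def)
  then show ?thesis using that[of M] MI2 Ms[of 1] by auto
qed

section \<open>Univariate polynomials over a subring, pseudo-division and extension of
  points\<close>

definition polys_over :: "'b::comm_ring_1 set \<Rightarrow> 'b poly set" where
  "polys_over A = {p. \<forall>i. coeff p i \<in> A}"

lemma is_subring_polys_over: "is_subring A \<Longrightarrow> is_subring (polys_over A)"
  unfolding is_subring_def[of "polys_over A"]
  by (auto simp: polys_over_def coeff_mult is_subringD coeff_1 intro!: is_subring_sum)

lemma polys_over_const: "is_subring A \<Longrightarrow> [:a:] \<in> polys_over A \<longleftrightarrow> a \<in> A"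
  by (auto simp: polys_over_def coeff_pCons is_subringD split: nat.splits)

lemma polys_over_monom: "is_subring A \<Longrightarrow> a \<in> A \<Longrightarrow> monom a n \<in> polys_over A"
  by (auto simp: polys_over_def is_subringD)

lemma polys_over_smult: "is_subring A \<Longrightarrow> a \<in> A \<Longrightarrow> p \<in> polys_over A \<Longrightarrow> smult a p \<in> polys_over A"
  by (auto simp: polys_over_def is_subringD)

lemma degree_diff_lead:
  fixes p q :: "'b::comm_ring_1 poly"
  assumes "degree p \<le> n" "degree q \<le> n" "coeff p n = coeff q n" "0 < n"
  shows "degree (p - q) < n"
proof -
  have "degree (p - q) \<le> n" using assms degree_diff_le_max[of p q] by simp
  moreover have "degree (p - q) \<noteq> n"
  proof
    assume "degree (p - q) = n"
    moreover have "coeff (p - q) n = 0" using assms by simp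
    ultimately have "p - q = 0" using leading_coeff_0_iff[of "p - q"] by simp
    then show False using \<open>degree (p - q) = n\<close> assms by simp
  qed
  ultimately show ?thesis by simp
qed

text \<open>The coefficients come from a ring, so every cancellation of a top term costs one factor
  of the leading coefficient of \<open>g\<close>. The bound on the quotient is what places it below
  the degree of \<open>f\<close> when \<open>g\<close> is the shorter, nonconstant
  polynomial.\<close>

lemma pseudo_division:
  fixes f g :: "'b::comm_ring_1 poly"
  assumes A: "is_subring A" and g: "g \<in> polys_over A" "0 < degree g" and "f \<in> polys_over A"
  shows "\<exists>k. \<exists>q\<in>polys_over A. \<exists>r\<in>polys_over A.
    smult (lead_coeff g ^ k) f = q * g + r \<and> degree r < degree g \<and> degree q \<le> degree f - degree g"
  using assms(4)
proof (induction "degree f" arbitrary: f rule: less_induct)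
  case less
  note AD = is_subringD[OF A] and PD = is_subringD[OF is_subring_polys_over[OF A]]
  show ?case
  proof (cases "degree f < degree g")
    case True
    then show ?thesis using PD(1) less.prems by (intro exI[of _ 0] bexI[of _ 0] bexI[of _ f]) auto
  next
    case False
    let ?m = "monom (lead_coeff f) (degree f - degree g)"
    define f1 where "f1 = smult (lead_coeff g) f - ?m * g"
    have mem: "?m \<in> polys_over A" using polys_over_monom[OF A] less.prems by (auto simp: polys_over_def)
    have lg: "lead_coeff g \<in> A" using g by (auto simp: polys_over_def)
    have f1: "f1 \<in> polys_over A" unfolding f1_def
      using PD mem g polys_over_smult[OF A lg less.prems] by auto
    have "degree (?m * g) \<le> degree f"
      using False degree_mult_le[of ?m g] degree_monom_le[of "lead_coeff f" "degree f - degree g"] by linarith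
    moreover have "coeff (?m * g) (degree f) = lead_coeff f * lead_coeff g"
      using False by (simp add: coeff_monom_mult)
    ultimately have d1: "degree f1 < degree f"
      unfolding f1_def using False g(2) by (intro degree_diff_lead) (auto simp: degree_smult_le mult.commute)
    from less.hyps[OF d1 f1] obtain k q r where
      1: "q \<in> polys_over A" "r \<in> polys_over A" "smult (lead_coeff g ^ k) f1 = q * g + r"
      "degree r < degree g" "degree q \<le> degree f1 - degree g" by blast
    let ?q = "q + smult (lead_coeff g ^ k) ?m"
    have "smult (lead_coeff g ^ Suc k) f = smult (lead_coeff g ^ k) (f1 + ?m * g)"
      by (simp add: f1_def mult.commute)
    also have "\<dots> = ?q * g + r"
      using 1(3) by (simp add: smult_add_right algebra_simps)
    finally have "smult (lead_coeff g ^ Suc k) f = ?q * g + r" .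
    moreover have "?q \<in> polys_over A" using 1 PD mem polys_over_smult[OF A] AD(7)[OF lg] by auto
    moreover have "degree ?q \<le> degree f - degree g"
    proof (rule degree_add_le)
      show "degree q \<le> degree f - degree g" using 1(5) d1 by linarith
      show "degree (smult (lead_coeff g ^ k) ?m) \<le> degree f - degree g"
        using degree_smult_le[of "lead_coeff g ^ k" ?m] degree_monom_le[of "lead_coeff f" "degree f - degree g"]
        by linarith
    qed
    ultimately show ?thesis using 1(2,4) by blast
  qed
qed

lemma minimal_degree:
  assumes "\<exists>p::'b::comm_ring_1 poly. P p"
  obtains p where "P p" "\<And>q. P q \<Longrightarrow> degree p \<le> degree q"
  using assms ex_has_least_nat[of P _ degree] by metis

lemma is_subfieldD:
  assumes "is_subfield S"
  shows "0 \<in> S" "1 \<in> S" "x \<in> S \<Longrightarrow> y \<in> S \<Longrightarrow> x + y \<in> S" "x \<in> S \<Longrightarrow> y \<in> S \<Longrightarrow> x * y \<in> S"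
    "x \<in> S \<Longrightarrow> - x \<in> S" "x \<in> S \<Longrightarrow> inverse x \<in> S" "x \<in> S \<Longrightarrow> y \<in> S \<Longrightarrow> x - y \<in> S"
    "x \<in> S \<Longrightarrow> y \<in> S \<Longrightarrow> x / y \<in> S"
  using assms unfolding is_subfield_def diff_conv_add_uminus divide_inverse by blast+

lemma is_subring_subfield: "is_subfield S \<Longrightarrow> is_subring S"
  by (auto simp: is_subring_def is_subfieldD)

lemma infinite_algebraically_closed:
  assumes "algebraically_closed_subfield (C :: 'a::field set)"
  shows "infinite C"
proof
  assume fin: "finite C"
  have C: "is_subfield C" and root: "\<And>p. (\<forall>i. coeff p i \<in> C) \<Longrightarrow> degree p > 0 \<Longrightarrow> \<exists>x\<in>C. poly p x = 0"
    using assms by (auto simp: algebraically_closed_subfield_def)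
  note CD = is_subfieldD[OF C]
  \<comment> \<open>Over a finite \<open>C\<close> this polynomial takes the value 1 at every
    element of \<open>C\<close>, hence has no root there.\<close>
  let ?p = "(\<Prod>c\<in>C. [:- c, 1:]) + 1"
  have P: "is_subring (polys_over C)" by (rule is_subring_polys_over[OF is_subring_subfield[OF C]])
  have "(\<Prod>c\<in>C. [:- c, 1:]) \<in> polys_over C"
    by (rule is_subring_prod[OF P]) (auto simp: polys_over_def coeff_pCons CD split: nat.splits)
  then have "?p \<in> polys_over C" by (rule is_subringD(6)[OF P _ is_subringD(2)[OF P]])
  moreover have dp: "degree (\<Prod>c\<in>C. [:- c, 1:]) = card C"
    by (subst degree_prod_eq_sum_degree) auto
  moreover have "0 < card C" using fin CD(1) card_gt_0_iff by blast
  ultimately have "degree ?p > 0" by (subst degree_add_eq_left) auto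
  from root[OF _ this] \<open>?p \<in> polys_over C\<close> obtain x where x: "x \<in> C" "poly ?p x = 0"
    by (auto simp: polys_over_def)
  then have "poly (\<Prod>c\<in>C. [:- c, 1:]) x = 0" using fin by (auto simp: poly_prod prod_zero_iff)
  then show False using x by simp
qed

lemma coeff_const_ideal:
  assumes A: "is_subring A" and Q: "ideal_in Q (polys_over A)" 
    and p: "p \<in> polys_over A" "\<And>i. [:coeff p i:] \<in> Q"
  shows "p \<in> Q"
proof -
  have "monom 1 i * [:coeff p i:] = monom (coeff p i) i" for i
    by (simp add: smult_monom)
  then have p_eq: "p = (\<Sum>i\<le>degree p. monom 1 i * [:coeff p i:])"
    by (simp add: poly_as_sum_of_monoms)
  have sumQ: "sum f I \<in> Q" if "\<And>i. i \<in> I \<Longrightarrow> f i \<in> Q" for f and I :: "nat set"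
    using that by (induction I rule: infinite_finite_induct) (auto simp: ideal_inD[OF Q])
  have mQ: "monom 1 i * [:coeff p i:] \<in> Q" for i
    by (rule ideal_inD(4)[OF Q polys_over_monom[OF A is_subringD(2)[OF A]] p(2)])
  show ?thesis by (subst p_eq, rule sumQ, rule mQ)
qed

lemma prime_inD:
  assumes "prime_in Q A"
  shows "ideal_in Q A" "1 \<notin> Q" "x \<in> A \<Longrightarrow> y \<in> A \<Longrightarrow> x * y \<in> Q \<Longrightarrow> x \<in> Q \<or> y \<in> Q"
  using assms by (auto simp: prime_in_def)

lemma prime_in_power:
  assumes "is_subring A" "prime_in Q A" "x \<in> A" "x ^ k \<in> Q"
  shows "x \<in> Q"
  using assms(4)
proof (induction k)
  case 0
  then show ?case using prime_inD(2)[OF assms(2)] by simp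
next
  case (Suc k)
  then show ?case using prime_inD(3)[OF assms(2,3) is_subringD(7)[OF assms(1,3)], of k] by auto
qed

text \<open>In the quotient by \<open>Q\<close> the variable is either transcendental over the coefficients, or
  \<open>b\<close> divides a nonzero coefficient there; a suitable leading coefficient or that multiple of
  \<open>b\<close> is the denominator \<open>a\<close>.\<close>

lemma extend_point:
  fixes A :: "'b::comm_ring_1 set" and C :: "'a::field set"
  assumes A: "is_subring A" and Q: "prime_in Q (polys_over A)"
    and b: "b \<in> polys_over A" "b \<notin> Q"
    and C: "algebraically_closed_subfield C"
  shows "\<exists>a\<in>A. [:a:] \<notin> Q \<and>
    (\<forall>\<phi>. comm_ring_hom \<phi> \<and> \<phi> ` A \<subseteq> C \<and> (\<forall>x\<in>A. [:x:] \<in> Q \<longrightarrow> \<phi> x = 0) \<and> \<phi> a \<noteq> 0 \<longrightarrow>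
      (\<exists>c\<in>C. (\<forall>q\<in>Q. poly (map_poly \<phi> q) c = 0) \<and> poly (map_poly \<phi> b) c \<noteq> 0))"
proof -
  note AD = is_subringD[OF A] and PD = is_subringD[OF is_subring_polys_over[OF A]]
  note Qi = prime_inD(1)[OF Q] and Qp = prime_inD(3)[OF Q]
  note QD = ideal_inD[OF Qi] and Qdiff = ideal_in_diff[OF is_subring_polys_over[OF A] Qi]
  have Cf: "is_subfield C" using C by (simp add: algebraically_closed_subfield_def)
  have coefA: "coeff p i \<in> A" if "p \<in> polys_over A" for p i using that by (auto simp: polys_over_def)
  have cA: "[:x:] \<in> polys_over A" if "x \<in> A" for x using that polys_over_const[OF A] by blast
  have cmult: "[:x * y:] \<in> Q \<Longrightarrow> [:x:] \<in> Q \<or> [:y:] \<in> Q" if "x \<in> A" "y \<in> A" for x y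
    using Qp[OF cA cA, of x y] that by (simp add: mult.commute)
  \<comment> \<open>\<open>red\<close> is the ideal generated by the constants in \<open>Q\<close>;
    modulo it there remains a polynomial ring over a domain. \<open>Q \<subseteq> red\<close> says
    that the variable is transcendental modulo \<open>Q\<close>.\<close>
  define red where "red = {q \<in> polys_over A. \<forall>i. [:coeff q i:] \<in> Q}"
  have redQ: "red \<subseteq> Q" using coeff_const_ideal[OF A Qi] by (auto simp: red_def)
  have lead_drop: "p - monom (lead_coeff p) (degree p) \<in> polys_over A"
    "[:lead_coeff p:] \<in> Q \<Longrightarrow> monom (lead_coeff p) (degree p) \<in> red"
    if "p \<in> polys_over A" for p
    using PD(3)[OF that polys_over_monom[OF A coefA[OF that]]] polys_over_monom[OF A coefA[OF that]] QD(2)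
    by (auto simp: red_def)
  have deg_drop: "degree (p - monom (lead_coeff p) (degree p)) < degree p" if "0 < degree p" for p :: "'b poly"
    by (rule degree_diff_lead) (auto simp: degree_monom_le that)
  show ?thesis
  proof (cases "Q \<subseteq> red")
    case True
    obtain i where i: "[:coeff b i:] \<notin> Q" using b redQ by (auto simp: red_def)
    \<comment> \<open>Every member of \<open>Q\<close> maps to 0 here, so any \<open>c\<close> in
      the infinite set \<open>C\<close> outside the finitely many roots of the image of
      \<open>b\<close> will do; \<open>coeff b i\<close> keeps that image nonzero.\<close>
    show ?thesis
    proof (intro bexI[of _ "coeff b i"] conjI allI impI)
      fix \<phi> :: "'b \<Rightarrow> 'a"
      assume \<phi>: "comm_ring_hom \<phi> \<and> \<phi> ` A \<subseteq> C \<and> (\<forall>x\<in>A. [:x:] \<in> Q \<longrightarrow> \<phi> x = 0) \<and> \<phi> (coeff b i) \<noteq> 0"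
      then interpret comm_ring_hom \<phi> by simp
      have "coeff (map_poly \<phi> b) i \<noteq> 0" using \<phi> by simp
      then have nz: "map_poly \<phi> b \<noteq> 0" by (metis coeff_0)
      then have "finite {c. poly (map_poly \<phi> b) c = 0}" by (rule poly_roots_finite)
      then obtain c where c: "c \<in> C" "poly (map_poly \<phi> b) c \<noteq> 0"
        using infinite_algebraically_closed[OF C] by (metis (mono_tags, lifting) finite_subset mem_Collect_eq subsetI)
      have "map_poly \<phi> q = 0" if "q \<in> Q" for q
        using True that \<phi> by (intro poly_eqI) (auto simp: red_def polys_over_def)
      then show "\<exists>c\<in>C. (\<forall>q\<in>Q. poly (map_poly \<phi> q) c = 0) \<and> poly (map_poly \<phi> b) c \<noteq> 0"
        using c by auto
    qed (use i coefA b in auto)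
  next
    case False
    then have "\<exists>g. g \<in> Q \<and> g \<notin> red" by auto
    \<comment> \<open>\<open>g\<close> plays the role of a minimal polynomial of the variable modulo
      \<open>Q\<close>: below its degree, \<open>Q\<close> contains nothing but members of
      \<open>red\<close>.\<close>
    then obtain g where g: "g \<in> Q" "g \<notin> red" and gmin: "\<And>p. p \<in> Q \<and> p \<notin> red \<Longrightarrow> degree g \<le> degree p"
      using minimal_degree[of "\<lambda>g. g \<in> Q \<and> g \<notin> red"] by metis
    have gA: "g \<in> polys_over A" using g QD(1) by auto
    have low: "p \<in> red" if "p \<in> Q" "degree p < degree g" for p using gmin[of p] that by auto
    have dg: "0 < degree g"
    proof (rule ccontr)
      assume "\<not> ?thesis"
      then obtain x where x: "g = [:x:]" by (auto elim: degree_eq_zeroE)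
      have "[:coeff [:x:] i:] \<in> Q" for i using g(1) QD(2) x by (cases i) auto
      then show False using g(2) gA x by (auto simp: red_def)
    qed
    have lgQ: "[:lead_coeff g:] \<notin> Q"
    proof
      assume *: "[:lead_coeff g:] \<in> Q"
      let ?m = "monom (lead_coeff g) (degree g)"
      have m: "?m \<in> red" using lead_drop(2)[OF gA *] .
      then have "g - ?m \<in> Q" using redQ g(1) by (intro Qdiff) auto
      then have "g - ?m \<in> red" using low deg_drop[OF dg] by blast
      then have "[:coeff g i:] \<in> Q" for i
        using QD(3)[of "[:coeff (g - ?m) i:]" "[:coeff ?m i:]"] m by (auto simp: red_def)
      then show False using g(2) gA by (auto simp: red_def)
    qed
    \<comment> \<open>The multiples of \<open>b\<close> modulo \<open>Q\<close> that are nonzero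
      there. A constant \<open>e0\<close> among them certifies that \<open>b\<close> cannot vanish
      at a zero of \<open>Q\<close> where \<open>e0\<close> does not.\<close>
    define E where "E = {p \<in> polys_over A. p \<notin> Q \<and> (\<exists>s\<in>polys_over A. p - s * b \<in> Q)}"
    have "b \<in> E" using b PD(2) QD(2) by (auto simp: E_def intro!: bexI[of _ 1])
    then obtain e where e: "e \<in> E" and emin: "\<And>p. p \<in> E \<Longrightarrow> degree e \<le> degree p"
      using minimal_degree[of "\<lambda>p. p \<in> E"] by metis
    have eA: "e \<in> polys_over A" and eQ: "e \<notin> Q" using e by (auto simp: E_def)
    obtain s where s: "s \<in> polys_over A" "e - s * b \<in> Q" using e by (auto simp: E_def)
    have EI: "p \<in> E" if "p \<in> polys_over A" "p \<notin> Q" "t \<in> polys_over A" "p - t * e \<in> Q" for p t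
    proof -
      have "p - (t * s) * b = (p - t * e) + t * (e - s * b)" by (simp add: algebra_simps)
      also have "\<dots> \<in> Q" using QD(3)[OF that(4) QD(4)[OF that(3) s(2)]] .
      finally show ?thesis using that PD(4)[OF that(3) s(1)] by (auto simp: E_def)
    qed
    have leQ: "[:lead_coeff e:] \<notin> Q"
    proof
      assume *: "[:lead_coeff e:] \<in> Q"
      let ?m = "monom (lead_coeff e) (degree e)"
      have mQ: "?m \<in> Q" using lead_drop(2)[OF eA *] redQ by auto
      show False
      proof (cases "degree e = 0")
        case True
        then obtain x where "e = [:x:]" by (auto elim: degree_eq_zeroE)
        then show False using eQ * by simp
      next
        case False
        have "e - ?m \<notin> Q" using QD(3)[of "e - ?m" ?m] mQ eQ by auto
        moreover have "e - ?m - 1 * e \<in> Q" using Qdiff[OF QD(2) mQ] by simp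
        ultimately have "e - ?m \<in> E" using lead_drop(1)[OF eA] PD(2) by (intro EI[where t = 1])
        then show False using emin deg_drop[of e] False by fastforce
      qed
    qed
    \<comment> \<open>A Euclidean argument. Dividing \<open>e\<close> by \<open>g\<close> shows
      \<open>degree e < degree g\<close>. Dividing \<open>g\<close> by \<open>e\<close> leaves a
      remainder too short for \<open>E\<close>, hence in \<open>Q\<close>, and so a quotient in
      \<open>Q\<close>. The quotient has degree below that of \<open>g\<close>, so it lies in
      \<open>red\<close>; comparing coefficients at \<open>degree g\<close> then puts a product of
      leading coefficients into \<open>Q\<close>, which is impossible.\<close>
    have de: "degree e = 0"
    proof (rule ccontr)
      assume de: "degree e \<noteq> 0"
      obtain k q r where 1: "q \<in> polys_over A" "r \<in> polys_over A" "smult (lead_coeff g ^ k) e = q * g + r" "degree r < degree g"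
        using pseudo_division[OF A gA dg eA] by blast
      have lgA: "lead_coeff g \<in> A" "lead_coeff e \<in> A" using coefA gA eA by auto
      have nQ: "[:x ^ k:] \<notin> Q" if "x \<in> A" "[:x:] \<notin> Q" for x k
        using prime_in_power[OF is_subring_polys_over[OF A] Q cA[OF that(1)], of k] that(2)
        by (auto simp: poly_const_pow)
      have deg: "degree e < degree g"
      proof -
        have eqr: "[:lead_coeff g ^ k:] * e = q * g + r" using 1(3) by simp
        have "r \<notin> Q"
        proof
          assume "r \<in> Q"
          then have "[:lead_coeff g ^ k:] * e \<in> Q" unfolding eqr using QD(3,4) g(1) 1(1) by blast
          then show False using Qp[OF cA[OF AD(7)[OF lgA(1)]] eA] eQ nQ lgA lgQ by blast
        qed
        moreover have "r - [:lead_coeff g ^ k:] * e \<in> Q"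
          unfolding eqr using QD(4)[OF PD(5)[OF 1(1)] g(1)] by simp
        ultimately have "r \<in> E" using 1(2) cA[OF AD(7)[OF lgA(1)]] by (intro EI)
        then show ?thesis using emin 1(4) by fastforce
      qed
      have "0 < degree e" using de by simp
      from pseudo_division[OF A eA this gA]
      obtain k q r where 2: "q \<in> polys_over A" "r \<in> polys_over A" "smult (lead_coeff e ^ k) g = q * e + r" 
        "degree r < degree e" "degree q \<le> degree g - degree e" by blast
      have eqr: "[:lead_coeff e ^ k:] * g = q * e + r" using 2(3) by simp
      have gQ: "[:lead_coeff e ^ k:] * g \<in> Q" using QD(4)[OF cA[OF AD(7)[OF lgA(2)]] g(1)] .
      have "r - (- q) * e \<in> Q" using gQ unfolding eqr by (simp add: add.commute)
      then have "r \<in> Q" using EI[OF 2(2) _ PD(5)[OF 2(1)]] emin[of r] 2(4) by fastforce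
      then have "q * e \<in> Q" using Qdiff[OF gQ] unfolding eqr by fastforce
      then have "q \<in> Q" using Qp[OF 2(1) eA] eQ by blast
      then have "q \<in> red" using low 2(5) deg de by simp
      have sumQ: "[:sum f I:] \<in> Q" if "\<And>i. i \<in> I \<Longrightarrow> [:f i:] \<in> Q" for f and I :: "nat set"
        using that
      proof (induction I rule: infinite_finite_induct)
        case (insert x F)
        then show ?case using QD(3)[of "[:f x:]" "[:sum f F:]"] by auto
      qed (auto simp: QD(2))
      have "[:coeff (q * e) (degree g):] \<in> Q" unfolding coeff_mult
      proof (rule sumQ)
        fix i
        show "[:coeff q i * coeff e (degree g - i):] \<in> Q"
          using QD(5)[OF cA[OF coefA[OF eA]], of "[:coeff q i:]"] \<open>q \<in> red\<close>
          by (simp add: red_def mult.commute[of "coeff q i"])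
      qed
      moreover have "coeff r (degree g) = 0" using 2(4) deg by (intro coeff_eq_0) simp
      ultimately have "[:coeff (q * e + r) (degree g):] \<in> Q" by simp
      then have "[:lead_coeff e ^ k * lead_coeff g:] \<in> Q" unfolding eqr[symmetric] by simp
      then show False using cmult[OF AD(7)[OF lgA(2)] lgA(1)] nQ[OF lgA(2) leQ] lgQ by blast
    qed
    then obtain e0 where e0: "e = [:e0:]" by (auto elim: degree_eq_zeroE)
    have e0A: "e0 \<in> A" and lgA: "lead_coeff g \<in> A" using polys_over_const[OF A] eA e0 coefA[OF gA] by auto
    \<comment> \<open>The factor \<open>lead_coeff g\<close> keeps the image of \<open>g\<close>
      nonconstant, so that it has a root \<open>c\<close> in \<open>C\<close>, and can be cancelled
      after pseudo-division by \<open>g\<close>; the factor \<open>e0\<close> keeps the image of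
      \<open>b\<close> nonzero at \<open>c\<close>.\<close>
    show ?thesis
    proof (intro bexI[of _ "e0 * lead_coeff g"] conjI allI impI)
      show "[:e0 * lead_coeff g:] \<notin> Q" using cmult[OF e0A lgA] lgQ eQ e0 by auto
      show "e0 * lead_coeff g \<in> A" using AD(4) e0A lgA by auto
      fix \<phi> :: "'b \<Rightarrow> 'a"
      assume "comm_ring_hom \<phi> \<and> \<phi> ` A \<subseteq> C \<and> (\<forall>x\<in>A. [:x:] \<in> Q \<longrightarrow> \<phi> x = 0) \<and> \<phi> (e0 * lead_coeff g) \<noteq> 0"
      then have h: "comm_ring_hom \<phi>" and \<phi>C: "\<phi> ` A \<subseteq> C" and \<phi>0: "\<And>x. x \<in> A \<Longrightarrow> [:x:] \<in> Q \<Longrightarrow> \<phi> x = 0"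
        and nz: "\<phi> (e0 * lead_coeff g) \<noteq> 0" by auto
      interpret comm_ring_hom \<phi> by (rule h)
      interpret mp: map_poly_comm_ring_hom \<phi> ..
      have nz: "\<phi> e0 \<noteq> 0" "\<phi> (lead_coeff g) \<noteq> 0" using nz by (auto simp: hom_mult)
      have "coeff (map_poly \<phi> g) (degree g) \<noteq> 0" using nz(2) by simp
      then have "degree (map_poly \<phi> g) > 0" using le_degree[of "map_poly \<phi> g" "degree g"] dg by linarith
      moreover have "\<forall>i. coeff (map_poly \<phi> g) i \<in> C" using \<phi>C coefA[OF gA] by auto
      ultimately obtain c where c: "c \<in> C" "poly (map_poly \<phi> g) c = 0"
        using C unfolding algebraically_closed_subfield_def by blast
      have zero: "poly (map_poly \<phi> q) c = 0" if "q \<in> Q" for q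
      proof -
        have qA: "q \<in> polys_over A" using QD(1) that by blast
        obtain k t r where 1: "t \<in> polys_over A" "r \<in> polys_over A" "smult (lead_coeff g ^ k) q = t * g + r" 
          "degree r < degree g" using pseudo_division[OF A gA dg qA] by blast
        have eqr: "[:lead_coeff g ^ k:] * q = t * g + r" using 1(3) by simp
        have "[:lead_coeff g ^ k:] * q - t * g \<in> Q"
          using Qdiff[OF QD(4)[OF cA[OF AD(7)[OF lgA]] that] QD(4)[OF 1(1) g(1)]] .
        then have "r \<in> Q" unfolding eqr by simp
        then have "r \<in> red" using low 1(4) by blast
        then have "map_poly \<phi> r = 0" using \<phi>0 by (intro poly_eqI) (auto simp: red_def polys_over_def)
        then have "map_poly \<phi> ([:lead_coeff g ^ k:] * q) = map_poly \<phi> t * map_poly \<phi> g"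
          unfolding eqr by (simp add: mp.hom_mult mp.hom_add)
        then have "poly (map_poly \<phi> ([:lead_coeff g ^ k:] * q)) c = 0" using c by simp
        then have "\<phi> (lead_coeff g) ^ k * poly (map_poly \<phi> q) c = 0"
          unfolding mp.hom_mult poly_mult by (simp add: hom_distribs)
        then show ?thesis using nz by simp
      qed
      moreover have "poly (map_poly \<phi> b) c \<noteq> 0"
      proof
        assume "poly (map_poly \<phi> b) c = 0"
        moreover have "poly (map_poly \<phi> (e - s * b)) c = 0" using zero s by blast
        ultimately have "poly (map_poly \<phi> e) c = 0" by (simp add: mp.hom_mult mp.hom_minus)
        then show False using nz e0 by (simp add: hom_distribs)
      qed
      ultimately show "\<exists>c\<in>C. (\<forall>q\<in>Q. poly (map_poly \<phi> q) c = 0) \<and> poly (map_poly \<phi> b) c \<noteq> 0"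
        using c by blast
    qed
  qed
qed

section \<open>Polynomial functions and a Nullstellensatz over \<open>C\<close>\<close>

inductive_set polyfun :: "'a::field set \<Rightarrow> nat \<Rightarrow> ((nat \<Rightarrow> 'a) \<Rightarrow> 'a) set"
  for S :: "'a set" and N :: nat where
  const: "c \<in> S \<Longrightarrow> (\<lambda>x. c) \<in> polyfun S N"
| var: "i < N \<Longrightarrow> (\<lambda>x. x i) \<in> polyfun S N"
| add: "f \<in> polyfun S N \<Longrightarrow> g \<in> polyfun S N \<Longrightarrow> (\<lambda>x. f x + g x) \<in> polyfun S N"
| mult: "f \<in> polyfun S N \<Longrightarrow> g \<in> polyfun S N \<Longrightarrow> (\<lambda>x. f x * g x) \<in> polyfun S N"

lemma is_subring_polyfun:
  assumes "is_subfield S"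
  shows "is_subring (polyfun S N)"
proof -
  note SD = is_subfieldD[OF assms]
  have "f - g \<in> polyfun S N" if "f \<in> polyfun S N" "g \<in> polyfun S N" for f g
    using polyfun.add[OF that(1) polyfun.mult[OF polyfun.const[OF SD(5)[OF SD(2)]] that(2)]]
    by (simp add: fun_diff_def)
  moreover have "1 \<in> polyfun S N" using polyfun.const[OF SD(2)] by (simp add: one_fun_def)
  moreover have "f * g \<in> polyfun S N" if "f \<in> polyfun S N" "g \<in> polyfun S N" for f g
    using polyfun.mult[OF that] by (simp add: times_fun_def)
  ultimately show ?thesis by (auto simp: is_subring_def)
qed

lemma polyfun_cong:
  "f \<in> polyfun S N \<Longrightarrow> (\<And>i. i < N \<Longrightarrow> x i = y i) \<Longrightarrow> f x = f y"
  by (induction rule: polyfun.induct) auto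

lemma polyfun_mono:
  "f \<in> polyfun S N \<Longrightarrow> S \<subseteq> T \<Longrightarrow> N \<le> M \<Longrightarrow> f \<in> polyfun T M"
  by (induction rule: polyfun.induct) (auto intro: polyfun.intros)

lemma polyfun_value:
  assumes "is_subfield S" "f \<in> polyfun S N" "\<And>i. i < N \<Longrightarrow> x i \<in> S"
  shows "f x \<in> S"
  using assms(2,3) by (induction rule: polyfun.induct) (auto simp: is_subfieldD[OF assms(1)])

lemma comm_ring_hom_eval: "comm_ring_hom (\<lambda>f :: 'x \<Rightarrow> 'a::comm_ring_1. f x)"
  by standard auto

text \<open>Prepares the induction on the number of variables: the last coordinate becomes the
  variable of a univariate polynomial whose coefficients are functions of the earlier ones.\<close>

lemma polyfun_Suc:
  assumes S: "is_subfield S" and "f \<in> polyfun S (Suc N)"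
  obtains p where "p \<in> polys_over (polyfun S N)" "f = poly p (\<lambda>x. x N)"
proof -
  note A = is_subring_polyfun[OF S, of N]
  note P = is_subringD[OF is_subring_polys_over[OF A]]
  let ?v = "\<lambda>x :: nat \<Rightarrow> 'a. x N"
  have "\<exists>p\<in>polys_over (polyfun S N). f = poly p ?v"
    using assms(2)
  proof (induction rule: polyfun.induct)
    case (const c)
    then show ?case using polys_over_const[OF A] polyfun.const by (intro bexI[of _ "[:\<lambda>x. c:]"]) auto
  next
    case (var i)
    show ?case
    proof (cases "i = N")
      case True
      then show ?thesis
        using is_subringD[OF A]
        by (intro bexI[of _ "[:0, 1:]"]) (auto simp: polys_over_def coeff_pCons split: nat.splits)
    next
      case False
      then have "(\<lambda>x. x i) \<in> polyfun S N" using var by (intro polyfun.var) auto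
      then show ?thesis using polys_over_const[OF A] by (intro bexI[of _ "[:\<lambda>x. x i:]"]) auto
    qed
  next
    case (add f g)
    then obtain p q where "p \<in> polys_over (polyfun S N)" "f = poly p ?v" "q \<in> polys_over (polyfun S N)" "g = poly q ?v" by blast
    then show ?case using P(6) by (intro bexI[of _ "p + q"]) (auto simp: fun_eq_iff)
  next
    case (mult f g)
    then obtain p q where "p \<in> polys_over (polyfun S N)" "f = poly p ?v" "q \<in> polys_over (polyfun S N)" "g = poly q ?v" by blast
    then show ?case using P(4) by (intro bexI[of _ "p * q"]) (auto simp: fun_eq_iff)
  qed
  then show ?thesis using that by blast
qed

lemma polyfun_Suc_conv:
  assumes S: "is_subfield S" and "p \<in> polys_over (polyfun S N)"
  shows "poly p (\<lambda>x. x N) \<in> polyfun S (Suc N)"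
proof -
  note A = is_subringD[OF is_subring_polyfun[OF S]]
  have "coeff p i * (\<lambda>x. x N) ^ i \<in> polyfun S (Suc N)" for i
  proof (rule A(4))
    show "coeff p i \<in> polyfun S (Suc N)" using assms(2) by (auto simp: polys_over_def intro: polyfun_mono)
    show "(\<lambda>x. x N) ^ i \<in> polyfun S (Suc N)" by (rule A(7), rule polyfun.var) simp
  qed
  then show ?thesis unfolding poly_altdef by (intro is_subring_sum[OF is_subring_polyfun[OF S]]) auto
qed

text \<open>The coefficients do not see coordinate \<open>N\<close>, so changing it affects only the
  place where the univariate polynomial is evaluated.\<close>

lemma eval_poly_last:
  assumes "p \<in> polys_over (polyfun S N)"
  shows "poly p (\<lambda>x. x N) (x(N := c)) = poly (map_poly (\<lambda>f. f x) p) c"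
proof -
  interpret e: comm_ring_hom "\<lambda>f :: (nat \<Rightarrow> 'a) \<Rightarrow> 'a. f (x(N := c))" by (rule comm_ring_hom_eval)
  have "map_poly (\<lambda>f. f (x(N := c))) p = map_poly (\<lambda>f. f x) p"
    using assms by (intro poly_eqI) (auto simp: coeff_map_poly polys_over_def intro: polyfun_cong)
  then show ?thesis
    using e.poly_map_poly[of p "\<lambda>x. x N"] by simp
qed

lemma prime_in_restrict:
  assumes A: "is_subring A" and AB: "A \<subseteq> B" and Q: "prime_in Q B"
  shows "prime_in (Q \<inter> A) A"
proof -
  note Qi = ideal_inD[OF prime_inD(1)[OF Q]] and AD = is_subringD[OF A]
  have "x * y \<in> Q" if "x \<in> A" "y \<in> Q" for x y using Qi(4) that AB by blast
  moreover have "x \<in> Q \<or> y \<in> Q" if "x \<in> A" "y \<in> A" "x * y \<in> Q" for x y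
    using prime_inD(3)[OF Q] that AB by blast
  ultimately show ?thesis
    unfolding prime_in_def ideal_in_def using Qi(2,3) AD(1,4,6) prime_inD(2)[OF Q] by simp
qed

text \<open>The last variable is removed by \<open>extend_point\<close>, which asks for a point in
  one dimension less where the denominator \<open>a\<close> is nonzero. This is why the claim
  carries a function \<open>g\<close> to be kept nonzero: the induction hypothesis is used with
  \<open>a\<close> in its place.\<close>

lemma polyfun_point_of_prime:
  fixes C :: "'a::field set"
  assumes C: "algebraically_closed_subfield C"
  shows "prime_in Q (polyfun C N) \<Longrightarrow> g \<in> polyfun C N \<Longrightarrow> g \<notin> Q \<Longrightarrow>
    \<exists>x. (\<forall>i. x i \<in> C) \<and> (\<forall>f\<in>Q. f x = 0) \<and> g x \<noteq> 0"
proof (induction N arbitrary: Q g)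
  case 0
  have Cf: "is_subfield C" using C by (simp add: algebraically_closed_subfield_def)
  define z :: "nat \<Rightarrow> 'a" where "z = (\<lambda>_. 0)"
  have const: "f = (\<lambda>x. f z)" "f z \<in> C" if "f \<in> polyfun C 0" for f
    using polyfun_cong[OF that, of _ z] polyfun_value[OF Cf that, of z] by auto
  \<comment> \<open>Without variables all functions are constants from a field, so a nonzero member
    of \<open>Q\<close> would be a unit.\<close>
  have "f z = 0" if f: "f \<in> Q" for f
  proof (rule ccontr)
    assume nz: "f z \<noteq> 0"
    have fP: "f \<in> polyfun C 0" using f ideal_inD(1)[OF prime_inD(1)[OF 0(1)]] by auto
    then have "(\<lambda>x. inverse (f z)) \<in> polyfun C 0" using const is_subfieldD[OF Cf] by (intro polyfun.const) auto
    then have "(\<lambda>x. inverse (f z)) * f \<in> Q" using ideal_inD(4)[OF prime_inD(1)[OF 0(1)]] f by auto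
    moreover have "f x = f z" for x using const(1)[OF fP] by metis
    then have "inverse (f z) * f x = 1" for x using nz by (metis left_inverse)
    then have "(\<lambda>x. inverse (f z)) * f = 1" by (simp add: fun_eq_iff)
    ultimately show False using prime_inD(2)[OF 0(1)] by simp
  qed
  moreover have "g z \<noteq> 0"
  proof
    assume "g z = 0"
    then have "g x = 0" for x using const(1)[OF 0(2)] by metis
    then have "g = 0" by (simp add: fun_eq_iff)
    then show False using 0(3) ideal_inD(2)[OF prime_inD(1)[OF 0(1)]] by blast
  qed
  moreover have "z i \<in> C" for i using is_subfieldD(1)[OF Cf] by (simp add: z_def)
  ultimately show ?case by blast
next
  case (Suc N)
  have Cf: "is_subfield C" using C by (simp add: algebraically_closed_subfield_def)
  let ?A = "polyfun C N" and ?B = "polyfun C (Suc N)"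
  let ?v = "\<lambda>x :: nat \<Rightarrow> 'a. x N"
  have AB: "?A \<subseteq> ?B" by (auto intro: polyfun_mono)
  note A = is_subring_polyfun[OF Cf, of N] and Qi = prime_inD(1)[OF Suc(2)]
  note conv = polyfun_Suc_conv[OF Cf]
  define P where "P = {p \<in> polys_over ?A. poly p ?v \<in> Q}"
  have P: "prime_in P (polys_over ?A)"
    unfolding prime_in_def ideal_in_def
    using ideal_inD[OF Qi] prime_inD(2,3)[OF Suc(2)] is_subringD[OF is_subring_polys_over[OF A]] conv
    by (auto simp: P_def)
  obtain b where b: "b \<in> polys_over ?A" "g = poly b ?v" using polyfun_Suc[OF Cf Suc(3)] by blast
  then have "b \<notin> P" using Suc(4) by (simp add: P_def)
  from extend_point[OF A P b(1) this C] obtain a where a: "a \<in> ?A" "[:a:] \<notin> P"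
    and ext: "\<And>\<phi>. comm_ring_hom \<phi> \<Longrightarrow> \<phi> ` ?A \<subseteq> C \<Longrightarrow> (\<forall>x\<in>?A. [:x:] \<in> P \<longrightarrow> \<phi> x = 0) \<Longrightarrow> \<phi> a \<noteq> 0 \<Longrightarrow>
      \<exists>c\<in>C. (\<forall>q\<in>P. poly (map_poly \<phi> q) c = 0) \<and> poly (map_poly \<phi> b) c \<noteq> 0" by blast
  have P_const: "[:x:] \<in> P \<longleftrightarrow> x \<in> Q" if "x \<in> ?A" for x
    using that polys_over_const[OF A] by (simp add: P_def)
  have "prime_in (Q \<inter> ?A) ?A" by (rule prime_in_restrict[OF A AB Suc(2)])
  from Suc.IH[OF this a(1)] obtain x where x: "\<And>i. x i \<in> C" "\<forall>f\<in>Q \<inter> ?A. f x = 0" "a x \<noteq> 0"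
    using a P_const by blast
  have "\<exists>c\<in>C. (\<forall>q\<in>P. poly (map_poly (\<lambda>f. f x) q) c = 0) \<and> poly (map_poly (\<lambda>f. f x) b) c \<noteq> 0"
    by (rule ext[OF comm_ring_hom_eval]) (use x P_const polyfun_value[OF Cf] in auto)
  then obtain c where c: "c \<in> C" "\<And>q. q \<in> P \<Longrightarrow> poly (map_poly (\<lambda>f. f x) q) c = 0"
    "poly (map_poly (\<lambda>f. f x) b) c \<noteq> 0" by blast
  have "f (x(N := c)) = 0" if f: "f \<in> Q" for f
  proof -
    have "f \<in> ?B" using f ideal_inD(1)[OF Qi] by auto
    then obtain p where p: "p \<in> polys_over ?A" "f = poly p ?v" using polyfun_Suc[OF Cf] by blast
    then have "p \<in> P" using f by (simp add: P_def)
    then show ?thesis using c(2) eval_poly_last[OF p(1)] p(2) by simp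
  qed
  moreover have "g (x(N := c)) \<noteq> 0" using eval_poly_last[OF b(1)] b(2) c(3) by simp
  ultimately show ?case using x(1) c(1) by (intro exI[of _ "x(N := c)"]) (simp del: fun_upd_apply add: fun_upd_def)
qed


section \<open>Polynomial functions and linear algebra over a subfield\<close>

lemma polyfun_univariate:
  assumes "f \<in> polyfun UNIV N"
  shows "\<exists>q. \<forall>t. f (x(i := t)) = poly q t"
  using assms
proof (induction rule: polyfun.induct)
  case (const c)
  then show ?case by (intro exI[of _ "[:c:]"]) auto
next
  case (var j)
  show ?case by (cases "j = i") (auto intro: exI[of _ "[:0, 1:]"] exI[of _ "[:x j:]"])
next
  case (add f g)
  then obtain p q where "\<forall>t. f (x(i := t)) = poly p t" "\<forall>t. g (x(i := t)) = poly q t" by blast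
  then show ?case by (intro exI[of _ "p + q"]) (simp del: fun_upd_apply)
next
  case (mult f g)
  then obtain p q where "\<forall>t. f (x(i := t)) = poly p t" "\<forall>t. g (x(i := t)) = poly q t" by blast
  then show ?case by (intro exI[of _ "p * q"]) (simp del: fun_upd_apply)
qed

text \<open>Coordinates are freed from \<open>E\<close> one at a time: in a single coordinate
  \<open>f\<close> is a univariate polynomial, and it vanishes on the infinite set
  \<open>E\<close>.\<close>

lemma polyfun_eq_zero:
  assumes f: "f \<in> polyfun UNIV N" and E: "infinite E"
    and zero: "\<And>x. (\<And>i. i < N \<Longrightarrow> x i \<in> E) \<Longrightarrow> f x = 0"
  shows "f x = 0"
proof -
  have "\<forall>x. (\<forall>i. k \<le> i \<and> i < N \<longrightarrow> x i \<in> E) \<longrightarrow> f x = 0" for k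
  proof (induction k)
    case 0
    then show ?case using zero by blast
  next
    case (Suc k)
    show ?case
    proof (intro allI impI)
      fix x assume x: "\<forall>i. Suc k \<le> i \<and> i < N \<longrightarrow> x i \<in> E"
      obtain q where q: "\<forall>t. f (x(k := t)) = poly q t" using polyfun_univariate[OF f] by blast
      have "poly q t = 0" if "t \<in> E" for t
      proof -
        have "(x(k := t)) i \<in> E" if "k \<le> i \<and> i < N" for i
          using that x \<open>t \<in> E\<close> by (cases "i = k") auto
        then have "f (x(k := t)) = 0" using Suc.IH by blast
        then show ?thesis using q by simp
      qed
      then have "E \<subseteq> {t. poly q t = 0}" by auto
      then have "q = 0" using E poly_roots_finite[of q] finite_subset by blast
      then show "f x = 0" using q by (metis fun_upd_triv poly_0)
    qed
  qed
  from this[of N] show ?thesis by auto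
qed

section \<open>Independence, linear forms and dependencies over a subfield\<close>

definition indep :: "'a::field set \<Rightarrow> nat \<Rightarrow> (nat \<Rightarrow> 'a) \<Rightarrow> bool" where
  "indep S r e \<longleftrightarrow> (\<forall>c. (\<forall>k<r. c k \<in> S) \<and> (\<Sum>k<r. c k * e k) = 0 \<longrightarrow> (\<forall>k<r. c k = 0))"

lemma indepD:
  assumes "indep S r e" "\<forall>k<r. c k \<in> S" "(\<Sum>k<r. c k * e k) = 0" "k < r"
  shows "c k = 0"
proof -
  have "(\<forall>k<r. c k \<in> S) \<and> (\<Sum>k<r. c k * e k) = 0 \<longrightarrow> (\<forall>k<r. c k = 0)"
    using assms(1) unfolding indep_def by (rule spec)
  then show ?thesis using assms(2-4) by simp
qed

definition in_span :: "'a::field set \<Rightarrow> nat \<Rightarrow> (nat \<Rightarrow> 'a) \<Rightarrow> 'a \<Rightarrow> bool" where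
  "in_span S r e x \<longleftrightarrow> (\<exists>c. (\<forall>k<r. c k \<in> S) \<and> x = (\<Sum>k<r. c k * e k))"

lemma exists_basis:
  assumes S: "is_subfield S" and "finite X"
  shows "\<exists>r e. indep S r e \<and> (\<forall>x\<in>X. in_span S r e x)"
  using assms(2)
proof (induction X rule: finite_induct)
  case empty
  show ?case by (intro exI[of _ 0]) (auto simp: indep_def)
next
  case (insert x X)
  note SD = is_subfieldD[OF S]
  from insert obtain r e where e: "indep S r e" "\<forall>x\<in>X. in_span S r e x" by blast
  show ?case
  proof (cases "in_span S r e x")
    case True
    then show ?thesis using e by blast
  next
    case False
    let ?e = "e(r := x)"
    have sum: "(\<Sum>k<Suc r. c k * ?e k) = (\<Sum>k<r. c k * e k) + c r * x" for c by simp
    have "indep S (Suc r) ?e" unfolding indep_def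
    proof (rule allI, rule impI)
      fix c assume c: "(\<forall>k<Suc r. c k \<in> S) \<and> (\<Sum>k<Suc r. c k * ?e k) = 0"
      then have eq: "(\<Sum>k<r. c k * e k) + c r * x = 0" unfolding sum by blast
      have "c r = 0"
      proof (rule ccontr)
        assume nz: "c r \<noteq> 0"
        have "x = - inverse (c r) * (\<Sum>k<r. c k * e k)" using eq nz
          by (simp add: field_simps) (simp add: eq_neg_iff_add_eq_0 add.commute)
        also have "\<dots> = (\<Sum>k<r. (- inverse (c r) * c k) * e k)" by (simp add: sum_distrib_left mult.assoc)
        finally have "x = (\<Sum>k<r. (- inverse (c r) * c k) * e k)" .
        moreover have "\<forall>k<r. - inverse (c r) * c k \<in> S" using c SD by simp
        ultimately have "in_span S r e x" unfolding in_span_def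
          by (intro exI[of _ "\<lambda>k. - inverse (c r) * c k"] conjI)
        then show False using False by contradiction
      qed
      moreover have "\<forall>k<r. c k = 0" using e(1) c eq \<open>c r = 0\<close> unfolding indep_def by simp
      ultimately show "\<forall>k<Suc r. c k = 0" by (simp add: less_Suc_eq)
    qed
    moreover have "in_span S (Suc r) ?e y" if sp: "in_span S r e y" for y
    proof -
      obtain c where c: "\<forall>k<r. c k \<in> S" "y = (\<Sum>k<r. c k * e k)" using sp unfolding in_span_def by auto
      show ?thesis unfolding in_span_def sum using c SD by (intro exI[of _ "c(r := 0)"]) auto
    qed
    moreover have "in_span S (Suc r) ?e x" unfolding in_span_def sum
      using SD by (intro exI[of _ "\<lambda>k. if k = r then 1 else 0"]) auto
    ultimately show ?thesis using e(2) by (intro exI[of _ "Suc r"] exI[of _ ?e]) blast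
  qed
qed

definition linear_form :: "'a::field set \<Rightarrow> ('a \<Rightarrow> 'a) \<Rightarrow> bool" where
  "linear_form S u \<longleftrightarrow> (\<forall>x. u x \<in> S) \<and> (\<forall>x y. u (x + y) = u x + u y) \<and> (\<forall>c\<in>S. \<forall>x. u (c * x) = c * u x)"

lemma linear_formD:
  assumes "linear_form S u"
  shows "u x \<in> S" "u (x + y) = u x + u y" "c \<in> S \<Longrightarrow> u (c * x) = c * u x" "c \<in> S \<Longrightarrow> u (x * c) = u x * c"
    "u 0 = 0" "u (sum f I) = (\<Sum>i\<in>I. u (f i))"
proof -
  show *: "u x \<in> S" "\<And>x y. u (x + y) = u x + u y" "c \<in> S \<Longrightarrow> u (c * x) = c * u x"
    using assms by (auto simp: linear_form_def)
  then show "c \<in> S \<Longrightarrow> u (x * c) = u x * c" by (simp add: mult.commute)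
  show z: "u 0 = 0" using *(2)[of 0 0] by (metis add_0_right add_left_cancel)
  show "u (sum f I) = (\<Sum>i\<in>I. u (f i))"
    by (induction I rule: infinite_finite_induct) (auto simp: z *(2))
qed

definition subspace_over :: "'a::field set \<Rightarrow> 'a set \<Rightarrow> bool" where
  "subspace_over S W \<longleftrightarrow> 0 \<in> W \<and> (\<forall>x\<in>W. \<forall>y\<in>W. x + y \<in> W) \<and> (\<forall>c\<in>S. \<forall>x\<in>W. c * x \<in> W)"

text \<open>The space may be infinite-dimensional. By Zorn there is a maximal subspace
  \<open>H\<close> containing \<open>W\<close> but not \<open>v\<close>. Adjoining any
  \<open>x\<close> outside \<open>H\<close> captures \<open>v\<close>, so \<open>x\<close> differs
  from a multiple of \<open>v\<close> by an element of \<open>H\<close>. Thus \<open>H\<close> is a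
  complement of the line through \<open>v\<close>, and \<open>u\<close> is the coordinate along that
  line.\<close>

lemma exists_linear_form:
  assumes S: "is_subfield S" and W: "subspace_over S W" and v: "v \<notin> W"
  shows "\<exists>u. linear_form S u \<and> u v = 1 \<and> (\<forall>w\<in>W. u w = 0)"
proof -
  note SD = is_subfieldD[OF S]
  let ?H = "{H. subspace_over S H \<and> W \<subseteq> H \<and> v \<notin> H}"
  have "\<exists>M\<in>?H. \<forall>X\<in>?H. M \<subseteq> X \<longrightarrow> X = M"
  proof (rule subset_Zorn_nonempty)
    show "?H \<noteq> {}" using W v by auto
    fix c assume c: "c \<noteq> {}" "subset.chain ?H c"
    have cH: "\<And>H. H \<in> c \<Longrightarrow> subspace_over S H \<and> W \<subseteq> H \<and> v \<notin> H" 
      and tot: "\<And>J J'. J \<in> c \<Longrightarrow> J' \<in> c \<Longrightarrow> J \<subseteq> J' \<or> J' \<subseteq> J"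
      using c(2) unfolding subset_chain_def by blast+
    obtain J0 where J0: "J0 \<in> c" using c(1) by auto
    have "x + y \<in> \<Union>c" if xy: "x \<in> \<Union>c" "y \<in> \<Union>c" for x y
    proof -
      obtain J J' where "x \<in> J" "J \<in> c" "y \<in> J'" "J' \<in> c" using xy by auto
      with tot[of J J'] have "\<exists>J\<in>c. x \<in> J \<and> y \<in> J" by blast
      then show ?thesis using cH unfolding subspace_over_def by blast
    qed
    moreover have "a * x \<in> \<Union>c" if "a \<in> S" "x \<in> \<Union>c" for a x
      using that cH unfolding subspace_over_def by blast
    moreover have "0 \<in> \<Union>c" using J0 cH unfolding subspace_over_def by blast
    ultimately have "subspace_over S (\<Union>c)" unfolding subspace_over_def by simp
    then show "\<Union>c \<in> ?H" using cH J0 by blast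
  qed
  then obtain H where H: "subspace_over S H" "W \<subseteq> H" "v \<notin> H"
    and max: "\<And>X. subspace_over S X \<Longrightarrow> W \<subseteq> X \<Longrightarrow> v \<notin> X \<Longrightarrow> H \<subseteq> X \<Longrightarrow> X = H" by (elim bexE) auto
  have HD: "0 \<in> H" "\<And>x y. x \<in> H \<Longrightarrow> y \<in> H \<Longrightarrow> x + y \<in> H" "\<And>c x. c \<in> S \<Longrightarrow> x \<in> H \<Longrightarrow> c * x \<in> H"
    using H(1) by (auto simp: subspace_over_def)
  have Hdiff: "x - y \<in> H" if "x \<in> H" "y \<in> H" for x y
    using HD(2)[OF that(1) HD(3)[OF SD(5)[OF SD(2)] that(2)]] by simp
  have ex: "\<exists>c\<in>S. x - c * v \<in> H" for x
  proof (cases "x \<in> H")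
    case True
    then show ?thesis using SD by (intro bexI[of _ 0]) auto
  next
    case False
    define X where "X = {h + c * x | h c. h \<in> H \<and> c \<in> S}"
    have XI: "h + c * x \<in> X" if "h \<in> H" "c \<in> S" for h c using that unfolding X_def by blast
    have XE: "\<exists>h c. h \<in> H \<and> c \<in> S \<and> z = h + c * x" if "z \<in> X" for z using that unfolding X_def by blast
    have "H \<subseteq> X" using XI[OF _ SD(1)] by auto
    have "x \<in> X" using XI[OF HD(1) SD(2)] by simp
    have "subspace_over S X" unfolding subspace_over_def
    proof (intro conjI ballI)
      show "0 \<in> X" using \<open>H \<subseteq> X\<close> HD(1) by blast
      fix y z assume "y \<in> X" "z \<in> X"
      then obtain h c h' c' where "h \<in> H" "c \<in> S" "y = h + c * x" "h' \<in> H" "c' \<in> S" "z = h' + c' * x"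
        by (auto dest!: XE)
      then show "y + z \<in> X" using XI[of "h + h'" "c + c'"] HD SD by (simp add: algebra_simps)
    next
      fix a y assume "a \<in> S" "y \<in> X"
      then obtain h c where "h \<in> H" "c \<in> S" "y = h + c * x" by (auto dest!: XE)
      then show "a * y \<in> X" using XI[of "a * h" "a * c"] HD SD \<open>a \<in> S\<close> by (simp add: algebra_simps)
    qed
    then have "v \<in> X" using max[of X] \<open>H \<subseteq> X\<close> \<open>x \<in> X\<close> False H(2) by blast
    then obtain h c where hc: "h \<in> H" "c \<in> S" "v = h + c * x" by (auto dest!: XE)
    have "c \<noteq> 0" using hc H(3) by auto
    then have "x - inverse c * v = (- inverse c) * h" unfolding hc(3) by (simp add: algebra_simps)
    moreover have "(- inverse c) * h \<in> H" by (rule HD(3)[OF SD(5)[OF SD(6)[OF hc(2)]] hc(1)])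
    ultimately have "x - inverse c * v \<in> H" by (simp only:)
    then show ?thesis using SD(6)[OF hc(2)] by (intro bexI[of _ "inverse c"])
  qed
  have uniq: "c = c'" if "c \<in> S" "c' \<in> S" "x - c * v \<in> H" "x - c' * v \<in> H" for c c' x
  proof (rule ccontr)
    assume ne: "c \<noteq> c'"
    have "(c' - c) * v \<in> H" using Hdiff[OF that(3,4)] by (simp add: algebra_simps)
    then have "inverse (c' - c) * ((c' - c) * v) \<in> H" using HD(3) that SD by simp
    then show False using H(3) ne by (simp add: mult.assoc[symmetric])
  qed
  obtain u where u: "\<And>x. u x \<in> S" "\<And>x. x - u x * v \<in> H" using ex by metis
  have "u (x + y) = u x + u y" for x y
    using HD(2)[OF u(2)[of x] u(2)[of y]] u SD by (intro uniq[of _ _ "x + y"]) (auto simp: algebra_simps)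
  moreover have "u (c * x) = c * u x" if "c \<in> S" for c x
    using HD(3)[OF that u(2)[of x]] u SD that by (intro uniq[of _ _ "c * x"]) (auto simp: algebra_simps)
  moreover have "u v = 1" using u SD HD(1) by (intro uniq[of _ _ v]) auto
  moreover have "u w = 0" if "w \<in> W" for w using u SD H(2) that by (intro uniq[of _ _ w]) auto
  ultimately show ?thesis using u(1) unfolding linear_form_def by blast
qed

text \<open>More unknowns than equations. Either the last equation is void, or it is solved for an
  unknown \<open>r\<close> with nonzero coefficient and substituted into the others, which costs one
  unknown and one equation.\<close>

lemma exists_dependency:
  assumes S: "is_subfield S" and "finite R" "M < card R" "\<And>i j. i \<in> R \<Longrightarrow> j < M \<Longrightarrow> a i j \<in> S"
  shows "\<exists>c. (\<forall>i\<in>R. c i \<in> S) \<and> (\<exists>i\<in>R. c i \<noteq> 0) \<and> (\<forall>j<M. (\<Sum>i\<in>R. c i * a i j) = (0::'a::field))"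
  using assms(2-)
proof (induction M arbitrary: R a)
  case 0
  then have "R \<noteq> {}" by auto
  then show ?case using is_subfieldD(2)[OF S] by (intro exI[of _ "\<lambda>_. 1"]) auto
next
  case (Suc M)
  note SD = is_subfieldD[OF S]
  show ?case
  proof (cases "\<forall>i\<in>R. a i M = 0")
    case True
    have "\<exists>c. (\<forall>i\<in>R. c i \<in> S) \<and> (\<exists>i\<in>R. c i \<noteq> 0) \<and> (\<forall>j<M. (\<Sum>i\<in>R. c i * a i j) = 0)"
      using Suc.prems by (intro Suc.IH) auto
    then show ?thesis using True by (auto simp: less_Suc_eq)
  next
    case False
    then obtain r where r: "r \<in> R" "a r M \<noteq> 0" by blast
    let ?b = "\<lambda>i j. a i j - (a i M / a r M) * a r j"
    have "\<exists>c. (\<forall>i\<in>R - {r}. c i \<in> S) \<and> (\<exists>i\<in>R - {r}. c i \<noteq> 0) \<and> (\<forall>j<M. (\<Sum>i\<in>R - {r}. c i * ?b i j) = 0)"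
      using Suc.prems r SD by (intro Suc.IH) auto
    then obtain c where c: "\<forall>i\<in>R - {r}. c i \<in> S" "\<exists>i\<in>R - {r}. c i \<noteq> 0"
      "\<And>j. j < M \<Longrightarrow> (\<Sum>i\<in>R - {r}. c i * ?b i j) = 0" by blast
    define s where "s = - (\<Sum>i\<in>R - {r}. c i * (a i M / a r M))"
    have sS: "s \<in> S" unfolding s_def
      using c(1) Suc.prems r SD is_subring_sum[OF is_subring_subfield[OF S], of "R - {r}"] by simp
    have eq: "(\<Sum>i\<in>R. (c(r := s)) i * a i j) = (\<Sum>i\<in>R - {r}. c i * ?b i j)" for j
    proof -
      have "(\<Sum>i\<in>R. (c(r := s)) i * a i j) = s * a r j + (\<Sum>i\<in>R - {r}. c i * a i j)"
        using Suc.prems(1) r(1) by (simp add: sum.remove)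
      also have "\<dots> = (\<Sum>i\<in>R - {r}. c i * ?b i j)"
        unfolding s_def by (simp add: sum_subtractf algebra_simps sum_distrib_left sum_distrib_right)
      finally show ?thesis .
    qed
    have "(\<Sum>i\<in>R. (c(r := s)) i * a i j) = 0" if "j < Suc M" for j
    proof (cases "j = M")
      case True
      have "?b i M = 0" for i using r(2) by simp
      then show ?thesis unfolding eq True by simp
    next
      case False
      then show ?thesis unfolding eq using c(3) that by simp
    qed
    moreover have "\<forall>i\<in>R. (c(r := s)) i \<in> S" using c(1) sS by auto
    moreover have "\<exists>i\<in>R. (c(r := s)) i \<noteq> 0" using c(2) by auto
    ultimately show ?thesis by blast
  qed
qed

section \<open>Spans over the whole field and descent to constant coefficients\<close>

inductive_set lspan :: "('x \<Rightarrow> 'a::field) set \<Rightarrow> ('x \<Rightarrow> 'a) set" for V :: "('x \<Rightarrow> 'a) set" where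
  zero: "(\<lambda>x. 0) \<in> lspan V"
| step: "f \<in> lspan V \<Longrightarrow> g \<in> V \<Longrightarrow> (\<lambda>x. f x + l * g x) \<in> lspan V"

lemma lspan_base: "g \<in> V \<Longrightarrow> (\<lambda>x. l * g x) \<in> lspan V"
  using lspan.step[OF lspan.zero] by fastforce

lemma lspan_incl: "g \<in> V \<Longrightarrow> g \<in> lspan V"
  using lspan_base[of g V 1] by simp

lemma lspan_add:
  assumes "f \<in> lspan V" "g \<in> lspan V"
  shows "(\<lambda>x. f x + g x) \<in> lspan V"
  using assms(2)
proof (induction rule: lspan.induct)
  case (step h g l)
  then have "(\<lambda>x. (f x + h x) + l * g x) \<in> lspan V" by (intro lspan.step)
  then show ?case by (simp add: add.assoc)
qed (use assms(1) in simp)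

lemma lspan_scale:
  assumes "f \<in> lspan V"
  shows "(\<lambda>x. c * f x) \<in> lspan V"
  using assms
proof (induction rule: lspan.induct)
  case (step h g l)
  then have "(\<lambda>x. c * h x + (c * l) * g x) \<in> lspan V" by (intro lspan.step)
  then show ?case by (simp add: algebra_simps)
qed (simp add: lspan.zero)

lemma lspan_sum:
  assumes "\<And>i. i \<in> I \<Longrightarrow> f i \<in> lspan V"
  shows "(\<lambda>x. \<Sum>i\<in>I. f i x) \<in> lspan V"
  using assms by (induction I rule: infinite_finite_induct) (auto intro: lspan_add lspan.zero)

lemma lspan_mult_closed:
  assumes "\<And>f g. f \<in> V \<Longrightarrow> g \<in> W \<Longrightarrow> (\<lambda>x. f x * g x) \<in> lspan U" and "f \<in> lspan V" "g \<in> lspan W"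
  shows "(\<lambda>x. f x * g x) \<in> lspan U"
  using assms(2)
proof (induction rule: lspan.induct)
  case (step h k l)
  have "(\<lambda>x. k x * g x) \<in> lspan U"
    using assms(3)
  proof (induction rule: lspan.induct)
    case (step p q c)
    then have "(\<lambda>x. k x * p x + c * (k x * q x)) \<in> lspan U"
      using assms(1)[OF \<open>k \<in> V\<close> step(2)] by (intro lspan_add lspan_scale)
    then show ?case by (simp add: algebra_simps)
  qed (simp add: lspan.zero)
  then have "(\<lambda>x. h x * g x + l * (k x * g x)) \<in> lspan U"
    using step by (intro lspan_add lspan_scale)
  then show ?case by (simp add: algebra_simps)
qed (simp add: lspan.zero)

definition fun_subspace :: "'a::field set \<Rightarrow> ('x \<Rightarrow> 'a) set \<Rightarrow> bool" where
  "fun_subspace S V \<longleftrightarrow> (\<lambda>x. 0) \<in> V \<and> (\<forall>f\<in>V. \<forall>g\<in>V. (\<lambda>x. f x + g x) \<in> V) \<and>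
    (\<forall>c\<in>S. \<forall>f\<in>V. (\<lambda>x. c * f x) \<in> V)"

lemma fun_subspaceD:
  assumes "fun_subspace S V"
  shows "(\<lambda>x. 0) \<in> V" "f \<in> V \<Longrightarrow> g \<in> V \<Longrightarrow> (\<lambda>x. f x + g x) \<in> V" "c \<in> S \<Longrightarrow> f \<in> V \<Longrightarrow> (\<lambda>x. c * f x) \<in> V"
  using assms by (auto simp: fun_subspace_def)

lemma fun_subspace_sum:
  assumes "fun_subspace S V" "\<And>i. i \<in> I \<Longrightarrow> f i \<in> V"
  shows "(\<lambda>x. \<Sum>i\<in>I. f i x) \<in> V"
  using assms(2) by (induction I rule: infinite_finite_induct) (auto simp: fun_subspaceD[OF assms(1)])

text \<open>\<open>X\<close> collects the scalars of one expression of \<open>f\<close>. Rewriting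
  them in any \<open>e\<close> that spans them over \<open>S\<close> regroups the expression along
  \<open>e\<close>; leaving \<open>e\<close> free lets one basis serve several functions at
  once.\<close>

lemma lspan_coeffs:
  assumes V: "fun_subspace S V" and "f \<in> lspan V"
  shows "\<exists>X. finite X \<and> (\<forall>r e. (\<forall>x\<in>X. in_span S r e x) \<longrightarrow>
    (\<exists>g. (\<forall>k<r. g k \<in> V) \<and> f = (\<lambda>x. \<Sum>k<r. e k * g k x)))"
  using assms(2)
proof (induction rule: lspan.induct)
  case zero
  show ?case
    by (intro exI[of _ "{}"] conjI allI impI exI[of _ "\<lambda>k x. 0"]) (auto simp: fun_subspaceD[OF V])
next
  case (step f h l)
  then obtain X where X: "finite X" "\<And>r e. (\<forall>x\<in>X. in_span S r e x) \<Longrightarrow>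
    (\<exists>g. (\<forall>k<r. g k \<in> V) \<and> f = (\<lambda>x. \<Sum>k<r. e k * g k x))" by blast
  show ?case
  proof (intro exI[of _ "insert l X"] conjI allI impI)
    fix r and e :: "nat \<Rightarrow> 'a" assume *: "\<forall>x\<in>insert l X. in_span S r e x"
    then obtain g where g: "\<forall>k<r. g k \<in> V" "f = (\<lambda>x. \<Sum>k<r. e k * g k x)" using X(2) by blast
    from * obtain c where c: "\<forall>k<r. c k \<in> S" "l = (\<Sum>k<r. c k * e k)" by (auto simp: in_span_def)
    let ?g = "\<lambda>k x. g k x + c k * h x"
    have "\<forall>k<r. ?g k \<in> V" using g(1) c(1) step(2) fun_subspaceD[OF V] by simp
    moreover have "f x + l * h x = (\<Sum>k<r. e k * ?g k x)" for x
      unfolding g(2) c(2) by (simp add: sum.distrib distrib_left sum_distrib_right mult.assoc mult.left_commute)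
    ultimately show "\<exists>g. (\<forall>k<r. g k \<in> V) \<and> (\<lambda>x. f x + l * h x) = (\<lambda>x. \<Sum>k<r. e k * g k x)"
      by (intro exI[of _ ?g]) auto
  qed (use X in simp)
qed

lemma lspan_common_basis:
  assumes S: "is_subfield S" and V: "fun_subspace S V" and F: "finite F" "F \<subseteq> lspan V"
  obtains r e where "indep S r e"
    "\<And>f. f \<in> F \<Longrightarrow> \<exists>g. (\<forall>k<r. g k \<in> V) \<and> f = (\<lambda>x. \<Sum>k<r. e k * g k x)"
proof -
  have "\<forall>f\<in>F. \<exists>X. finite X \<and> (\<forall>r e. (\<forall>x\<in>X. in_span S r e x) \<longrightarrow>
      (\<exists>g. (\<forall>k<r. g k \<in> V) \<and> f = (\<lambda>x. \<Sum>k<r. e k * g k x)))"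
    using lspan_coeffs[OF V] F(2) by blast
  from bchoice[OF this] obtain X where "\<forall>f\<in>F. finite (X f) \<and>
      (\<forall>r e. (\<forall>x\<in>X f. in_span S r e x) \<longrightarrow> (\<exists>g. (\<forall>k<r. g k \<in> V) \<and> f = (\<lambda>x. \<Sum>k<r. e k * g k x)))" ..
  then have X: "\<And>f. f \<in> F \<Longrightarrow> finite (X f)"
    "\<And>f r e. f \<in> F \<Longrightarrow> (\<forall>x\<in>X f. in_span S r e x) \<Longrightarrow>
      (\<exists>g. (\<forall>k<r. g k \<in> V) \<and> f = (\<lambda>x. \<Sum>k<r. e k * g k x))"
    by blast+
  have "finite (\<Union>f\<in>F. X f)" using F(1) X(1) by blast
  from exists_basis[OF S this] obtain r e where "indep S r e" "\<forall>x\<in>\<Union>f\<in>F. X f. in_span S r e x" by blast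
  then show ?thesis using X(2) by (intro that[of r e]) auto
qed

lemma lspan_repr:
  assumes "f \<in> lspan V"
  obtains r l g where "\<And>k. k < r \<Longrightarrow> g k \<in> V" "f = (\<lambda>x. \<Sum>k<(r::nat). l k * g k x)"
proof -
  have "\<exists>r l g. (\<forall>k<r. g k \<in> V) \<and> f = (\<lambda>x. \<Sum>k<(r::nat). l k * g k x)" using assms
  proof (induction rule: lspan.induct)
    case zero
    show ?case by (intro exI[of _ 0]) auto
  next
    case (step f h m)
    then obtain r l g where *: "\<forall>k<r. g k \<in> V" "f = (\<lambda>x. \<Sum>k<(r::nat). l k * g k x)" by blast
    show ?case using * step(2)
      by (intro exI[of _ "Suc r"] exI[of _ "l(r := m)"] exI[of _ "g(r := h)"]) (auto simp: less_Suc_eq)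
  qed
  then show ?thesis using that by blast
qed

text \<open>A shortest nonvanishing combination in \<open>M\<close>, with one coefficient normalised to 1,
  has constant coefficients: otherwise a multiple of its derivative, which vanishes at \<open>x\<close> by
  minimality, can be subtracted to shorten it.\<close>

lemma descend_constants:
  fixes D :: "'a::field \<Rightarrow> 'a" and M V :: "('x \<Rightarrow> 'a) set"
  assumes D1: "D 1 = 0" and S: "\<And>c. D c = 0 \<Longrightarrow> c \<in> S"
    and V: "fun_subspace S V"
    and M: "fun_subspace UNIV M"
    and DM: "\<And>I l g. finite (I :: nat set) \<Longrightarrow> (\<And>k. k \<in> I \<Longrightarrow> g k \<in> V) \<Longrightarrow> (\<lambda>x. \<Sum>k\<in>I. l k * g k x) \<in> M \<Longrightarrow>
      (\<lambda>x. \<Sum>k\<in>I. D (l k) * g k x) \<in> M"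
    and zero: "\<And>f. f \<in> M \<Longrightarrow> f \<in> V \<Longrightarrow> f x = 0"
  shows "finite (I :: nat set) \<Longrightarrow> (\<And>k. k \<in> I \<Longrightarrow> g k \<in> V) \<Longrightarrow> (\<lambda>x. \<Sum>k\<in>I. l k * g k x) \<in> M \<Longrightarrow>
    (\<Sum>k\<in>I. l k * g k x) = 0"
proof (induction "card I" arbitrary: I l rule: less_induct)
  case less
  note MD = fun_subspaceD[OF M]
  show ?case
  proof (cases "\<exists>k\<in>I. l k = 0")
    case True
    then obtain k where k: "k \<in> I" "l k = 0" by blast
    have eq: "(\<Sum>k\<in>I. l k * g k x) = (\<Sum>k\<in>I - {k}. l k * g k x)" for x
      using k less.prems(1) by (simp add: sum.remove)
    show ?thesis using less k unfolding eq
      by (intro less.hyps[OF card_Diff1_less[OF less.prems(1) k(1)]]) auto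
  next
    case nz: False
    show ?thesis
    proof (cases "I = {}")
      case False
      then obtain k0 where k0: "k0 \<in> I" by blast
      let ?l = "\<lambda>k. inverse (l k0) * l k"
      have l1: "?l k0 = 1" using nz k0 by simp
      have M1: "(\<lambda>x. \<Sum>k\<in>I. ?l k * g k x) \<in> M"
        using MD(3)[OF _ less.prems(3), of "inverse (l k0)"] by (simp add: sum_distrib_left mult.assoc)
      have M2: "(\<lambda>x. \<Sum>k\<in>I. D (?l k) * g k x) \<in> M" 
        by (rule DM[OF less.prems(1) _ M1]) (rule less.prems(2))
      have eq: "(\<Sum>k\<in>I. D (?l k) * g k x) = (\<Sum>k\<in>I - {k0}. D (?l k) * g k x)" for x
        using k0 less.prems(1) l1 D1 by (simp add: sum.remove)
      have D0: "(\<Sum>k\<in>I. D (?l k) * g k x) = 0" 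
        using M2 less.prems k0 unfolding eq
        by (intro less.hyps[OF card_Diff1_less[OF less.prems(1) k0]]) auto
      have "(\<Sum>k\<in>I. ?l k * g k x) = 0"
      proof (cases "\<forall>k\<in>I. D (?l k) = 0")
        case True
        have "(\<lambda>x. \<Sum>k\<in>I. ?l k * g k x) \<in> V"
          using True S less.prems(2) by (intro fun_subspace_sum[OF V] fun_subspaceD(3)[OF V]) auto
        then show ?thesis using zero M1 by blast
      next
        case False
        then obtain k1 where k1: "k1 \<in> I" "D (?l k1) \<noteq> 0" by blast
        \<comment> \<open>Chosen so that the coefficient at \<open>k1\<close> becomes zero. The
          combination added with this factor vanishes at \<open>x\<close>: its coefficient at
          \<open>k0\<close> is \<open>D 1 = 0\<close>, so it is already shorter.\<close>
        let ?c = "- (?l k1 / D (?l k1))"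
        let ?m = "\<lambda>k. ?l k + ?c * D (?l k)"
        have m1: "?m k1 = 0" using k1 by simp
        have eqm: "(\<Sum>k\<in>I. ?l k * g k x) + ?c * (\<Sum>k\<in>I. D (?l k) * g k x) = (\<Sum>k\<in>I. ?m k * g k x)" for x
          by (simp only: sum_distrib_left sum.distrib[symmetric] distrib_right mult.assoc)
        have eq1: "(\<Sum>k\<in>I. ?m k * g k x) = (\<Sum>k\<in>I - {k1}. ?m k * g k x)" for x
          using sum.remove[OF less.prems(1) k1(1), of "\<lambda>k. ?m k * g k x"] m1 by (metis (no_types, lifting) add_0 mult_zero_left)
        have "(\<lambda>x. \<Sum>k\<in>I - {k1}. ?m k * g k x) \<in> M"
          unfolding eq1[symmetric] unfolding eqm[symmetric] by (intro MD(2)[OF M1] MD(3)[OF UNIV_I M2])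
        then have "(\<Sum>k\<in>I - {k1}. ?m k * g k x) = 0"
          using less.prems(1,2) by (intro less.hyps[OF card_Diff1_less[OF less.prems(1) k1(1)]]) auto
        then show ?thesis using eqm[of x] eq1[of x] D0 by simp
      qed
      then have "inverse (l k0) * (\<Sum>k\<in>I. l k * g k x) = 0" by (simp add: sum_distrib_left mult.assoc)
      then show ?thesis using nz k0 by simp
    qed simp
  qed
qed

text \<open>Dividing by \<open>X - c\<close> for a root \<open>c\<close> in \<open>C\<close> keeps
  the coefficients in \<open>C\<close> and lowers the degree, until \<open>a\<close> itself is the
  root removed.\<close>

lemma root_in_algebraically_closed:
  fixes C :: "'a::field set"
  assumes C: "algebraically_closed_subfield C"
  shows "p \<in> polys_over C \<Longrightarrow> p \<noteq> 0 \<Longrightarrow> poly p a = 0 \<Longrightarrow> a \<in> C"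
proof (induction "degree p" arbitrary: p)
  case 0
  then obtain x where "p = [:x:]" by (auto elim: degree_eq_zeroE[of p])
  then show ?case using 0 by simp
next
  case (Suc d)
  have Cf: "is_subfield C" using C by (simp add: algebraically_closed_subfield_def)
  note P = is_subringD[OF is_subring_polys_over[OF is_subring_subfield[OF Cf]]]
  have "(\<forall>i. coeff p i \<in> C) \<and> degree p > 0" using Suc(2,3) by (auto simp: polys_over_def)
  then obtain c where c: "c \<in> C" "poly p c = 0"
    using C unfolding algebraically_closed_subfield_def by blast
  define q where "q = synthetic_div p c"
  have pq: "p = [:- c, 1:] * q" using synthetic_div_correct'[of c p] c(2) by (simp add: q_def)
  have "q \<in> polys_over C"
  proof -
    have "coeff (synthetic_div p c) i \<in> C" if "p \<in> polys_over C" for p i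
      using that
    proof (induction p arbitrary: i)
      case (pCons a p)
      have pC: "coeff p j \<in> C" for j using pCons(3) unfolding polys_over_def by (auto dest!: spec[of _ "Suc j"])
      have "poly p c \<in> C" unfolding poly_altdef using pC c(1) is_subringD[OF is_subring_subfield[OF Cf]]
        by (intro is_subring_sum[OF is_subring_subfield[OF Cf]]) auto
      then show ?case using pCons pC by (cases i) (auto simp: polys_over_def)
    qed (simp add: is_subfieldD[OF Cf])
    then show ?thesis using Suc by (auto simp: q_def polys_over_def)
  qed
  moreover have "q \<noteq> 0" using pq Suc by auto
  moreover have "d = degree q" using Suc(2) by (simp add: q_def degree_synthetic_div)
  moreover have "a = c \<or> poly q a = 0" using Suc(5) unfolding pq by auto
  ultimately show ?case using Suc(1) c(1) by blast
qed


section \<open>Nilpotent tensors\<close>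

text \<open>The next-to-top coefficient, through which a power of \<open>t - a\<close> with
  coefficients in \<open>K\<close> reveals an integer multiple of \<open>a\<close>.\<close>

lemma coeff_linear_power_pred:
  "coeff ([:- a, 1:] ^ Suc k) k = - (of_nat (Suc k) * (a::'a::comm_ring_1))"
proof (induction k)
  case (Suc k)
  let ?p = "[:- a, 1:] ^ Suc k"
  have "coeff ([:- a, 1:] * ?p) (Suc k) = coeff ?p k - a * coeff ?p (Suc k)"
    by (simp del: power_Suc)
  then show ?case unfolding Suc.IH coeff_linear_power power_Suc[of _ "Suc k"] by (simp add: algebra_simps)
qed simp

lemma linear_form_separates:
  assumes S: "is_subfield S" and "\<And>u. linear_form S u \<Longrightarrow> u x = 0"
  shows "x = (0::'a::field)"
proof (rule ccontr)
  assume "x \<noteq> 0"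
  moreover have "subspace_over S {0}" by (auto simp: subspace_over_def)
  ultimately obtain u where "linear_form S u" "u x = 1" using exists_linear_form[OF S, of "{0}" x] by auto
  then show False using assms(2)[of u] by simp
qed

lemma poly_map_poly_linear_form:
  assumes u: "linear_form S u" and q: "q \<in> polys_over S"
  shows "map_poly u (p * q) = map_poly u p * q"
proof (rule poly_eqI)
  fix n
  have "u (\<Sum>i\<le>n. coeff p i * coeff q (n - i)) = (\<Sum>i\<le>n. u (coeff p i) * coeff q (n - i))"
    using q by (simp add: linear_formD(4,6)[OF u] polys_over_def)
  then show "coeff (map_poly u (p * q)) n = coeff (map_poly u p * q) n"
    by (simp add: coeff_map_poly coeff_mult linear_formD(5)[OF u])
qed

text \<open>The linear factor is prime, so the part of \<mu> prime to it divides 1.\<close>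

lemma dvd_linear_power:
  fixes \<mu> :: "'a::field poly"
  assumes "\<mu> dvd [:- a, 1:] ^ N"
  obtains c k where "\<mu> = smult c ([:- a, 1:] ^ k)" "c \<noteq> 0"
proof -
  have nz: "\<mu> \<noteq> 0" using assms by auto
  from order_decomp[OF nz, of a] obtain q where q: "\<mu> = [:- a, 1:] ^ order a \<mu> * q" "\<not> [:- a, 1:] dvd q" by blast
  have prime: "prime_elem [:- a, 1:]" by (rule prime_elem_linear_field_poly) simp
  have "q dvd [:- a, 1:] ^ N" using assms q(1) by (metis dvd_mult_right)
  then obtain t where "[:- a, 1:] ^ N = q * t" ..
  then have "is_unit q"
  proof (induction N arbitrary: t)
    case 0
    then show ?case by (metis dvdI power_0)
  next
    case (Suc N)
    then have "[:- a, 1:] dvd q * t" by (metis dvd_triv_left power_Suc)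
    then have "[:- a, 1:] dvd t" using prime q(2) prime_elem_dvd_multD by blast
    then obtain s where s: "t = [:- a, 1:] * s" ..
    then have "[:- a, 1:] * [:- a, 1:] ^ N = [:- a, 1:] * (q * s)"
      using Suc.prems by (metis mult.left_commute power_Suc)
    then have "[:- a, 1:] ^ N = q * s" by (subst (asm) mult_left_cancel) auto
    then show ?case by (rule Suc.IH)
  qed
  then obtain c where "q = [:c:]" "c \<noteq> 0" by (auto elim: degree_eq_zeroE[of q])
  then show ?thesis using q(1) by (intro that[of c "order a \<mu>"]) auto
qed

text \<open>The hypothesis says that \<open>a \<otimes> 1 - 1 \<otimes> a\<close> is nilpotent in \<open>L \<otimes>\<^sub>K L\<close>; it forces the
  minimal polynomial of \<open>a\<close> over \<open>K\<close> to be a power of \<open>t - a\<close>.\<close>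

lemma nilpotent_tensor_in_subfield:
  fixes a :: "'a::field"
  assumes K: "is_subfield K" and C: "algebraically_closed_subfield C" "C \<subseteq> K"
    and char: "\<And>k. 0 < k \<Longrightarrow> of_nat k = (0::'a) \<Longrightarrow> a ^ k \<in> C"
    and nil: "\<And>u. linear_form K u \<Longrightarrow> poly (map_poly u ([:- a, 1:] ^ N)) a = 0"
  shows "a \<in> K"
proof -
  note KD = is_subfieldD[OF K]
  let ?f = "[:- a, 1:] ^ N"
  have over: "map_poly u p \<in> polys_over K" if "linear_form K u" for u p
    using linear_formD(1,5)[OF that] by (simp add: polys_over_def coeff_map_poly)
  have "subspace_over K {0}" by (auto simp: subspace_over_def)
  then obtain v where v: "linear_form K v" "v 1 = 1" using exists_linear_form[OF K, of "{0}" 1] by auto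
  \<comment> \<open>A form with value 1 at 1 keeps the top coefficient, so \<open>a\<close> is a
    root of a monic polynomial over \<open>K\<close>.\<close>
  have "coeff (map_poly v ?f) N = 1" using v linear_formD(5)[OF v(1)] by (simp add: coeff_map_poly coeff_linear_power)
  then have "map_poly v ?f \<noteq> 0" by (intro notI) simp
  then have "\<exists>p. p \<in> polys_over K \<and> p \<noteq> 0 \<and> poly p a = 0" using nil[OF v(1)] over[OF v(1)] by blast
  then obtain \<mu> where \<mu>: "\<mu> \<in> polys_over K" "\<mu> \<noteq> 0" "poly \<mu> a = 0"
    and min: "\<And>p. p \<in> polys_over K \<and> p \<noteq> 0 \<and> poly p a = 0 \<Longrightarrow> degree \<mu> \<le> degree p"
    using minimal_degree[of "\<lambda>p. p \<in> polys_over K \<and> p \<noteq> 0 \<and> poly p a = 0"] by blast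
  define r where "r = ?f mod \<mu>"
  have f: "?f = (?f div \<mu>) * \<mu> + r" by (simp add: r_def)
  \<comment> \<open>Applying \<open>u\<close> to coefficients is compatible with multiplication by
    \<mu>, so the image of the remainder has the root \<open>a\<close> and degree below that of
    \<mu>; by minimality it is zero. Linear forms separate elements of the field, so
    \<open>r\<close> itself is zero.\<close>
  have "map_poly u r = 0" if u: "linear_form K u" for u
  proof (rule ccontr)
    assume nz: "map_poly u r \<noteq> 0"
    have "map_poly u ?f = map_poly u ((?f div \<mu>) * \<mu>) + map_poly u r"
      by (subst f) (intro poly_eqI, simp add: coeff_map_poly linear_formD[OF u])
    then have "poly (map_poly u r) a = 0"
      using nil[OF u] \<mu> poly_map_poly_linear_form[OF u \<mu>(1)] by simp
    then have "degree \<mu> \<le> degree (map_poly u r)" using min over[OF u] nz by blast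
    also have "\<dots> \<le> degree r" by (rule degree_map_poly_le)
    finally have "degree \<mu> \<le> degree r" .
    moreover have "r \<noteq> 0" using nz by auto
    ultimately show False using degree_mod_less[OF \<mu>(2), of ?f] by (auto simp: r_def)
  qed
  then have "u (coeff r i) = 0" if "linear_form K u" for u i
    using that coeff_map_poly[of u r i] linear_formD(5)[OF that] by simp
  then have "coeff r i = 0" for i by (rule linear_form_separates[OF K])
  then have "r = 0" by (intro poly_eqI) simp
  then have "\<mu> dvd ?f" by (simp add: r_def mod_eq_0_iff_dvd)
  then obtain c k where \<mu>k: "\<mu> = smult c ([:- a, 1:] ^ k)" "c \<noteq> 0" by (rule dvd_linear_power)
  have "k \<noteq> 0" using \<mu> \<mu>k by (intro notI) simp
  then obtain j where j: "k = Suc j" using not0_implies_Suc by blast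
  have cK: "c \<in> K" using \<mu>(1) \<mu>k by (auto simp: polys_over_def coeff_linear_power dest!: spec[of _ k])
  \<comment> \<open>This coefficient is \<open>c\<close> times \<open>- (k * a)\<close>, so
    \<open>k * a\<close> lies in \<open>K\<close>. If \<open>k\<close> vanishes in the field this
    says nothing, and \<open>a\<close> is reached as an element algebraic over \<open>C\<close>
    instead.\<close>
  have "coeff \<mu> j \<in> K" using \<mu>(1) by (simp add: polys_over_def)
  then have "c * - (of_nat k * a) \<in> K" using \<mu>k coeff_linear_power_pred[of a j] by (simp add: j del: of_nat_Suc power_Suc)
  then have "inverse c * (c * - (of_nat k * a)) \<in> K" by (rule KD(4)[OF KD(6)[OF cK]])
  then have "- (of_nat k * a) \<in> K" using \<mu>k(2) by (simp add: mult.assoc[symmetric])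
  then have ka: "of_nat k * a \<in> K" using KD(5) by fastforce
  show "a \<in> K"
  proof (cases "of_nat k = (0::'a)")
    case False
    have "of_nat k \<in> K" by (induction k) (auto simp: KD)
    then have "inverse (of_nat k) * (of_nat k * a) \<in> K" by (rule KD(4)[OF KD(6) ka])
    then show ?thesis using False by (simp add: mult.assoc[symmetric])
  next
    case True
    have ak: "a ^ k \<in> C" using char[of k] True j by simp
    have Cf: "is_subfield C" using C(1) by (simp add: algebraically_closed_subfield_def)
    let ?p = "monom 1 k - [:a ^ k:]"
    note P = is_subring_polys_over[OF is_subring_subfield[OF Cf]]
    have "?p \<in> polys_over C"
      using polys_over_monom[OF is_subring_subfield[OF Cf] is_subfieldD(2)[OF Cf]]
        polys_over_const[OF is_subring_subfield[OF Cf], of "a ^ k"] ak by (intro is_subringD(3)[OF P]) auto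
    moreover have "coeff ?p k = 1" using j by simp
    then have "?p \<noteq> 0" by (intro notI) simp
    moreover have "poly ?p a = 0" by (simp add: poly_monom)
    ultimately show ?thesis using root_in_algebraically_closed[OF C(1)] C(2) by blast
  qed
qed


section \<open>Matrices over a subfield\<close>

lemma Mat_iff: "A \<in> Mat S n \<longleftrightarrow> A \<in> carrier_mat n n \<and> (\<forall>i<n. \<forall>j<n. A $$ (i, j) \<in> S)"
  unfolding Mat_def elements_mat_def by (auto simp: UN_subset_iff image_subset_iff)

lemma MatD: "A \<in> Mat S n \<Longrightarrow> A \<in> carrier_mat n n" "A \<in> Mat S n \<Longrightarrow> i < n \<Longrightarrow> j < n \<Longrightarrow> A $$ (i, j) \<in> S"
  by (auto simp: Mat_iff)

lemma Mat_mono: "S \<subseteq> T \<Longrightarrow> Mat S n \<subseteq> Mat T n"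
  by (auto simp: Mat_def)

lemma GL_mono: "S \<subseteq> T \<Longrightarrow> GL S n \<subseteq> GL T n"
  using Mat_mono[of S T n] by (force simp: GL_def)

lemma index_mult_mat_sum:
  "A \<in> carrier_mat n k \<Longrightarrow> B \<in> carrier_mat k l \<Longrightarrow> i < n \<Longrightarrow> j < l \<Longrightarrow>
    (A * B) $$ (i, j) = (\<Sum>s<k. A $$ (i, s) * B $$ (s, j))"
  by (auto simp: scalar_prod_def lessThan_atLeast0)

lemma Mat_mult:
  assumes S: "is_subring S" and "A \<in> Mat S n" "B \<in> Mat S n"
  shows "A * B \<in> Mat S n"
  unfolding Mat_iff
proof (intro conjI allI impI)
  show "A * B \<in> carrier_mat n n" 
    by (rule mult_carrier_mat[OF MatD(1)[OF assms(2)] MatD(1)[OF assms(3)]])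
  fix i j assume "i < n" "j < n"
  then show "(A * B) $$ (i, j) \<in> S"
    using MatD assms(2,3)
    by (subst index_mult_mat_sum[OF MatD(1)[OF assms(2)] MatD(1)[OF assms(3)]])
      (auto intro!: is_subring_sum[OF S] is_subringD(4)[OF S])
qed

lemma minv_unique:
  fixes U :: "'a::field mat"
  assumes "U \<in> carrier_mat n n" "V \<in> carrier_mat n n" "U * V = 1\<^sub>m n" "V * U = 1\<^sub>m n"
  shows "minv U = V"
proof (cases "mat_inverse U")
  case None
  then have "U \<notin> Units (ring_mat TYPE('a) n ())" 
    using mat_inverse(1)[OF assms(1), where b = "()"] by simp
  moreover have "U \<in> Units (ring_mat TYPE('a) n ())"
    using assms by (auto simp: Units_def ring_mat_def)
  ultimately show ?thesis by simp
next
  case (Some B)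
  then have B: "U * B = 1\<^sub>m n" "B \<in> carrier_mat n n" using mat_inverse(2)[OF assms(1)] by auto
  have "B = (V * U) * B" using assms(4) B by simp
  also have "\<dots> = V * (U * B)" using assms B by (intro assoc_mult_mat) auto
  also have "\<dots> = V" using B assms by simp
  finally show ?thesis using Some by simp
qed

lemma GL_D:
  assumes "U \<in> GL S n"
  shows "U \<in> Mat S n" "U \<in> carrier_mat n n" "minv U \<in> Mat S n" "minv U \<in> carrier_mat n n"
    "U * minv U = 1\<^sub>m n" "minv U * U = 1\<^sub>m n" "minv U \<in> GL S n" "minv (minv U) = U"
proof -
  obtain V where V: "U \<in> Mat S n" "V \<in> Mat S n" "U * V = 1\<^sub>m n" "V * U = 1\<^sub>m n"
    using assms by (auto simp: GL_def)
  then have "minv U = V" "minv V = U" using minv_unique MatD(1) by blast+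
  with V show "U \<in> Mat S n" "U \<in> carrier_mat n n" "minv U \<in> Mat S n" "minv U \<in> carrier_mat n n"
    "U * minv U = 1\<^sub>m n" "minv U * U = 1\<^sub>m n" "minv U \<in> GL S n" "minv (minv U) = U"
    using MatD(1) by (auto simp: GL_def)
qed

lemma mult_minv_cancel:
  assumes U: "U \<in> GL S n" and A: "A \<in> carrier_mat n k"
  shows "U * (minv U * A) = A" "minv U * (U * A) = A"
  using A GL_D(5,6)[OF U] assoc_mult_mat[OF GL_D(2)[OF U] GL_D(4)[OF U] A]
    assoc_mult_mat[OF GL_D(4)[OF U] GL_D(2)[OF U] A] by simp_all

lemma mult_minv_cancel_right:
  assumes U: "U \<in> GL S n" and A: "A \<in> carrier_mat k n"
  shows "A * U * minv U = A" "A * minv U * U = A"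
  using A GL_D(5,6)[OF U] assoc_mult_mat[OF A GL_D(2)[OF U] GL_D(4)[OF U]]
    assoc_mult_mat[OF A GL_D(4)[OF U] GL_D(2)[OF U]] by simp_all

lemma Mat_one: "is_subring S \<Longrightarrow> 1\<^sub>m n \<in> Mat S n"
  by (auto simp: Mat_iff is_subringD)

lemma GL_one: "is_subring S \<Longrightarrow> 1\<^sub>m n \<in> GL S n" "minv (1\<^sub>m n) = 1\<^sub>m n"
  using Mat_one[of S n] minv_unique[of "1\<^sub>m n" n "1\<^sub>m n"]
  by (auto simp: GL_def intro!: bexI[of _ "1\<^sub>m n"])

lemma GL_mult:
  assumes S: "is_subring S" and U: "U \<in> GL S n" and V: "V \<in> GL S n"
  shows "U * V \<in> GL S n" "minv (U * V) = minv V * minv U"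
proof -
  note UD = GL_D[OF U] and VD = GL_D[OF V]
  have 1: "U * V * (minv V * minv U) = 1\<^sub>m n"
    using UD VD by (simp add: assoc_mult_mat[of _ n n _ n _ n] mult_minv_cancel[OF V])
  have 2: "minv V * minv U * (U * V) = 1\<^sub>m n"
    using UD VD by (simp add: assoc_mult_mat[of _ n n _ n _ n] mult_minv_cancel[OF U])
  show "U * V \<in> GL S n" unfolding GL_def using 1 2 Mat_mult[OF S] UD VD by blast
  show "minv (U * V) = minv V * minv U" using 1 2 UD VD by (intro minv_unique[of _ n]) auto
qed

lemma signof_in_subring: "is_subring S \<Longrightarrow> signof p \<in> S"
  by (auto simp: sign_def is_subringD)

lemma det_in_subring:
  assumes S: "is_subring S" and A: "A \<in> Mat S n"
  shows "det A \<in> S"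
proof -
  have "(\<Prod>i = 0..<n. A $$ (i, p i)) \<in> S" if "p permutes {0..<n}" for p
  proof (rule is_subring_prod[OF S])
    fix i assume "i \<in> {0..<n}"
    moreover from this have "p i \<in> {0..<n}" by (simp only: permutes_in_image[OF that])
    ultimately show "A $$ (i, p i) \<in> S" by (intro MatD(2)[OF A]) simp_all
  qed
  then have "signof p * (\<Prod>i = 0..<n. A $$ (i, p i)) \<in> S" if "p permutes {0..<n}" for p
    using that by (intro is_subringD(4)[OF S signof_in_subring[OF S]])
  then have "(\<Sum>p\<in>{p. p permutes {0..<n}}. signof p * (\<Prod>i = 0..<n. A $$ (i, p i))) \<in> S"
    by (intro is_subring_sum[OF S]) blast
  then show ?thesis by (simp only: det_def'[OF MatD(1)[OF A]])
qed

text \<open>The inverse is the adjugate divided by the determinant, so its entries stay in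
  \<open>S\<close>. Invertibility over a smaller field is thus a matter of where the entries of the
  matrix itself lie.\<close>

lemma GL_iff_det:
  assumes S: "is_subfield S"
  shows "A \<in> GL S n \<longleftrightarrow> A \<in> Mat S n \<and> det A \<noteq> 0"
proof
  assume A: "A \<in> GL S n"
  have "det A * det (minv A) = 1"
    using det_mult[OF GL_D(2)[OF A] GL_D(4)[OF A]] GL_D(5)[OF A] by simp
  then show "A \<in> Mat S n \<and> det A \<noteq> 0" using GL_D(1)[OF A] by auto
next
  note R = is_subring_subfield[OF S]
  assume A: "A \<in> Mat S n \<and> det A \<noteq> 0"
  then have Ac: "A \<in> carrier_mat n n" using MatD by blast
  let ?V = "inverse (det A) \<cdot>\<^sub>m adj_mat A"
  note adj = adj_mat[OF Ac]
  have "cofactor A i j \<in> S" if "i < n" "j < n" for i j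
  proof -
    have "mat_delete A i j \<in> Mat S (n - 1)"
      using A that by (auto simp: Mat_iff mat_delete_def)
    then have "det (mat_delete A i j) \<in> S" by (rule det_in_subring[OF R])
    then show ?thesis unfolding cofactor_def by (auto intro!: is_subringD[OF R])
  qed
  then have "?V \<in> Mat S n" using A is_subfieldD[OF S] det_in_subring[OF R, of A n] adj(1)
    by (auto simp: Mat_iff adj_mat_def)
  moreover have "A * ?V = 1\<^sub>m n" "?V * A = 1\<^sub>m n"
    using adj A Ac by (auto simp: mult_smult_distrib[OF Ac adj(1)] mult_smult_assoc_mat[OF adj(1) Ac] intro!: eq_matI)
  ultimately show "A \<in> GL S n" using A by (auto simp: GL_def)
qed

lemma minv_eq_adj:
  assumes "A \<in> GL UNIV n"
  shows "minv A = inverse (det A) \<cdot>\<^sub>m adj_mat A"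
proof -
  have A: "A \<in> carrier_mat n n" "det A \<noteq> 0" using assms by (auto simp: GL_iff_det is_subfield_def Mat_iff)
  note adj = adj_mat[OF A(1)]
  show ?thesis
    using adj A
    by (intro minv_unique[of _ n]) (auto simp: mult_smult_distrib[OF A(1) adj(1)] mult_smult_assoc_mat[OF adj(1) A(1)] intro!: eq_matI)
qed

section \<open>Matrices as points of affine space, in row-major order\<close>

definition entries :: "nat \<Rightarrow> 'a mat \<Rightarrow> nat \<Rightarrow> 'a" where
  "entries m A = (\<lambda>k. A $$ (k div m, k mod m))"

definition of_entries :: "nat \<Rightarrow> (nat \<Rightarrow> 'a) \<Rightarrow> 'a mat" where
  "of_entries m x = mat m m (\<lambda>(i, j). x (i * m + j))"

lemma index_less_square: "k < m * m \<Longrightarrow> k div m < m" "k < m * m \<Longrightarrow> k mod m < m" for m :: nat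
  by (cases "m = 0", auto simp: less_mult_imp_div_less)+

lemma index_pair_less: "i < m \<Longrightarrow> j < m \<Longrightarrow> i * m + j < m * m" for m :: nat
proof -
  assume "i < m" "j < m"
  then have "i * m + j < Suc i * m" by simp
  also have "\<dots> \<le> m * m" using \<open>i < m\<close> by (intro mult_le_mono1) simp
  finally show ?thesis .
qed

lemma of_entries_carrier [simp]: "of_entries m x \<in> carrier_mat m m"
  by (simp add: of_entries_def)

lemma entries_of_entries: "k < m * m \<Longrightarrow> entries m (of_entries m x) k = x k"
  using index_less_square by (simp add: entries_def of_entries_def)

lemma of_entries_entries: "A \<in> carrier_mat m m \<Longrightarrow> of_entries m (entries m A) = A"
  by (intro eq_matI) (auto simp: entries_def of_entries_def)

lemma of_entries_Mat: "(\<And>k. k < m * m \<Longrightarrow> x k \<in> S) \<Longrightarrow> of_entries m x \<in> Mat S m"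
  by (auto simp: Mat_iff of_entries_def index_pair_less)

lemma polyfun_sum:
  assumes "is_subfield S" "\<And>i. i \<in> I \<Longrightarrow> f i \<in> polyfun S N"
  shows "(\<lambda>x. \<Sum>i\<in>I. f i x) \<in> polyfun S N"
  using assms(2) by (induction I rule: infinite_finite_induct) 
    (auto intro: polyfun.add polyfun.const is_subfieldD[OF assms(1)])

lemma polyfun_prod:
  assumes "is_subfield S" "\<And>i. i \<in> I \<Longrightarrow> f i \<in> polyfun S N"
  shows "(\<lambda>x. \<Prod>i\<in>I. f i x) \<in> polyfun S N"
  using assms(2) by (induction I rule: infinite_finite_induct) 
    (auto intro: polyfun.mult polyfun.const is_subfieldD[OF assms(1)])

lemma polyfun_subst:
  assumes "p \<in> polyfun S N" "S \<subseteq> T" "\<And>i. i < N \<Longrightarrow> (\<lambda>x. g x i) \<in> polyfun T M"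
  shows "(\<lambda>x. p (g x)) \<in> polyfun T M"
  using assms(1) by (induction rule: polyfun.induct) (use assms(2,3) in \<open>auto intro: polyfun.intros\<close>)

lemma polyfun_mult_left:
  assumes S: "is_subfield S" and A: "A \<in> Mat S m" and p: "p \<in> polyfun T (m * m)" "T \<subseteq> S"
  shows "(\<lambda>x. p (entries m (A * of_entries m x))) \<in> polyfun S (m * m)"
proof (rule polyfun_subst[OF p])
  fix k assume k: "k < m * m"
  note kl = index_less_square[OF k]
  have "entries m (A * of_entries m x) k = (\<Sum>s<m. A $$ (k div m, s) * x (s * m + k mod m))" for x
    unfolding entries_def using kl
    by (subst index_mult_mat_sum[OF MatD(1)[OF A] of_entries_carrier]) (auto simp: of_entries_def)
  then show "(\<lambda>x. entries m (A * of_entries m x) k) \<in> polyfun S (m * m)"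
    using kl MatD(2)[OF A] index_pair_less
    by (auto intro!: polyfun_sum[OF S] polyfun.mult polyfun.var intro: polyfun.const)
qed

lemma polyfun_mult_right:
  assumes S: "is_subfield S" and A: "A \<in> Mat S m" and p: "p \<in> polyfun T (m * m)" "T \<subseteq> S"
  shows "(\<lambda>x. p (entries m (of_entries m x * A))) \<in> polyfun S (m * m)"
proof (rule polyfun_subst[OF p])
  fix k assume k: "k < m * m"
  note kl = index_less_square[OF k]
  have "entries m (of_entries m x * A) k = (\<Sum>s<m. x ((k div m) * m + s) * A $$ (s, k mod m))" for x
    unfolding entries_def using kl
    by (subst index_mult_mat_sum[OF of_entries_carrier MatD(1)[OF A]]) (auto simp: of_entries_def)
  then show "(\<lambda>x. entries m (of_entries m x * A) k) \<in> polyfun S (m * m)"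
    using kl MatD(2)[OF A] index_pair_less
    by (auto intro!: polyfun_sum[OF S] polyfun.mult polyfun.var intro: polyfun.const)
qed

lemma det_mat_permutations:
  "det (mat k k (\<lambda>(i, j). h i j)) = (\<Sum>p | p permutes {0..<k}. signof p * (\<Prod>i = 0..<k. h i (p i)))"
  for h :: "nat \<Rightarrow> nat \<Rightarrow> 'a::comm_ring_1"
  by (subst det_def'[of _ k]) (auto simp: permutes_in_image intro!: sum.cong prod.cong)

lemma polyfun_det:
  assumes S: "is_subfield S" and h: "\<And>i j. i < k \<Longrightarrow> j < k \<Longrightarrow> h i j \<in> polyfun S N"
  shows "(\<lambda>x. det (mat k k (\<lambda>(i, j). h i j x))) \<in> polyfun S N"
proof -
  have "h i (p i) \<in> polyfun S N" if "p permutes {0..<k}" "i < k" for p i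
    using that permutes_in_image[OF that(1), of i] h by simp
  then show ?thesis unfolding det_mat_permutations
    using signof_in_subring[OF is_subring_subfield[OF S]]
    by (auto intro!: polyfun_sum[OF S] polyfun_prod[OF S] polyfun.mult intro: polyfun.const)
qed

lemma polyfun_det_of_entries:
  assumes "is_subfield S"
  shows "(\<lambda>x. det (of_entries m x)) \<in> polyfun S (m * m)"
  unfolding of_entries_def
  by (rule polyfun_det[OF assms]) (auto intro: polyfun.var index_pair_less)

lemma polyfun_subset_lspan:
  assumes S: "is_subfield S"
  shows "polyfun UNIV N \<subseteq> lspan (polyfun S N)"
proof
  fix f :: "(nat \<Rightarrow> 'a) \<Rightarrow> 'a" assume "f \<in> polyfun UNIV N"
  then show "f \<in> lspan (polyfun S N)"
  proof (induction rule: polyfun.induct)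
    case (const c)
    have "(\<lambda>x. 1) \<in> polyfun S N" using is_subfieldD[OF S] by (intro polyfun.const)
    from lspan_base[OF this, of c] show ?case by simp
  next
    case (mult f g)
    show ?case by (rule lspan_mult_closed[OF _ mult.IH]) (intro lspan_incl polyfun.mult)
  qed (auto intro: lspan_incl polyfun.var lspan_add)
qed

lemma fun_subspace_polyfun: "is_subfield S \<Longrightarrow> fun_subspace S (polyfun S N)"
  by (auto simp: fun_subspace_def is_subfieldD intro: polyfun.intros)

lemma fun_subspace_lspan: "fun_subspace UNIV (lspan V)"
  by (auto simp: fun_subspace_def intro: lspan.zero lspan_add lspan_scale)

section \<open>Bounded degree and translation by powers of a matrix\<close>

definition monoms :: "nat \<Rightarrow> nat \<Rightarrow> nat list set" where
  "monoms N d = {w. set w \<subseteq> {..<N} \<and> length w \<le> d}"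

text \<open>Monomials are words of variable indices, so one monomial has several words; the words of
  bounded length serve as a finite spanning family, not as a basis.\<close>

definition monom_fun :: "nat list \<Rightarrow> (nat \<Rightarrow> 'a::field) \<Rightarrow> 'a" where
  "monom_fun w x = prod_list (map x w)"

definition polyfun_deg :: "'a::field set \<Rightarrow> nat \<Rightarrow> nat \<Rightarrow> ((nat \<Rightarrow> 'a) \<Rightarrow> 'a) set" where
  "polyfun_deg S N d = {f. \<exists>a. (\<forall>w. a w \<in> S) \<and> f = (\<lambda>x. \<Sum>w\<in>monoms N d. a w * monom_fun w x)}"

lemma finite_monoms: "finite (monoms N d)"
  unfolding monoms_def by (rule finite_lists_length_le) simp

lemma fun_subspace_polyfun_deg:
  assumes S: "is_subfield S"
  shows "fun_subspace S (polyfun_deg S N d)"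
  unfolding fun_subspace_def
proof (intro conjI ballI)
  note SD = is_subfieldD[OF S]
  show "(\<lambda>x. 0) \<in> polyfun_deg S N d"
    unfolding polyfun_deg_def using SD(1) by (intro CollectI exI[of _ "\<lambda>w. 0"]) simp
  fix f g assume "f \<in> polyfun_deg S N d" "g \<in> polyfun_deg S N d"
  then obtain a b where "\<forall>w. a w \<in> S" "f = (\<lambda>x. \<Sum>w\<in>monoms N d. a w * monom_fun w x)"
    "\<forall>w. b w \<in> S" "g = (\<lambda>x. \<Sum>w\<in>monoms N d. b w * monom_fun w x)" by (auto simp: polyfun_deg_def)
  then show "(\<lambda>x. f x + g x) \<in> polyfun_deg S N d" unfolding polyfun_deg_def using SD(3)
    by (intro CollectI exI[of _ "\<lambda>w. a w + b w"]) (auto simp: sum.distrib distrib_right)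
next
  note SD = is_subfieldD[OF S]
  fix c f assume "c \<in> S" "f \<in> polyfun_deg S N d"
  then obtain a where "\<forall>w. a w \<in> S" "f = (\<lambda>x. \<Sum>w\<in>monoms N d. a w * monom_fun w x)"
    by (auto simp: polyfun_deg_def)
  then show "(\<lambda>x. c * f x) \<in> polyfun_deg S N d" unfolding polyfun_deg_def using SD(4) \<open>c \<in> S\<close>
    by (intro CollectI exI[of _ "\<lambda>w. c * a w"]) (auto simp: sum_distrib_left mult.assoc)
qed

lemma monom_fun_in_polyfun_deg:
  assumes S: "is_subfield S" and w: "w \<in> monoms N d"
  shows "monom_fun w \<in> polyfun_deg S N d"
proof -
  have "(\<Sum>v\<in>monoms N d. (if v = w then 1 else 0) * monom_fun v x) = monom_fun w x" for x :: "nat \<Rightarrow> 'a"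
    using w finite_monoms by (simp add: if_distrib[of "\<lambda>c. c * _"] cong: if_cong)
  then show ?thesis unfolding polyfun_deg_def using is_subfieldD[OF S]
    by (intro CollectI exI[of _ "\<lambda>v. if v = w then 1 else 0"]) auto
qed

lemma polyfun_deg_combination:
  assumes S: "is_subfield S" and f: "f \<in> polyfun_deg S N d" and V: "fun_subspace S V"
    and "\<And>w. w \<in> monoms N d \<Longrightarrow> (\<lambda>x. monom_fun w (h x)) \<in> V"
  shows "(\<lambda>x. f (h x)) \<in> V"
proof -
  obtain a where "\<forall>w. a w \<in> S" "f = (\<lambda>x. \<Sum>w\<in>monoms N d. a w * monom_fun w x)"
    using f by (auto simp: polyfun_deg_def)
  then show ?thesis using assms(4) by (auto intro!: fun_subspace_sum[OF V] fun_subspaceD(3)[OF V])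
qed

lemma polyfun_deg_mono:
  assumes S: "is_subfield S" and f: "f \<in> polyfun_deg S N d" and "d \<le> e"
  shows "f \<in> polyfun_deg S N e"
  using polyfun_deg_combination[OF S f fun_subspace_polyfun_deg[OF S], of "\<lambda>x. x"] assms(3)
    monom_fun_in_polyfun_deg[OF S]
  by (auto simp: monoms_def)

lemma polyfun_deg_mult:
  assumes S: "is_subfield S" and f: "f \<in> polyfun_deg S N d" and g: "g \<in> polyfun_deg S N e"
  shows "(\<lambda>x. f x * g x) \<in> polyfun_deg S N (d + e)"
proof -
  obtain a where a: "\<And>w. a w \<in> S" "f = (\<lambda>x. \<Sum>w\<in>monoms N d. a w * monom_fun w x)"
    using f by (auto simp: polyfun_deg_def)
  obtain b where b: "\<And>w. b w \<in> S" "g = (\<lambda>x. \<Sum>w\<in>monoms N e. b w * monom_fun w x)"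
    using g by (auto simp: polyfun_deg_def)
  note V = fun_subspace_polyfun_deg[OF S]
  have "f x * g x = (\<Sum>w\<in>monoms N d. \<Sum>v\<in>monoms N e. (a w * b v) * monom_fun (w @ v) x)" for x
    unfolding a(2) b(2) sum_product by (simp add: monom_fun_def mult_ac)
  moreover have "monom_fun (w @ v) \<in> polyfun_deg S N (d + e)" if "w \<in> monoms N d" "v \<in> monoms N e" for w v
    using that by (intro monom_fun_in_polyfun_deg[OF S]) (auto simp: monoms_def)
  ultimately show ?thesis using a(1) b(1) is_subfieldD(4)[OF S]
    by (auto intro!: fun_subspace_sum[OF V] fun_subspaceD(3)[OF V])
qed

lemma polyfun_has_deg:
  assumes S: "is_subfield S" and "f \<in> polyfun S N"
  shows "\<exists>d. f \<in> polyfun_deg S N d"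
  using assms(2)
proof (induction rule: polyfun.induct)
  case (const c)
  have "monom_fun [] \<in> polyfun_deg S N 0" by (intro monom_fun_in_polyfun_deg[OF S]) (simp add: monoms_def)
  from fun_subspaceD(3)[OF fun_subspace_polyfun_deg[OF S] const this]
  show ?case by (auto simp: monom_fun_def)
next
  case (var i)
  have "monom_fun [i] \<in> polyfun_deg S N 1" using var by (intro monom_fun_in_polyfun_deg[OF S]) (simp add: monoms_def)
  then show ?case by (auto simp: monom_fun_def[abs_def])
next
  case (add f g)
  then obtain d e where "f \<in> polyfun_deg S N d" "g \<in> polyfun_deg S N e" by blast
  then have "f \<in> polyfun_deg S N (max d e)" "g \<in> polyfun_deg S N (max d e)"
    using polyfun_deg_mono[OF S] by auto
  then show ?case using fun_subspaceD(2)[OF fun_subspace_polyfun_deg[OF S]] by blast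
next
  case (mult f g)
  then show ?case using polyfun_deg_mult[OF S] by blast
qed

text \<open>A linear change of coordinates replaces each letter of a word by a combination of single
  letters. All translates of a function by powers of a matrix therefore stay in one
  finite-dimensional space.\<close>

lemma polyfun_deg_mult_right:
  assumes S: "is_subfield S" and A: "A \<in> Mat S m" and f: "f \<in> polyfun_deg S (m * m) d"
  shows "(\<lambda>x. f (entries m (of_entries m x * A))) \<in> polyfun_deg S (m * m) d"
proof (rule polyfun_deg_combination[OF S f fun_subspace_polyfun_deg[OF S]])
  let ?h = "\<lambda>x. entries m (of_entries m x * A)"
  note V = fun_subspace_polyfun_deg[OF S]
  have var: "(\<lambda>x. ?h x k) \<in> polyfun_deg S (m * m) 1" if k: "k < m * m" for k
  proof -
    note kl = index_less_square[OF k]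
    have "?h x k = (\<Sum>s<m. A $$ (s, k mod m) * monom_fun [(k div m) * m + s] x)" for x
      unfolding entries_def using kl
      by (subst index_mult_mat_sum[OF of_entries_carrier MatD(1)[OF A]]) (auto simp: of_entries_def monom_fun_def mult.commute intro!: sum.cong)
    moreover have "monom_fun [(k div m) * m + s] \<in> polyfun_deg S (m * m) 1" if "s < m" for s
      using that kl index_pair_less by (intro monom_fun_in_polyfun_deg[OF S]) (auto simp: monoms_def)
    ultimately show ?thesis using kl MatD(2)[OF A]
      by (auto intro!: fun_subspace_sum[OF V] fun_subspaceD(3)[OF V])
  qed
  fix w assume "w \<in> monoms (m * m) d"
  then have "set w \<subseteq> {..<m * m}" "length w \<le> d" by (auto simp: monoms_def)
  then show "(\<lambda>x. monom_fun w (?h x)) \<in> polyfun_deg S (m * m) d"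
  proof (induction w arbitrary: d)
    case Nil
    have "monom_fun [] \<in> polyfun_deg S (m * m) d" by (intro monom_fun_in_polyfun_deg[OF S]) (simp add: monoms_def)
    then show ?case by (simp add: monom_fun_def[abs_def])
  next
    case (Cons i w)
    then obtain e where e: "d = 1 + e" "length w \<le> e" by (cases d) auto
    have "(\<lambda>x. ?h x i * monom_fun w (?h x)) \<in> polyfun_deg S (m * m) (1 + e)"
      using Cons e var by (intro polyfun_deg_mult[OF S]) auto
    then show ?case by (simp add: monom_fun_def e)
  qed
qed

fun mat_power :: "'a::semiring_1 mat \<Rightarrow> nat \<Rightarrow> 'a mat" where
  "mat_power X 0 = 1\<^sub>m (dim_row X)"
| "mat_power X (Suc k) = X * mat_power X k"

lemma mat_power_Mat: "is_subring S \<Longrightarrow> X \<in> Mat S m \<Longrightarrow> mat_power X k \<in> Mat S m"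
  by (induction k) (auto simp: Mat_one Mat_mult dest: MatD(1))

lemma mat_power_cancel:
  assumes X: "X \<in> GL S m"
  shows "mat_power (minv X) k * mat_power X (k + j) = mat_power X j"
proof (induction k arbitrary: j)
  case 0
  have "mat_power X j \<in> carrier_mat m m" by (induction j) (use GL_D(2)[OF X] in auto)
  then show ?case using GL_D[OF X] by simp
next
  case (Suc k)
  have c: "mat_power Y j \<in> carrier_mat m m" if "Y \<in> carrier_mat m m" for Y :: "'a mat" and j
    by (induction j) (use that in auto)
  note X' = GL_D(2,4)[OF X]
  have comm: "minv X * mat_power (minv X) k = mat_power (minv X) k * minv X"
  proof (induction k)
    case (Suc k)
    then show ?case using assoc_mult_mat[OF X'(2) c[OF X'(2), of k] X'(2)] by simp
  qed (use X' in simp)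
  have "mat_power (minv X) (Suc k) * mat_power X (Suc k + j)
      = mat_power (minv X) k * minv X * (X * mat_power X (k + j))"
    by (simp add: comm)
  also have "\<dots> = mat_power (minv X) k * (minv X * (X * mat_power X (k + j)))"
    using c[OF X'(1), of "k + j"] c[OF X'(2), of k] X' by (intro assoc_mult_mat[of _ m m _ m _ m]) auto
  also have "\<dots> = mat_power X j"
    using mult_minv_cancel(2)[OF X c[OF X'(1), of "k + j"]] Suc.IH by simp
  finally show ?case .
qed

text \<open>The relations among the entries of \<open>F\<close> of bounded degree form a finite-dimensional space on
  which \<open>X\<close> acts injectively, hence bijectively.\<close>

lemma relation_reflects:
  fixes F :: "'a::field mat"
  assumes S: "is_subfield S" and F: "F \<in> carrier_mat m m" and X: "X \<in> GL S m"
    and rel: "\<And>p. p \<in> polyfun S (m * m) \<Longrightarrow> p (entries m F) = 0 \<Longrightarrow> p (entries m (F * X)) = 0"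
    and p: "p \<in> polyfun S (m * m)" "p (entries m (F * X)) = 0"
  shows "p (entries m F) = 0"
proof -
  note R = is_subring_subfield[OF S]
  note X' = GL_D[OF X]
  let ?q = "\<lambda>k x. p (entries m (of_entries m x * mat_power X k))"
  obtain d where d: "p \<in> polyfun_deg S (m * m) d" using polyfun_has_deg[OF S p(1)] by blast
  have XM: "mat_power X k \<in> Mat S m" for k by (rule mat_power_Mat[OF R X'(1)])
  note XC = MatD(1)[OF XM]
  have YC: "mat_power (minv X) k \<in> carrier_mat m m" for k
    by (rule MatD(1)[OF mat_power_Mat[OF R X'(3)]])
  have "?q k \<in> polyfun_deg S (m * m) d" for k by (rule polyfun_deg_mult_right[OF S XM d])
  then have "\<forall>k. \<exists>a. (\<forall>w. a w \<in> S) \<and> ?q k = (\<lambda>x. \<Sum>w\<in>monoms (m * m) d. a w * monom_fun w x)"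
    unfolding polyfun_deg_def by blast
  from choice[OF this] obtain a where a: "\<And>k w. a k w \<in> S"
    "\<And>k. ?q k = (\<lambda>x. \<Sum>w\<in>monoms (m * m) d. a k w * monom_fun w x)" by blast
  let ?W = "monoms (m * m) d"
  obtain e where e: "bij_betw e {0..<card ?W} ?W" using ex_bij_betw_nat_finite[OF finite_monoms] by blast
  \<comment> \<open>The \<open>card ?W + 1\<close> translates with exponents from 0 to
    \<open>card ?W\<close> are combinations of \<open>card ?W\<close> words, hence linearly
    dependent.\<close>
  have "\<exists>c. (\<forall>i\<in>{..card ?W}. c i \<in> S) \<and> (\<exists>i\<in>{..card ?W}. c i \<noteq> 0) \<and>
      (\<forall>j<card ?W. (\<Sum>i\<in>{..card ?W}. c i * a i (e j)) = 0)"
    by (rule exists_dependency[OF S]) (auto simp: a(1))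
  then obtain c where c: "\<exists>i\<le>card ?W. c i \<noteq> 0" "\<And>j. j < card ?W \<Longrightarrow> (\<Sum>i\<in>{..card ?W}. c i * a i (e j)) = 0"
    by auto
  let ?n = "card ?W"
  have c0: "(\<Sum>i\<le>?n. c i * a i w) = 0" if w: "w \<in> ?W" for w
  proof -
    have "w \<in> e ` {0..<?n}" using e w by (simp add: bij_betw_def)
    then show ?thesis using c(2) by auto
  qed
  have dep: "(\<Sum>i\<le>?n. c i * ?q i x) = 0" for x
  proof -
    have "(\<Sum>i\<le>?n. c i * ?q i x) = (\<Sum>i\<le>?n. \<Sum>w\<in>?W. c i * (a i w * monom_fun w x))"
      using fun_cong[OF a(2), where x = x] by (simp add: sum_distrib_left)
    also have "\<dots> = (\<Sum>w\<in>?W. (\<Sum>i\<le>?n. c i * a i w) * monom_fun w x)"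
      by (subst sum.swap) (simp add: sum_distrib_right mult.assoc)
    also have "\<dots> = 0" using c0 by simp
    finally show ?thesis .
  qed
  define k0 where "k0 = (LEAST i. c i \<noteq> 0)"
  obtain i where i: "i \<le> ?n" "c i \<noteq> 0" using c(1) by blast
  have k0: "c k0 \<noteq> 0" unfolding k0_def using i(2) by (rule LeastI)
  have "k0 \<le> i" unfolding k0_def using i(2) by (rule Least_le)
  then have k0n: "k0 \<le> ?n" using i(1) by simp
  have below: "c i = 0" if "i < k0" for i using that not_less_Least unfolding k0_def by blast
  have qrel: "?q (Suc j) (entries m F) = 0" for j
  proof (induction j)
    case 0
    then show ?case using p(2) X' F by (simp add: of_entries_entries)
  next
    case (Suc j)
    have "?q (Suc j) \<in> polyfun S (m * m)" by (rule polyfun_mult_right[OF S XM p(1) subset_refl])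
    from rel[OF this Suc] have "p (entries m (F * X * mat_power X (Suc j))) = 0"
      using F X' by (simp add: of_entries_entries)
    moreover have "F * X * mat_power X (Suc j) = F * mat_power X (Suc (Suc j))"
      using assoc_mult_mat[OF F X'(2) XC[of "Suc j"]] by simp
    ultimately show ?case using F by (simp add: of_entries_entries)
  qed
  \<comment> \<open>Starting from \<open>F X^(-k0)\<close> shifts all exponents down by
    \<open>k0\<close>: terms above \<open>k0\<close> vanish by \<open>qrel\<close>, terms below have
    coefficient zero, and the term at \<open>k0\<close> is \<open>c k0\<close> times the value of
    \<open>p\<close> at \<open>F\<close>.\<close>
  define x0 where "x0 = entries m (F * mat_power (minv X) k0)"
  have q: "?q (k0 + j) x0 = ?q j (entries m F)" for j
  proof -
    have "F * mat_power (minv X) k0 * mat_power X (k0 + j) = F * mat_power X j"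
      using assoc_mult_mat[OF F YC[of k0] XC[of "k0 + j"]] mat_power_cancel[OF X] by simp
    then show ?thesis using F YC by (simp add: x0_def of_entries_entries)
  qed
  have z: "c i * ?q i x0 = 0" if "i \<noteq> k0" for i
  proof (cases "i < k0")
    case True
    then show ?thesis using below by simp
  next
    case False
    then have "i = k0 + Suc (i - k0 - 1)" using that by simp
    then show ?thesis using q[of "Suc (i - k0 - 1)"] qrel by (metis mult_zero_right)
  qed
  have "(\<Sum>i\<le>?n. c i * ?q i x0) = c k0 * ?q k0 x0"
  proof -
    have "(\<Sum>i\<in>{..?n} - {k0}. c i * ?q i x0) = 0" by (rule sum.neutral) (use z in blast)
    then show ?thesis using k0n sum.remove[of "{..?n}" k0 "\<lambda>i. c i * ?q i x0"] by simp
  qed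
  then have "?q 0 (entries m F) = 0" using dep[of x0] k0 q[of 0] by simp
  then show ?thesis using F X' by (simp add: of_entries_entries)
qed

lemma polyfun_diff:
  assumes "is_subfield S" "f \<in> polyfun S N" "g \<in> polyfun S N"
  shows "(\<lambda>x. f x - g x) \<in> polyfun S N"
  using is_subringD(3)[OF is_subring_polyfun[OF assms(1)] assms(2,3)] by (simp add: fun_diff_def)

section \<open>Generated subfields and isomorphisms between them\<close>

definition fractions :: "'a::field set \<Rightarrow> nat \<Rightarrow> (nat \<Rightarrow> 'a) \<Rightarrow> 'a set" where
  "fractions S N y = {p y / q y | p q. p \<in> polyfun S N \<and> q \<in> polyfun S N \<and> q y \<noteq> 0}"

lemma fractionsI: "p \<in> polyfun S N \<Longrightarrow> q \<in> polyfun S N \<Longrightarrow> q y \<noteq> 0 \<Longrightarrow> u = p y / q y \<Longrightarrow> u \<in> fractions S N y"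
  by (auto simp: fractions_def)

lemma fractionsE:
  assumes "u \<in> fractions S N y"
  obtains p q where "p \<in> polyfun S N" "q \<in> polyfun S N" "q y \<noteq> 0" "u = p y / q y"
  using assms by (auto simp: fractions_def)

lemma fractions_incl:
  assumes "is_subfield S" "p \<in> polyfun S N"
  shows "p y \<in> fractions S N y"
  using assms polyfun.const[OF is_subfieldD(2)[OF assms(1)]] by (intro fractionsI[of p S N "\<lambda>x. 1"]) auto

lemma is_subfield_fractions:
  assumes S: "is_subfield S"
  shows "is_subfield (fractions S N y)"
  unfolding is_subfield_def
proof (intro conjI ballI)
  note SD = is_subfieldD[OF S]
  show "0 \<in> fractions S N y" using fractions_incl[OF S polyfun.const[OF SD(1)]] by simp
  show "1 \<in> fractions S N y" using fractions_incl[OF S polyfun.const[OF SD(2)]] by simp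
  fix u v assume "u \<in> fractions S N y" "v \<in> fractions S N y"
  then obtain p q r s where *: "p \<in> polyfun S N" "q \<in> polyfun S N" "q y \<noteq> 0" "u = p y / q y"
    "r \<in> polyfun S N" "s \<in> polyfun S N" "s y \<noteq> 0" "v = r y / s y" by (auto elim!: fractionsE)
  show "u + v \<in> fractions S N y"
    by (rule fractionsI[of "\<lambda>x. p x * s x + r x * q x" S N "\<lambda>x. q x * s x"])
      (use * in \<open>auto intro!: polyfun.add polyfun.mult simp: field_simps\<close>)
  show "u * v \<in> fractions S N y"
    by (rule fractionsI[of "\<lambda>x. p x * r x" S N "\<lambda>x. q x * s x"]) (use * in \<open>auto intro!: polyfun.mult\<close>)
next
  note SD = is_subfieldD[OF S]
  fix u assume "u \<in> fractions S N y"
  then obtain p q where *: "p \<in> polyfun S N" "q \<in> polyfun S N" "q y \<noteq> 0" "u = p y / q y"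
    by (auto elim!: fractionsE)
  show "- u \<in> fractions S N y"
    by (rule fractionsI[of "\<lambda>x. 0 - p x" S N q])
      (use * SD in \<open>auto intro: polyfun_diff[OF S polyfun.const[OF SD(1)], simplified]\<close>)
  show "inverse u \<in> fractions S N y"
  proof (cases "p y = 0")
    case True
    then show ?thesis using * fractions_incl[OF S polyfun.const[OF SD(1)]] by simp
  next
    case False
    then show ?thesis using * by (intro fractionsI[of q S N p]) auto
  qed
qed

lemma fractions_UNIV:
  assumes S: "is_subfield S" and hull: "is_subfield hull (S \<union> X) = UNIV" and "X \<subseteq> fractions S N y"
  shows "u \<in> fractions S N y"
proof -
  have "S \<subseteq> fractions S N y" using fractions_incl[OF S polyfun.const] by blast
  then have "is_subfield hull (S \<union> X) \<subseteq> fractions S N y"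
    using assms(3) is_subfield_fractions[OF S] by (intro hull_minimal) auto
  then show ?thesis using hull by auto
qed

text \<open>The map sends \<open>p y0 / q y0\<close> to \<open>p y1 / q y1\<close>. Equality of the
  relations at both points makes it well defined, keeps denominators nonzero and gives injectivity;
  surjectivity holds because \<open>y1\<close> generates as well.\<close>

lemma exists_specialization_iso:
  fixes S :: "'a::field set"
  assumes S: "is_subfield S"
    and gen0: "\<And>u. u \<in> fractions S N y0" and gen1: "\<And>u. u \<in> fractions S N y1"
    and rel: "\<And>p. p \<in> polyfun S N \<Longrightarrow> p y0 = 0 \<longleftrightarrow> p y1 = 0"
  obtains \<sigma> where "bij \<sigma>" "\<And>u v. \<sigma> (u + v) = \<sigma> u + \<sigma> v" "\<And>u v. \<sigma> (u * v) = \<sigma> u * \<sigma> v"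
    "\<And>c. c \<in> S \<Longrightarrow> \<sigma> c = c" "\<And>p. p \<in> polyfun S N \<Longrightarrow> \<sigma> (p y0) = p y1"
proof -
  note SD = is_subfieldD[OF S]
  have "\<forall>u. \<exists>p q. p \<in> polyfun S N \<and> q \<in> polyfun S N \<and> q y0 \<noteq> 0 \<and> u = p y0 / q y0"
    using gen0 unfolding fractions_def by blast
  then obtain P Q where PQ: "\<And>u. P u \<in> polyfun S N" "\<And>u. Q u \<in> polyfun S N" "\<And>u. Q u y0 \<noteq> 0" 
    "\<And>u. u = P u y0 / Q u y0" by metis
  define \<sigma> where "\<sigma> u = P u y1 / Q u y1" for u
  have key: "\<sigma> (p y0 / q y0) = p y1 / q y1" if pq: "p \<in> polyfun S N" "q \<in> polyfun S N" "q y0 \<noteq> 0" for p q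
  proof -
    let ?u = "p y0 / q y0"
    \<comment> \<open>Two fractions for the same element, cross-multiplied: a relation at
      \<open>y0\<close>, hence at \<open>y1\<close>, so the value of \<sigma> is independent of the
      choice of \<open>P\<close> and \<open>Q\<close>.\<close>
    let ?r = "\<lambda>x. P ?u x * q x - p x * Q ?u x"
    have "?r \<in> polyfun S N" using pq PQ by (intro polyfun_diff[OF S] polyfun.mult)
    moreover have "?r y0 = 0" using PQ(3)[of ?u] PQ(4)[of ?u] pq(3) by (simp add: field_simps)
    ultimately have "?r y1 = 0" using rel[of ?r] by blast
    moreover have "q y1 \<noteq> 0" "Q ?u y1 \<noteq> 0" using rel pq PQ(2,3) by blast+
    ultimately show ?thesis by (simp add: \<sigma>_def field_simps)
  qed
  have nz: "Q u y1 \<noteq> 0" for u using rel PQ(2,3) by blast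
  have key1: "\<sigma> (p y0) = p y1" if "p \<in> polyfun S N" for p
    using key[OF that polyfun.const[OF SD(2)]] by simp
  have add: "\<sigma> (u + v) = \<sigma> u + \<sigma> v" for u v
  proof -
    let ?p = "\<lambda>x. P u x * Q v x + P v x * Q u x" and ?q = "\<lambda>x. Q u x * Q v x"
    have "u + v = P u y0 / Q u y0 + P v y0 / Q v y0" using PQ(4)[of u] PQ(4)[of v] by simp
    also have "\<dots> = ?p y0 / ?q y0" using PQ(3)[of u] PQ(3)[of v] by (simp add: add_frac_eq)
    finally have "\<sigma> (u + v) = \<sigma> (?p y0 / ?q y0)" by simp
    also have "\<dots> = ?p y1 / ?q y1"
      by (rule key[of ?p ?q]) (use PQ in \<open>auto intro!: polyfun.add polyfun.mult\<close>)
    also have "\<dots> = \<sigma> u + \<sigma> v" using nz by (simp add: \<sigma>_def add_frac_eq)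
    finally show ?thesis .
  qed
  have mult: "\<sigma> (u * v) = \<sigma> u * \<sigma> v" for u v
  proof -
    let ?p = "\<lambda>x. P u x * P v x" and ?q = "\<lambda>x. Q u x * Q v x"
    have "u * v = (P u y0 / Q u y0) * (P v y0 / Q v y0)" using PQ(4)[of u] PQ(4)[of v] by simp
    then have "\<sigma> (u * v) = \<sigma> (?p y0 / ?q y0)" by simp
    also have "\<dots> = ?p y1 / ?q y1"
      by (rule key[of ?p ?q]) (use PQ in \<open>auto intro!: polyfun.mult\<close>)
    finally show ?thesis by (simp add: \<sigma>_def)
  qed
  have fix1: "\<sigma> c = c" if "c \<in> S" for c using key1[OF polyfun.const[OF that]] by simp
  have "inj \<sigma>"
  proof (rule injI)
    fix u v assume eq: "\<sigma> u = \<sigma> v"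
    have "\<sigma> (u - v) + \<sigma> v = \<sigma> u" using add[of "u - v" v] by simp
    then have "\<sigma> (u - v) = 0" using eq by simp
    then have "P (u - v) y1 = 0" using nz by (simp add: \<sigma>_def)
    then have "P (u - v) y0 = 0" using rel PQ(1) by blast
    then show "u = v" using PQ(4)[of "u - v"] by simp
  qed
  moreover have "surj \<sigma>"
  proof (rule surjI[of _ "\<lambda>v. SOME u. \<sigma> u = v"])
    fix v
    obtain p q where *: "p \<in> polyfun S N" "q \<in> polyfun S N" "q y1 \<noteq> 0" "v = p y1 / q y1"
      using gen1[of v] by (rule fractionsE)
    then have "\<sigma> (p y0 / q y0) = v" using key[of p q] rel by auto
    then show "\<sigma> (SOME u. \<sigma> u = v) = v" by (rule someI)
  qed
  ultimately have "bij \<sigma>" by (rule bijI)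
  then show ?thesis using add mult fix1 key1 by (intro that[of \<sigma>])
qed


section \<open>Automorphisms of a Picard-Vessiot extension\<close>

lemma derivation_simps:
  assumes "derivation D"
  shows "D (x + y) = D x + D y" "D (x * y) = D x * y + x * D y" "D 0 = 0" "D 1 = 0"
    "D (sum f I) = (\<Sum>i\<in>I. D (f i))" "D (- x) = - D x" "D (x - y) = D x - D y"
    "D (x ^ k) = of_nat k * x ^ (k - 1) * D x"
proof -
  show add: "D (x + y) = D x + D y" and mult: "D (x * y) = D x * y + x * D y" for x y
    using assms by (auto simp: derivation_def)
  have "D (0 + 0) = D 0 + D 0" by (rule add)
  then show z: "D 0 = 0" by (metis add_0_right add_left_cancel)
  have "D (1 * 1) = D 1 * 1 + 1 * D 1" by (rule mult)
  then have "D 1 + 0 = D 1 + D 1" by simp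
  then show o: "D 1 = 0" by (metis add_left_cancel)
  show "D (sum f I) = (\<Sum>i\<in>I. D (f i))"
    by (induction I rule: infinite_finite_induct) (auto simp: z add)
  have neg: "D (- x) = - D x" for x
  proof -
    have "D (x + - x) = D x + D (- x)" by (rule add)
    then show ?thesis by (simp add: z eq_neg_iff_add_eq_0 add.commute)
  qed
  then show "D (- x) = - D x" .
  show "D (x - y) = D x - D y" using add[of x "- y"] neg by simp
  show "D (x ^ k) = of_nat k * x ^ (k - 1) * D x"
  proof (induction k)
    case (Suc k)
    then show ?case by (cases k) (auto simp: mult algebra_simps)
  qed (simp add: o)
qed

lemma derivation_divide:
  assumes "derivation D" "y \<noteq> 0"
  shows "D (x / y) = (D x * y - x * D y) / (y * y)"
proof -
  have "D x = D (x / y * y)" using assms(2) by simp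
  also have "\<dots> = D (x / y) * y + x / y * D y" by (rule derivation_simps[OF assms(1)])
  finally show ?thesis using assms(2) by (simp add: field_simps)
qed

lemma map_mat_derivation_mult:
  assumes "derivation D" and A: "A \<in> carrier_mat n k" and B: "B \<in> carrier_mat k l"
  shows "map_mat D (A * B) = map_mat D A * B + A * map_mat D B"
proof (rule eq_matI)
  note D = derivation_simps[OF assms(1)]
  fix i j assume "i < dim_row (map_mat D A * B + A * map_mat D B)" "j < dim_col (map_mat D A * B + A * map_mat D B)"
  then have ij: "i < n" "j < l" using A B by auto
  have "map_mat D A \<in> carrier_mat n k" "map_mat D B \<in> carrier_mat k l" using A B by auto
  note idx = index_mult_mat_sum[OF A B ij] index_mult_mat_sum[OF A this(2) ij] index_mult_mat_sum[OF this(1) B ij]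
  have "map_mat D (A * B) $$ (i, j) = D ((A * B) $$ (i, j))" using A B ij by simp
  also have "\<dots> = (\<Sum>s<k. D (A $$ (i, s)) * B $$ (s, j)) + (\<Sum>s<k. A $$ (i, s) * D (B $$ (s, j)))"
    unfolding idx by (simp add: D sum.distrib)
  also have "\<dots> = (map_mat D A * B) $$ (i, j) + (A * map_mat D B) $$ (i, j)"
    unfolding idx using A B ij by simp
  finally show "map_mat D (A * B) $$ (i, j) = (map_mat D A * B + A * map_mat D B) $$ (i, j)"
    using A B ij by simp
qed (use A B in auto)

locale picard_vessiot_extension =
  fixes D :: "'a::field \<Rightarrow> 'a" and K :: "'a set" and m :: nat and F :: "'a mat"
  assumes D: "derivation D"
    and diff_K: "diff_subfield D K"
    and C_closed: "algebraically_closed_subfield (constants D K)"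
    and pv: "picard_vessiot D K m F"
begin

abbreviation C :: "'a set" where "C \<equiv> constants D K"

lemma K_subfield: "is_subfield K" and D_in_K: "x \<in> K \<Longrightarrow> D x \<in> K"
  using diff_K by (auto simp: diff_subfield_def)

lemma C_subfield: "is_subfield C" using C_closed by (simp add: algebraically_closed_subfield_def)

lemma C_subset_K: "C \<subseteq> K" by (auto simp: constants_def)

lemma mem_C_iff: "x \<in> C \<longleftrightarrow> D x = 0"
  using pv by (auto simp: picard_vessiot_def constants_def)

lemma F_GL: "F \<in> GL UNIV m" using pv by (auto simp: picard_vessiot_def)

lemmas F_carrier = GL_D(2)[OF F_GL]

definition B :: "'a mat" where "B = (SOME B. B \<in> Mat K m \<and> map_mat D F = B * F)"

lemma B_Mat: "B \<in> Mat K m" and D_F: "map_mat D F = B * F"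
proof -
  have "\<exists>B. B \<in> Mat K m \<and> map_mat D F = B * F" using pv by (auto simp: picard_vessiot_def)
  from someI_ex[OF this] show "B \<in> Mat K m" "map_mat D F = B * F" by (auto simp: B_def)
qed

lemma fractions_all:
  assumes y: "\<And>i j. i < m \<Longrightarrow> j < m \<Longrightarrow> F $$ (i, j) \<in> fractions K N y"
  shows "u \<in> fractions K N y"
proof (rule fractions_UNIV[OF K_subfield])
  show "is_subfield hull (K \<union> elements_mat F) = UNIV" using pv by (simp add: picard_vessiot_def)
  show "elements_mat F \<subseteq> fractions K N y" using y F_carrier by (auto simp: elements_mat_def)
qed

lemma entry_fraction:
  assumes "i < m" "j < m"
  shows "A $$ (i, j) \<in> fractions K (m * m) (entries m A)"
proof -
  have "(\<lambda>x. x (i * m + j)) \<in> polyfun K (m * m)" using assms index_pair_less by (intro polyfun.var)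
  from fractions_incl[OF K_subfield this, of "entries m A"] show ?thesis
    using assms by (simp add: entries_def)
qed

lemma F_fractions: "u \<in> fractions K (m * m) (entries m F)"
  by (rule fractions_all) (rule entry_fraction)

text \<open>\<open>p'\<close> is the image of \<open>p\<close> under the derivation of
  \<open>K[Y]\<close> that extends \<open>D\<close> and has \<open>Y' = B Y\<close>. One
  \<open>p'\<close> serves all solutions \<open>Y\<close>, which is what allows \<open>F\<close> and
  \<open>F X\<close> to be compared.\<close>

lemma transport:
  assumes "p \<in> polyfun K (m * m)"
  shows "\<exists>p'\<in>polyfun K (m * m). \<forall>Y\<in>carrier_mat m m. map_mat D Y = B * Y \<longrightarrow>
    D (p (entries m Y)) = p' (entries m Y)"
  using assms
proof (induction rule: polyfun.induct)
  case (const c)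
  then show ?case using D_in_K by (intro bexI[of _ "\<lambda>x. D c"]) (auto intro: polyfun.const)
next
  case (var k)
  have "(\<lambda>x. entries m (B * of_entries m x) k) \<in> polyfun K (m * m)"
    by (rule polyfun_mult_left[OF K_subfield B_Mat polyfun.var[OF var] subset_refl])
  moreover have "D (entries m Y k) = entries m (B * of_entries m (entries m Y)) k"
    if "Y \<in> carrier_mat m m" "map_mat D Y = B * Y" for Y
  proof -
    have "D (entries m Y k) = map_mat D Y $$ (k div m, k mod m)"
      using that(1) index_less_square[OF var] by (simp add: entries_def)
    then show ?thesis unfolding of_entries_entries[OF that(1)] by (simp add: entries_def that(2))
  qed
  ultimately show ?case
    by (intro bexI[of _ "\<lambda>x. entries m (B * of_entries m x) k"] ballI impI)
next
  case (add f g)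
  then obtain f' g' where *: "f' \<in> polyfun K (m * m)" "g' \<in> polyfun K (m * m)"
    "\<forall>Y\<in>carrier_mat m m. map_mat D Y = B * Y \<longrightarrow> D (f (entries m Y)) = f' (entries m Y)"
    "\<forall>Y\<in>carrier_mat m m. map_mat D Y = B * Y \<longrightarrow> D (g (entries m Y)) = g' (entries m Y)" by blast
  show ?case using * by (intro bexI[of _ "\<lambda>x. f' x + g' x"]) (auto simp: derivation_simps[OF D] intro: polyfun.add)
next
  case (mult f g)
  then obtain f' g' where *: "f' \<in> polyfun K (m * m)" "g' \<in> polyfun K (m * m)"
    "\<forall>Y\<in>carrier_mat m m. map_mat D Y = B * Y \<longrightarrow> D (f (entries m Y)) = f' (entries m Y)"
    "\<forall>Y\<in>carrier_mat m m. map_mat D Y = B * Y \<longrightarrow> D (g (entries m Y)) = g' (entries m Y)" by blast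
  show ?case using * mult(1,2) by (intro bexI[of _ "\<lambda>x. f' x * g x + f x * g' x"])
    (auto simp: derivation_simps[OF D] intro!: polyfun.add polyfun.mult)
qed

lemma D_F_mult:
  assumes X: "X \<in> Mat C m"
  shows "map_mat D (F * X) = B * (F * X)"
proof -
  note Xc = MatD(1)[OF X]
  have "map_mat D X = 0\<^sub>m m m" using X mem_C_iff by (intro eq_matI) (auto simp: Mat_iff)
  then have "map_mat D (F * X) = B * F * X"
    using map_mat_derivation_mult[OF D F_carrier Xc] D_F F_carrier Xc MatD(1)[OF B_Mat] by simp
  then show ?thesis using assoc_mult_mat[OF MatD(1)[OF B_Mat] F_carrier Xc] by simp
qed

section \<open>The ideal of relations in the coordinates of a constant matrix\<close>

definition rels :: "((nat \<Rightarrow> 'a) \<Rightarrow> 'a) set" where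
  "rels = {p \<in> polyfun K (m * m). p (entries m F) = 0}"

definition pull :: "((nat \<Rightarrow> 'a) \<Rightarrow> 'a) \<Rightarrow> (nat \<Rightarrow> 'a) \<Rightarrow> 'a" where
  "pull p = (\<lambda>x. p (entries m (F * of_entries m x)))"

text \<open>Substituting \<open>Y = F X\<close> over \<open>L\<close> identifies the quotient of
  \<open>polyfun UNIV (m * m)\<close> by \<open>rel_span\<close> with the tensor product over
  \<open>K\<close> of \<open>L\<close> and \<open>K[F]\<close>.\<close>

definition rel_span :: "((nat \<Rightarrow> 'a) \<Rightarrow> 'a) set" where
  "rel_span = lspan (pull ` rels)"

lemma UNIV_subfield: "is_subfield (UNIV :: 'a set)" by (simp add: is_subfield_def)

lemma pull_polyfun: "p \<in> polyfun K (m * m) \<Longrightarrow> pull p \<in> polyfun UNIV (m * m)"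
  unfolding pull_def using GL_D(1)[OF F_GL] by (intro polyfun_mult_left[OF UNIV_subfield, where T = K]) auto

lemma rel_span_polyfun: "rel_span \<subseteq> polyfun UNIV (m * m)"
proof
  fix f assume "f \<in> rel_span"
  then show "f \<in> polyfun UNIV (m * m)" unfolding rel_span_def
  proof (induction rule: lspan.induct)
    case (step f g l)
    then have "g \<in> polyfun UNIV (m * m)" using pull_polyfun by (auto simp: rels_def)
    then show ?case using step by (intro polyfun.add polyfun.mult polyfun.const) auto
  qed (auto intro: polyfun.const)
qed

lemma polyfun_pull_lspan: "polyfun UNIV (m * m) \<subseteq> lspan (pull ` polyfun K (m * m))"
proof
  fix h :: "(nat \<Rightarrow> 'a) \<Rightarrow> 'a" assume h: "h \<in> polyfun UNIV (m * m)"
  let ?h = "\<lambda>x. h (entries m (minv F * of_entries m x))"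
  have "?h \<in> polyfun UNIV (m * m)"
    using GL_D(3)[OF F_GL] h by (intro polyfun_mult_left[OF UNIV_subfield]) auto
  then have "?h \<in> lspan (polyfun K (m * m))" using polyfun_subset_lspan[OF K_subfield] by blast
  moreover have "pull f \<in> lspan (pull ` V)" if "f \<in> lspan V" for f V
    using that
  proof (induction rule: lspan.induct)
    case zero
    then show ?case by (simp add: pull_def lspan.zero)
  next
    case (step f g l)
    then have "(\<lambda>x. pull f x + l * pull g x) \<in> lspan (pull ` V)" by (intro lspan.step) auto
    then show ?case by (simp add: pull_def)
  qed
  ultimately have "pull ?h \<in> lspan (pull ` polyfun K (m * m))" by blast
  moreover have "pull ?h x = h x" for x
  proof -
    have "pull ?h x = h (entries m (of_entries m x))"
      using F_carrier mult_minv_cancel(2)[OF F_GL of_entries_carrier]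
      by (simp add: pull_def of_entries_entries)
    also have "\<dots> = h x" by (rule polyfun_cong[OF h]) (rule entries_of_entries)
    finally show ?thesis .
  qed
  then have "pull ?h = h" by (rule ext)
  ultimately show "h \<in> lspan (pull ` polyfun K (m * m))" by simp
qed

text \<open>The functions over \<open>L\<close> are spanned by pullbacks of functions over
  \<open>K\<close>, and a multiple over \<open>K\<close> of a relation is a relation.\<close>

lemma rel_span_mult:
  assumes "h \<in> polyfun UNIV (m * m)" "f \<in> rel_span"
  shows "(\<lambda>x. h x * f x) \<in> rel_span"
  unfolding rel_span_def
proof (rule lspan_mult_closed)
  show "h \<in> lspan (pull ` polyfun K (m * m))" using assms(1) polyfun_pull_lspan by blast
  show "f \<in> lspan (pull ` rels)" using assms(2) by (simp add: rel_span_def)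
  fix f g assume "f \<in> pull ` polyfun K (m * m)" "g \<in> pull ` rels"
  then obtain p q where "f = pull p" "p \<in> polyfun K (m * m)" "g = pull q" "q \<in> rels" by blast
  then have "(\<lambda>x. p x * q x) \<in> rels" "(\<lambda>x. f x * g x) = pull (\<lambda>x. p x * q x)"
    by (auto simp: rels_def pull_def intro: polyfun.mult)
  then show "(\<lambda>x. f x * g x) \<in> lspan (pull ` rels)" by (auto intro: lspan_incl)
qed

text \<open>For a constant matrix \<open>X\<close> the product \<open>F X\<close> solves the same
  equation, so differentiating the value of a relation there gives the value of another relation,
  its \<open>transport\<close>. On the other side only the \<open>l k\<close> get differentiated,
  since the \<open>g k\<close> take constant values. Both expressions agree at all constant points,
  hence everywhere because \<open>C\<close> is infinite.\<close>

lemma rel_span_derivative: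
  assumes I: "finite (I :: nat set)" and g: "\<And>k. k \<in> I \<Longrightarrow> g k \<in> polyfun C (m * m)"
    and f: "(\<lambda>x. \<Sum>k\<in>I. l k * g k x) \<in> rel_span"
  shows "(\<lambda>x. \<Sum>k\<in>I. D (l k) * g k x) \<in> rel_span"
proof -
  let ?f = "\<lambda>x. \<Sum>k\<in>I. l k * g k x" and ?f' = "\<lambda>x. \<Sum>k\<in>I. D (l k) * g k x"
  obtain r c P where P: "\<And>j. j < r \<Longrightarrow> P j \<in> pull ` rels" "?f = (\<lambda>x. \<Sum>j<(r::nat). c j * P j x)"
    using f unfolding rel_span_def by (rule lspan_repr) blast
  define good where "good j pp \<longleftrightarrow> fst pp \<in> rels \<and> P j = pull (fst pp) \<and> snd pp \<in> rels \<and>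
    (\<forall>Y\<in>carrier_mat m m. map_mat D Y = B * Y \<longrightarrow> D (fst pp (entries m Y)) = snd pp (entries m Y))" for j pp
  have "\<exists>pp. good j pp" if j: "j < r" for j
  proof -
    obtain p where p: "p \<in> rels" "P j = pull p" using P(1)[OF j] by blast
    then obtain p' where p': "p' \<in> polyfun K (m * m)"
      "\<And>Y. Y \<in> carrier_mat m m \<Longrightarrow> map_mat D Y = B * Y \<Longrightarrow> D (p (entries m Y)) = p' (entries m Y)"
      using transport[of p] by (auto simp: rels_def)
    have "p' (entries m F) = 0"
      using p'(2)[OF F_carrier D_F] p derivation_simps(3)[OF D] by (simp add: rels_def)
    then have "good j (p, p')" using p p' by (simp add: good_def rels_def)
    then show ?thesis ..
  qed
  then have "\<forall>j. \<exists>pp. j < r \<longrightarrow> good j pp" by blast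
  from choice[OF this] obtain pp where pp: "\<And>j. j < r \<Longrightarrow> good j (pp j)" by blast
  define p p' where "p j = fst (pp j)" and "p' j = snd (pp j)" for j
  have p: "p j \<in> rels" "P j = pull (p j)" "p' j \<in> rels"
    "Y \<in> carrier_mat m m \<Longrightarrow> map_mat D Y = B * Y \<Longrightarrow> D (p j (entries m Y)) = p' j (entries m Y)"
    if "j < r" for j Y
    using pp[OF that] by (auto simp: good_def p_def p'_def)
  let ?h = "\<lambda>x. \<Sum>j<r. (D (c j) * pull (p j) x + c j * pull (p' j) x)"
  have h: "?h \<in> rel_span" unfolding rel_span_def
    using p by (intro lspan_sum lspan_add lspan_base) auto
  have "?f' \<in> polyfun UNIV (m * m)"
    using g by (intro polyfun_sum[OF UNIV_subfield] polyfun.mult polyfun.const) (auto intro: polyfun_mono)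
  then have diff: "(\<lambda>x. ?f' x - ?h x) \<in> polyfun UNIV (m * m)"
    using h rel_span_polyfun by (intro polyfun_diff[OF UNIV_subfield]) auto
  have eq: "?f' x - ?h x = 0" if x: "\<And>i. i < m * m \<Longrightarrow> x i \<in> C" for x
  proof -
    have X: "of_entries m x \<in> Mat C m" using x by (rule of_entries_Mat)
    have "D (g k x) = 0" if "k \<in> I" for k
      by (rule mem_C_iff[THEN iffD1, OF polyfun_value[OF C_subfield g[OF that] x]])
    then have "D (?f x) = ?f' x" by (simp add: derivation_simps[OF D])
    moreover have "D (pull (p j) x) = pull (p' j) x" if "j < r" for j
      unfolding pull_def using p(4)[OF that _ D_F_mult[OF X]] F_carrier MatD(1)[OF X] by simp
    then have "D (\<Sum>j<r. c j * pull (p j) x) = ?h x"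
      by (simp add: derivation_simps[OF D])
    moreover have "?f x = (\<Sum>j<r. c j * pull (p j) x)"
      using fun_cong[OF P(2), of x] p(2) by simp
    ultimately show ?thesis by simp
  qed
  have "?f' x - ?h x = 0" for x
    by (rule polyfun_eq_zero[OF diff infinite_algebraically_closed[OF C_closed] eq])
  then have "?f' = ?h" by (simp add: fun_eq_iff)
  then show ?thesis using h by simp
qed

text \<open>A point then needs testing only against the members with constant coefficients, the ones
  visible to the Nullstellensatz over \<open>C\<close>.\<close>

lemma rel_span_vanishes:
  assumes zero: "\<And>f. f \<in> rel_span \<Longrightarrow> f \<in> polyfun C (m * m) \<Longrightarrow> f x = 0" and f: "f \<in> rel_span"
  shows "f x = 0"
proof -
  have "f \<in> lspan (polyfun C (m * m))"
    using f rel_span_polyfun polyfun_subset_lspan[OF C_subfield] by blast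
  then obtain r l g where g: "\<And>k. k < r \<Longrightarrow> g k \<in> polyfun C (m * m)" "f = (\<lambda>x. \<Sum>k<(r::nat). l k * g k x)"
    by (rule lspan_repr) blast
  have "(\<Sum>k<r. l k * g k x) = 0"
  proof (rule descend_constants[where D = D and S = C and V = "polyfun C (m * m)" and M = rel_span and g = g and l = l and x = x])
    show "D 1 = 0" by (rule derivation_simps[OF D])
    show "fun_subspace C (polyfun C (m * m))" by (rule fun_subspace_polyfun[OF C_subfield])
    show "fun_subspace UNIV rel_span" unfolding rel_span_def by (rule fun_subspace_lspan)
    show "(\<lambda>x. \<Sum>k<r. l k * g k x) \<in> rel_span" using f g(2) by simp
  qed (use zero g mem_C_iff rel_span_derivative in auto)
  then show ?thesis using g(2) by simp
qed

text \<open>The specialisation from \<open>F\<close> to \<open>F X\<close> respects relations in one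
  direction by assumption and in the other by \<open>relation_reflects\<close>; both matrices
  generate \<open>L\<close> because \<open>minv X\<close> has entries in \<open>C\<close>. It
  commutes with \<open>D\<close> since both are solutions of the same equation.\<close>

lemma exists_automorphism:
  assumes X: "X \<in> GL C m" and rel: "\<forall>p\<in>rels. p (entries m (F * X)) = 0"
  obtains \<sigma> where "\<sigma> \<in> dGal D K" "map_mat \<sigma> F = F * X"
proof -
  note XD = GL_D[OF X]
  have XK: "X \<in> GL K m" using X GL_mono[OF C_subset_K] by blast
  have FX: "F * X \<in> carrier_mat m m" using F_carrier XD by simp
  have iff: "p (entries m F) = 0 \<longleftrightarrow> p (entries m (F * X)) = 0" if "p \<in> polyfun K (m * m)" for p
    using relation_reflects[OF K_subfield F_carrier XK _ that] rel that by (auto simp: rels_def)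
  have FXX: "F * X * minv X = F" by (rule mult_minv_cancel_right(1)[OF X F_carrier])
  let ?fr = "fractions K (m * m) (entries m (F * X))"
  note fr = is_subring_subfield[OF is_subfield_fractions[OF K_subfield]]
  have gen1: "u \<in> ?fr" for u
  proof (rule fractions_all)
    fix i j assume ij: "i < m" "j < m"
    have "F $$ (i, j) = (F * X * minv X) $$ (i, j)" by (simp add: FXX)
    also have "\<dots> = (\<Sum>s<m. (F * X) $$ (i, s) * minv X $$ (s, j))"
      by (rule index_mult_mat_sum[OF FX XD(4) ij])
    also have "\<dots> \<in> ?fr"
    proof (intro is_subring_sum[OF fr] is_subringD(4)[OF fr])
      fix s assume "s \<in> {..<m}"
      then have s: "s < m" by simp
      show "(F * X) $$ (i, s) \<in> ?fr" by (rule entry_fraction[OF ij(1) s])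
      have "minv X $$ (s, j) \<in> K" using MatD(2)[OF XD(3) s ij(2)] C_subset_K by blast
      from fractions_incl[OF K_subfield polyfun.const[OF this]] show "minv X $$ (s, j) \<in> ?fr" .
    qed
    finally show "F $$ (i, j) \<in> ?fr" .
  qed
  obtain \<sigma> where \<sigma>: "bij \<sigma>" "\<And>u v. \<sigma> (u + v) = \<sigma> u + \<sigma> v" "\<And>u v. \<sigma> (u * v) = \<sigma> u * \<sigma> v"
    "\<And>c. c \<in> K \<Longrightarrow> \<sigma> c = c" 
    "\<And>p. p \<in> polyfun K (m * m) \<Longrightarrow> \<sigma> (p (entries m F)) = p (entries m (F * X))"
    using exists_specialization_iso[OF K_subfield F_fractions gen1 iff] by blast
  have s1: "\<sigma> 1 = 1" using \<sigma>(4) is_subfieldD(2)[OF K_subfield] by auto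
  have inv: "\<sigma> (u / v) = \<sigma> u / \<sigma> v" if "v \<noteq> 0" for u v
  proof -
    have "\<sigma> v * \<sigma> (inverse v) = 1" using \<sigma>(3)[of v "inverse v"] that s1 by simp
    then have "\<sigma> v \<noteq> 0" by auto
    moreover have "\<sigma> (u / v) * \<sigma> v = \<sigma> u" using \<sigma>(3)[of "u / v" v] that by simp
    ultimately show ?thesis by (simp add: field_simps)
  qed
  have sdiff: "\<sigma> (u - v) = \<sigma> u - \<sigma> v" for u v using \<sigma>(2)[of "u - v" v] by simp
  have Dp: "\<sigma> (D (p (entries m F))) = D (\<sigma> (p (entries m F)))" if p: "p \<in> polyfun K (m * m)" for p
  proof -
    obtain p' where p': "p' \<in> polyfun K (m * m)"
        "\<And>Y. Y \<in> carrier_mat m m \<Longrightarrow> map_mat D Y = B * Y \<Longrightarrow> D (p (entries m Y)) = p' (entries m Y)"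
        using transport[OF p] by auto
    have "D (p (entries m (F * X))) = p' (entries m (F * X))" by (rule p'(2)[OF FX D_F_mult[OF XD(1)]])
    then show ?thesis using p'(2)[OF F_carrier D_F] \<sigma>(5)[OF p] \<sigma>(5)[OF p'(1)] by simp
  qed
  have "\<sigma> (D u) = D (\<sigma> u)" for u
  proof -
    obtain p q where pq: "p \<in> polyfun K (m * m)" "q \<in> polyfun K (m * m)" "q (entries m F) \<noteq> 0"
      "u = p (entries m F) / q (entries m F)" using F_fractions[of u] by (rule fractionsE)
    let ?p = "p (entries m F)" and ?q = "q (entries m F)"
    have q1: "\<sigma> ?q \<noteq> 0" using \<sigma>(5)[OF pq(2)] iff[OF pq(2)] pq(3) by simp
    have "\<sigma> (D u) = \<sigma> ((D ?p * ?q - ?p * D ?q) / (?q * ?q))"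
      unfolding pq(4) derivation_divide[OF D pq(3)] ..
    also have "\<dots> = (D (\<sigma> ?p) * \<sigma> ?q - \<sigma> ?p * D (\<sigma> ?q)) / (\<sigma> ?q * \<sigma> ?q)"
      using pq(3) by (simp add: inv sdiff \<sigma>(3) Dp[OF pq(1)] Dp[OF pq(2)])
    also have "\<dots> = D (\<sigma> ?p / \<sigma> ?q)" by (rule derivation_divide[OF D q1, symmetric])
    also have "\<dots> = D (\<sigma> u)" unfolding pq(4) inv[OF pq(3)] ..
    finally show ?thesis .
  qed
  then have "\<sigma> \<in> dGal D K" using \<sigma>(1-4) by (auto simp: dGal_def)
  moreover have "map_mat \<sigma> F = F * X"
  proof (rule eq_matI)
    fix i j assume "i < dim_row (F * X)" "j < dim_col (F * X)"
    then have ij: "i < m" "j < m" using FX by auto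
    have "(\<lambda>x. x (i * m + j)) \<in> polyfun K (m * m)" using ij index_pair_less by (intro polyfun.var)
    from \<sigma>(5)[OF this] show "map_mat \<sigma> F $$ (i, j) = (F * X) $$ (i, j)"
      using ij F_carrier FX by (simp add: entries_def)
  qed (use F_carrier FX in auto)
  ultimately show ?thesis by (rule that)
qed

end

section \<open>The fixed field of the Galois group\<close>

lemma homogenized_linear_power:
  fixes p q a :: "'a::comm_ring_1"
  shows "(p - a * q) ^ k = (\<Sum>i\<le>k. coeff ([:- a, 1:] ^ k) i * (p ^ i * q ^ (k - i)))"
proof -
  have "(p + - (a * q)) ^ k = (\<Sum>i\<le>k. of_nat (k choose i) * p ^ i * (- (a * q)) ^ (k - i))"
    by (rule binomial_ring)
  also have "\<dots> = (\<Sum>i\<le>k. coeff ([:- a, 1:] ^ k) i * (p ^ i * q ^ (k - i)))"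
  proof (rule sum.cong[OF refl])
    fix i assume "i \<in> {..k}"
    then have "coeff ([:- a, 1:] ^ k) i = of_nat (k choose i) * (- a) ^ (k - i)"
      by (subst coeff_linear_poly_power) auto
    moreover have "(- (a * q)) ^ (k - i) = (- a) ^ (k - i) * q ^ (k - i)"
      by (metis mult_minus_left power_mult_distrib)
    ultimately show "of_nat (k choose i) * p ^ i * (- (a * q)) ^ (k - i)
      = coeff ([:- a, 1:] ^ k) i * (p ^ i * q ^ (k - i))" by (simp add: mult_ac)
  qed
  finally show ?thesis by simp
qed

context picard_vessiot_extension
begin

lemma dGalD:
  assumes "\<sigma> \<in> dGal D K"
  shows "bij \<sigma>" "\<sigma> (x + y) = \<sigma> x + \<sigma> y" "\<sigma> (x * y) = \<sigma> x * \<sigma> y" "c \<in> K \<Longrightarrow> \<sigma> c = c" "\<sigma> (D x) = D (\<sigma> x)"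
    "\<sigma> 0 = 0" "\<sigma> 1 = 1" "comm_ring_hom \<sigma>" "\<sigma> (x - y) = \<sigma> x - \<sigma> y" "\<sigma> (x / y) = \<sigma> x / \<sigma> y" "\<sigma> x = 0 \<longleftrightarrow> x = 0"
    "\<sigma> (sum f I) = (\<Sum>i\<in>I. \<sigma> (f i))"
proof -
  have *: "bij \<sigma>" "\<And>x y. \<sigma> (x + y) = \<sigma> x + \<sigma> y" "\<And>x y. \<sigma> (x * y) = \<sigma> x * \<sigma> y" "\<And>c. c \<in> K \<Longrightarrow> \<sigma> c = c"
    "\<And>x. \<sigma> (D x) = D (\<sigma> x)" using assms by (simp_all add: dGal_def)
  show "bij \<sigma>" by (rule *(1))
  show "\<sigma> (x + y) = \<sigma> x + \<sigma> y" by (rule *(2))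
  show "\<sigma> (x * y) = \<sigma> x * \<sigma> y" by (rule *(3))
  show "c \<in> K \<Longrightarrow> \<sigma> c = c" by (rule *(4))
  show "\<sigma> (D x) = D (\<sigma> x)" by (rule *(5))
  have 0: "\<sigma> 0 = 0" and 1: "\<sigma> 1 = 1" using *(4) is_subfieldD(1,2)[OF K_subfield] by blast+
  show "\<sigma> 0 = 0" by (rule 0)
  show "\<sigma> 1 = 1" by (rule 1)
  show "comm_ring_hom \<sigma>" by standard (auto simp: * 0 1)
  have nz: "\<sigma> x = 0 \<longleftrightarrow> x = 0" for x
    using bij_is_inj[OF *(1)] 0 by (metis injD)
  then show "\<sigma> x = 0 \<longleftrightarrow> x = 0" .
  show "\<sigma> (x - y) = \<sigma> x - \<sigma> y" using *(2)[of "x - y" y] by simp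
  show "\<sigma> (x / y) = \<sigma> x / \<sigma> y"
  proof (cases "y = 0")
    case False
    then have "\<sigma> (x / y) * \<sigma> y = \<sigma> x" using *(3)[of "x / y" y] by simp
    then show ?thesis using nz False by (simp add: field_simps)
  qed (simp add: 0)
  show "\<sigma> (sum f I) = (\<Sum>i\<in>I. \<sigma> (f i))"
    by (induction I rule: infinite_finite_induct) (auto simp: 0 *(2))
qed

lemma dGal_polyfun:
  assumes "\<sigma> \<in> dGal D K" and "p \<in> polyfun K N"
  shows "\<sigma> (p x) = p (\<lambda>i. \<sigma> (x i))"
  using assms(2) by (induction rule: polyfun.induct) (auto simp: dGalD[OF assms(1)])

lemma dGal_polyfun_entries:
  assumes "\<sigma> \<in> dGal D K" and "p \<in> polyfun K (m * m)" and A: "A \<in> carrier_mat m m"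
  shows "\<sigma> (p (entries m A)) = p (entries m (map_mat \<sigma> A))"
  unfolding dGal_polyfun[OF assms(1,2)]
  by (rule polyfun_cong[OF assms(2)]) (use A index_less_square in \<open>auto simp: entries_def\<close>)

lemma rel_span_ideal: "ideal_in rel_span (polyfun UNIV (m * m))"
  unfolding ideal_in_def
proof (intro conjI ballI)
  show "rel_span \<subseteq> polyfun UNIV (m * m)" by (rule rel_span_polyfun)
  show "0 \<in> rel_span" using lspan.zero by (auto simp: rel_span_def zero_fun_def)
  show "f + g \<in> rel_span" if "f \<in> rel_span" "g \<in> rel_span" for f g using lspan_add that by (auto simp: rel_span_def plus_fun_def)
  show "f * g \<in> rel_span" if "f \<in> polyfun UNIV (m * m)" "g \<in> rel_span" for f g
    using rel_span_mult[OF that] by (simp add: times_fun_def)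
qed

text \<open>If no power lay in \<open>rel_span\<close>, some prime ideal above it would avoid the
  function, and the Nullstellensatz would give a constant point where all relations hold while a
  component of \<open>pull p - a * pull q\<close> and the determinant are nonzero. Such a point
  yields an automorphism; as it fixes \<open>a\<close>, the difference must vanish there. The factor
  \<open>det\<close> ensures that the point is an invertible matrix.\<close>

lemma fixed_power_in_rel_span:
  assumes fixed: "\<forall>\<sigma>\<in>dGal D K. \<sigma> a = a"
    and pq: "p \<in> polyfun K (m * m)" "q \<in> polyfun K (m * m)" "q (entries m F) \<noteq> 0"
      "a = p (entries m F) / q (entries m F)"
  shows "\<exists>k. (\<lambda>x. ((pull p x - a * pull q x) * det (of_entries m x)) ^ k) \<in> rel_span"
proof (rule ccontr)
  let ?N = "m * m"
  let ?h = "\<lambda>x. pull p x - a * pull q x" and ?d = "\<lambda>x. det (of_entries m x)"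
  let ?hd = "\<lambda>x. ?h x * ?d x"
  assume "\<not> ?thesis"
  moreover have "f ^ k = (\<lambda>x. f x ^ k)" for f :: "(nat \<Rightarrow> 'a) \<Rightarrow> 'a" and k
    by (induction k) (auto simp: fun_eq_iff)
  ultimately have notM: "?hd ^ k \<notin> rel_span" for k by simp
  have h: "?h \<in> polyfun UNIV ?N"
    using pq by (intro polyfun_diff[OF UNIV_subfield] polyfun.mult polyfun.const pull_polyfun) auto
  have dC: "?d \<in> polyfun C ?N" by (rule polyfun_det_of_entries[OF C_subfield])
  have CU: "polyfun C ?N \<subseteq> polyfun UNIV ?N" by (auto intro: polyfun_mono)
  have "?hd \<in> polyfun UNIV ?N" using h dC CU by (intro polyfun.mult) auto
  from prime_in_exists[OF is_subring_polyfun[OF UNIV_subfield] rel_span_ideal this notM]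
  obtain Q' where Q': "prime_in Q' (polyfun UNIV ?N)" "rel_span \<subseteq> Q'" "?hd \<notin> Q'" by blast
  let ?Q = "Q' \<inter> polyfun C ?N"
  have Q: "prime_in ?Q (polyfun C ?N)" by (rule prime_in_restrict[OF is_subring_polyfun[OF C_subfield] CU Q'(1)])
  have hl: "?h \<in> lspan (polyfun C ?N)" using h polyfun_subset_lspan[OF C_subfield] by blast
  \<comment> \<open>The function has coefficients in \<open>L\<close>; it is split along a
    \<open>C\<close>-independent family so that some component with coefficients in \<open>C\<close>
    avoids the prime.\<close>
  obtain r e where e: "indep C r e"
    "\<exists>g. (\<forall>k<r. g k \<in> polyfun C ?N) \<and> ?h = (\<lambda>x. \<Sum>k<r. e k * g k x)"
    by (rule lspan_common_basis[OF C_subfield fun_subspace_polyfun[OF C_subfield, of ?N], of "{?h}"]) (use hl in auto)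
  then obtain g where g: "\<And>k. k < r \<Longrightarrow> g k \<in> polyfun C ?N" "?h = (\<lambda>x. \<Sum>k<r. e k * g k x)" by blast
  note Q'i = ideal_inD[OF prime_inD(1)[OF Q'(1)]]
  have "\<exists>k<r. (\<lambda>x. g k x * ?d x) \<notin> Q'"
  proof (rule ccontr)
    assume "\<not> ?thesis"
    then have in_Q: "(\<lambda>x. g k x * ?d x) \<in> Q'" if "k < r" for k using that by blast
    have eQ: "(\<lambda>x. e k) * (\<lambda>x. g k x * ?d x) \<in> Q'" if "k < r" for k
      by (rule Q'i(4)[OF polyfun.const[OF UNIV_I] in_Q[OF that]])
    have "(\<lambda>x. \<Sum>k<s. e k * (g k x * ?d x)) \<in> Q'" if "s \<le> r" for s
      using that
    proof (induction s)
      case 0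
      then show ?case using Q'i(2) by (simp add: zero_fun_def)
    next
      case (Suc s)
      have "(\<lambda>x. \<Sum>k<s. e k * (g k x * ?d x)) \<in> Q'" using Suc by simp
      from Q'i(3)[OF this eQ] have "(\<lambda>x. \<Sum>k<s. e k * (g k x * ?d x)) + (\<lambda>x. e s) * (\<lambda>x. g s x * ?d x) \<in> Q'"
        using Suc.prems by simp
      then show ?case by (simp add: plus_fun_def times_fun_def)
    qed
    from this[OF order_refl] have "(\<lambda>x. (\<Sum>k<r. e k * g k x) * ?d x) \<in> Q'"
      by (simp add: sum_distrib_right mult.assoc)
    moreover have "?hd = (\<lambda>x. (\<Sum>k<r. e k * g k x) * ?d x)" using fun_cong[OF g(2)] by (intro ext) simp
    ultimately show False using Q'(3) by simp
  qed
  then obtain k where k: "k < r" "(\<lambda>x. g k x * ?d x) \<notin> ?Q" by blast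
  have "(\<lambda>x. g k x * ?d x) \<in> polyfun C ?N" using g(1)[OF k(1)] dC by (rule polyfun.mult)
  from polyfun_point_of_prime[OF C_closed Q this k(2)] obtain x where
    x: "\<And>i. x i \<in> C" "\<And>f. f \<in> ?Q \<Longrightarrow> f x = 0" "g k x * ?d x \<noteq> 0" by blast
  let ?X = "of_entries m x"
  have X: "?X \<in> GL C m" unfolding GL_iff_det[OF C_subfield] using x(1,3) by (auto intro: of_entries_Mat)
  \<comment> \<open>By choice the point kills the members of \<open>rel_span\<close> with constant
    coefficients; \<open>rel_span_vanishes\<close> extends this to all members.\<close>
  have M0: "f x = 0" if "f \<in> rel_span" for f
    by (rule rel_span_vanishes[OF _ that]) (use x(2) Q'(2) in auto)
  have "\<forall>s\<in>rels. s (entries m (F * ?X)) = 0"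
  proof
    fix s assume "s \<in> rels"
    then have "pull s \<in> rel_span" by (auto simp: rel_span_def intro: lspan_incl)
    from M0[OF this] show "s (entries m (F * ?X)) = 0" by (simp add: pull_def)
  qed
  from exists_automorphism[OF X this] obtain \<sigma> where \<sigma>: "\<sigma> \<in> dGal D K" "map_mat \<sigma> F = F * ?X" by blast
  have "\<sigma> (p (entries m F)) = a * \<sigma> (q (entries m F))"
    using bspec[OF fixed \<sigma>(1)] dGalD(3)[OF \<sigma>(1), of a "q (entries m F)"] pq(3,4) by simp
  then have "?h x = 0"
    using \<sigma>(2) dGal_polyfun_entries[OF \<sigma>(1) pq(1) F_carrier] dGal_polyfun_entries[OF \<sigma>(1) pq(2) F_carrier]
    by (simp add: pull_def)
  \<comment> \<open>The values \<open>g k x\<close> are constants, so independence of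
    \<open>e\<close> over \<open>C\<close> makes each of them zero.\<close>
  then have "(\<Sum>k<r. g k x * e k) = 0" using fun_cong[OF g(2), of x] by (simp add: mult.commute)
  moreover have "\<forall>k<r. g k x \<in> C" using polyfun_value[OF C_subfield g(1)] x(1) by blast
  ultimately have "g k x = 0" by (intro indepD[OF e(1) _ _ k(1), of "\<lambda>k. g k x"])
  then show False using x(3) by simp
qed

text \<open>Membership in \<open>rel_span\<close> is rewritten in the coordinates
  \<open>Y = F X\<close>, where the relations, \<open>p\<close> and \<open>q\<close> have
  coefficients in \<open>K\<close>. A \<open>K\<close>-linear form on \<open>L\<close> can then be
  applied to the remaining scalars, and evaluation at \<open>F\<close> kills the relations. What is
  left is the hypothesis of \<open>nilpotent_tensor_in_subfield\<close>.\<close>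

lemma fixed_field:
  assumes fixed: "\<forall>\<sigma>\<in>dGal D K. \<sigma> a = a"
  shows "a \<in> K"
proof -
  let ?N = "m * m"
  obtain p q where pq: "p \<in> polyfun K ?N" "q \<in> polyfun K ?N" "q (entries m F) \<noteq> 0"
    "a = p (entries m F) / q (entries m F)" using F_fractions[of a] by (rule fractionsE)
  obtain k where k: "(\<lambda>x. ((pull p x - a * pull q x) * det (of_entries m x)) ^ k) \<in> rel_span"
    using fixed_power_in_rel_span[OF fixed pq] by blast
  then obtain r l P where P: "\<And>j. j < r \<Longrightarrow> P j \<in> pull ` rels"
    "(\<lambda>x. ((pull p x - a * pull q x) * det (of_entries m x)) ^ k) = (\<lambda>x. \<Sum>j<(r::nat). l j * P j x)"
    unfolding rel_span_def by (rule lspan_repr) blast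
  have "\<forall>j. \<exists>s. j < r \<longrightarrow> s \<in> rels \<and> P j = pull s" using P(1) by blast
  from choice[OF this] obtain s where s: "\<And>j. j < r \<Longrightarrow> s j \<in> rels" "\<And>j. j < r \<Longrightarrow> P j = pull (s j)" by blast
  \<comment> \<open>The change of coordinates multiplies the determinant by this fixed nonzero
    element of \<open>L\<close>.\<close>
  define \<delta> where "\<delta> = det (minv F)"
  have \<delta>: "\<delta> \<noteq> 0" using GL_iff_det[OF UNIV_subfield] GL_D(7)[OF F_GL] by (auto simp: \<delta>_def)
  let ?\<alpha> = "coeff ([:- a, 1:] ^ k)"
  let ?d = "\<lambda>x. det (of_entries m x)"
  have eq: "(\<Sum>i\<le>k. ?\<alpha> i * (p y ^ i * q y ^ (k - i) * ?d y ^ k)) = (\<Sum>j<r. (inverse \<delta> ^ k * l j) * s j y)" for y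
  proof -
    let ?x = "entries m (minv F * of_entries m y)"
    have c: "minv F * of_entries m y \<in> carrier_mat m m" using GL_D[OF F_GL] by simp
    have FY: "F * of_entries m ?x = of_entries m y"
      unfolding of_entries_entries[OF c] by (rule mult_minv_cancel(1)[OF F_GL of_entries_carrier])
    have y: "f (entries m (of_entries m y)) = f y" if "f \<in> polyfun K ?N" for f
      by (rule polyfun_cong[OF that]) (rule entries_of_entries)
    have pl: "pull f ?x = f y" if "f \<in> polyfun K ?N" for f unfolding pull_def FY by (rule y[OF that])
    have dx: "?d ?x = \<delta> * ?d y"
      unfolding of_entries_entries[OF c] \<delta>_def by (rule det_mult) (use GL_D[OF F_GL] in auto)
    have "((p y - a * q y) * (\<delta> * ?d y)) ^ k = (\<Sum>j<r. l j * P j ?x)"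
      using fun_cong[OF P(2), of ?x] by (simp only: pl pq dx)
    also have "\<dots> = (\<Sum>j<r. l j * s j y)"
      using s pl by (intro sum.cong) (auto simp: rels_def)
    finally have "inverse \<delta> ^ k * ((p y - a * q y) * (\<delta> * ?d y)) ^ k = (\<Sum>j<r. (inverse \<delta> ^ k * l j) * s j y)"
      by (simp add: sum_distrib_left mult.assoc)
    moreover have "inverse \<delta> ^ k * ((p y - a * q y) * (\<delta> * ?d y)) ^ k = (p y - a * q y) ^ k * ?d y ^ k"
    proof -
      have "inverse \<delta> * ((p y - a * q y) * (\<delta> * ?d y)) = (p y - a * q y) * ?d y" using \<delta> by simp
      then show ?thesis by (simp only: power_mult_distrib[symmetric])
    qed
    ultimately show ?thesis
      unfolding homogenized_linear_power by (simp add: sum_distrib_right mult.assoc)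
  qed
  have dF: "?d (entries m F) \<noteq> 0"
    using GL_iff_det[OF UNIV_subfield] F_GL by (simp add: of_entries_entries[OF F_carrier])
  show ?thesis
  proof (rule nilpotent_tensor_in_subfield[OF K_subfield C_closed C_subset_K])
    fix j :: nat assume "0 < j" "of_nat j = (0::'a)"
    \<comment> \<open>The derivative of \<open>a ^ j\<close> carries the factor \<open>j\<close>,
      which is zero in the field.\<close>
    then show "a ^ j \<in> C" unfolding mem_C_iff by (simp add: derivation_simps[OF D])
  next
    fix u assume u: "linear_form K u"
    note uD = linear_formD[OF u]
    let ?L = "\<lambda>y. \<Sum>i\<le>k. u (?\<alpha> i) * (p y ^ i * q y ^ (k - i) * ?d y ^ k)"
    let ?R = "\<lambda>y. \<Sum>j<r. u (inverse \<delta> ^ k * l j) * s j y"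
    note S = is_subring_polyfun[OF K_subfield, of ?N]
    have pow: "(\<lambda>y. f y ^ i) \<in> polyfun K ?N" if "f \<in> polyfun K ?N" for f i
      using that is_subfieldD(2)[OF K_subfield] by (induction i) (auto intro: polyfun.mult polyfun.const)
    have t: "(\<lambda>y. p y ^ i * q y ^ (k - i) * ?d y ^ k) \<in> polyfun K ?N" for i
      using pq polyfun_det_of_entries[OF K_subfield] by (intro polyfun.mult pow)
    have sK: "s j \<in> polyfun K ?N" if "j < r" for j using s(1)[OF that] by (simp add: rels_def)
    have "?L \<in> polyfun K ?N" "?R \<in> polyfun K ?N"
      using uD(1) t sK by (auto intro!: polyfun_sum[OF K_subfield] polyfun.mult[OF polyfun.const])
    then have "(\<lambda>y. ?L y - ?R y) \<in> polyfun K ?N" by (intro polyfun_diff[OF K_subfield])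
    then have diff: "(\<lambda>y. ?L y - ?R y) \<in> polyfun UNIV ?N" by (auto intro: polyfun_mono)
    \<comment> \<open>Only factors from \<open>K\<close> can be moved past \<open>u\<close>, so the
      identity is obtained first at points over \<open>K\<close>; since \<open>K\<close> is infinite
      it holds everywhere, in particular at \<open>F\<close>.\<close>
    have "?L y - ?R y = 0" if y: "\<And>i. i < ?N \<Longrightarrow> y i \<in> K" for y
    proof -
      have "u (?\<alpha> i * (p y ^ i * q y ^ (k - i) * ?d y ^ k)) = u (?\<alpha> i) * (p y ^ i * q y ^ (k - i) * ?d y ^ k)" for i
        by (rule uD(4)) (rule polyfun_value[OF K_subfield t y])
      moreover have "u (inverse \<delta> ^ k * l j * s j y) = u (inverse \<delta> ^ k * l j) * s j y" if "j < r" for j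
        by (rule uD(4)) (rule polyfun_value[OF K_subfield sK[OF that] y])
      ultimately show ?thesis using arg_cong[OF eq[of y], of u] by (simp add: uD(6))
    qed
    moreover have "infinite K" using infinite_algebraically_closed[OF C_closed] C_subset_K finite_subset by blast
    ultimately have LR: "?L y - ?R y = 0" for y using polyfun_eq_zero[OF diff] by blast
    let ?y = "entries m F"
    have "?R ?y = 0" using s(1) by (simp add: rels_def)
    then have "?L ?y = 0" using LR[of ?y] by simp
    \<comment> \<open>At \<open>F\<close> each product becomes \<open>a ^ i\<close> times a common
      nonzero factor. Cancelling it leaves the image of the power of \<open>t - a\<close> under
      \<open>u\<close>, evaluated at \<open>a\<close>.\<close>
    moreover have "p ?y = a * q ?y" using pq(3,4) by simp
    then have pe: "p ?y ^ i * q ?y ^ (k - i) * ?d ?y ^ k = a ^ i * (q ?y ^ k * ?d ?y ^ k)" if "i \<le> k" for i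
      using that by (simp add: power_mult_distrib power_add[symmetric] mult.assoc[symmetric])
    have "?L ?y = (\<Sum>i\<le>k. u (?\<alpha> i) * (a ^ i * (q ?y ^ k * ?d ?y ^ k)))"
      by (rule sum.cong[OF refl]) (simp only: pe atMost_iff)
    then have "?L ?y = (\<Sum>i\<le>k. u (?\<alpha> i) * a ^ i) * (q ?y ^ k * ?d ?y ^ k)"
      by (simp add: sum_distrib_right mult.assoc)
    ultimately have "(\<Sum>i\<le>k. u (?\<alpha> i) * a ^ i) = 0" using pq(3) dF by simp
    moreover have "poly (map_poly u ([:- a, 1:] ^ k)) a = (\<Sum>i\<le>k. u (?\<alpha> i) * a ^ i)"
    proof -
      have "degree (map_poly u ([:- a, 1:] ^ k)) \<le> k"
        using degree_map_poly_le[of u "[:- a, 1:] ^ k"] by (simp add: degree_linear_power)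
      then have "(\<Sum>i\<le>degree (map_poly u ([:- a, 1:] ^ k)). u (?\<alpha> i) * a ^ i) = (\<Sum>i\<le>k. u (?\<alpha> i) * a ^ i)"
        using coeff_eq_0[of "map_poly u ([:- a, 1:] ^ k)"]
        by (intro sum.mono_neutral_left) (auto simp: coeff_map_poly uD(5))
      then show ?thesis by (simp add: poly_altdef coeff_map_poly uD(5))
    qed
    ultimately show "poly (map_poly u ([:- a, 1:] ^ k)) a = 0" by simp
  qed
qed

end


section \<open>The Galois cocycle\<close>

context picard_vessiot_extension
begin

abbreviation G :: "('a \<Rightarrow> 'a) set" where "G \<equiv> dGal D K"

lemma dGal_id: "id \<in> G"
  by (simp add: dGal_def)

lemma dGal_comp: "\<sigma> \<in> G \<Longrightarrow> \<tau> \<in> G \<Longrightarrow> \<sigma> \<circ> \<tau> \<in> G"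
  unfolding dGal_def by (auto intro: bij_comp)

lemma dGal_inv:
  assumes "\<sigma> \<in> G"
  shows "inv_into UNIV \<sigma> \<in> G" "\<sigma> (inv_into UNIV \<sigma> x) = x" "inv_into UNIV \<sigma> (\<sigma> x) = x" "\<sigma> \<circ> inv_into UNIV \<sigma> = id"
proof -
  note \<sigma> = dGalD[OF assms]
  have r: "\<sigma> (inv_into UNIV \<sigma> x) = x" and l: "inv_into UNIV \<sigma> (\<sigma> x) = x" for x
    using \<sigma>(1) by (simp_all add: bij_is_surj bij_is_inj surj_f_inv_f inv_f_f)
  then show "\<sigma> (inv_into UNIV \<sigma> x) = x" "inv_into UNIV \<sigma> (\<sigma> x) = x" "\<sigma> \<circ> inv_into UNIV \<sigma> = id" by (auto simp: fun_eq_iff)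
  have eqI: "inv_into UNIV \<sigma> y = x" if "y = \<sigma> x" for x y using that l by simp
  have "bij (inv_into UNIV \<sigma>)" using \<sigma>(1) by (rule bij_imp_bij_inv)
  moreover have "inv_into UNIV \<sigma> (x + y) = inv_into UNIV \<sigma> x + inv_into UNIV \<sigma> y" for x y by (rule eqI) (simp add: \<sigma>(2) r)
  moreover have "inv_into UNIV \<sigma> (x * y) = inv_into UNIV \<sigma> x * inv_into UNIV \<sigma> y" for x y by (rule eqI) (simp add: \<sigma>(3) r)
  moreover have "inv_into UNIV \<sigma> x = x" if "x \<in> K" for x by (rule eqI) (simp add: \<sigma>(4) that)
  moreover have "inv_into UNIV \<sigma> (D x) = D (inv_into UNIV \<sigma> x)" for x by (rule eqI) (simp add: \<sigma>(5) r)
  ultimately show "inv_into UNIV \<sigma> \<in> G" by (simp add: dGal_def)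
qed

lemma map_dGal_mult:
  assumes "\<sigma> \<in> G" "A \<in> carrier_mat n k" "A' \<in> carrier_mat k l"
  shows "map_mat \<sigma> (A * A') = map_mat \<sigma> A * map_mat \<sigma> A'"
proof -
  interpret comm_ring_hom \<sigma> by (rule dGalD(8)[OF assms(1)])
  show ?thesis by (rule mat_hom_mult[OF assms(2,3)])
qed

lemma map_dGal_det:
  assumes "\<sigma> \<in> G"
  shows "det (map_mat \<sigma> A) = \<sigma> (det A)"
proof -
  interpret comm_ring_hom \<sigma> by (rule dGalD(8)[OF assms(1)])
  show ?thesis by (rule hom_det)
qed

lemma map_dGal_Mat: "\<sigma> \<in> G \<Longrightarrow> T \<in> Mat K n \<Longrightarrow> map_mat \<sigma> T = T"
  by (intro eq_matI) (auto simp: Mat_iff dGalD(4))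

lemma map_dGal_GL:
  assumes "\<sigma> \<in> G" "U \<in> GL UNIV n"
  shows "map_mat \<sigma> U \<in> GL UNIV n" "minv (map_mat \<sigma> U) = map_mat \<sigma> (minv U)"
proof -
  interpret comm_ring_hom \<sigma> by (rule dGalD(8)[OF assms(1)])
  note U = GL_D[OF assms(2)]
  have 1: "map_mat \<sigma> U * map_mat \<sigma> (minv U) = 1\<^sub>m n" "map_mat \<sigma> (minv U) * map_mat \<sigma> U = 1\<^sub>m n"
    unfolding mat_hom_mult[OF U(2,4), symmetric] mat_hom_mult[OF U(4,2), symmetric] U(5,6) by (rule mat_hom_one)+
  show "minv (map_mat \<sigma> U) = map_mat \<sigma> (minv U)" using 1 U by (intro minv_unique[of _ n]) auto
  show "map_mat \<sigma> U \<in> GL UNIV n" unfolding GL_def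
    using 1 U by (intro CollectI conjI bexI[of _ "map_mat \<sigma> (minv U)"]) (auto simp: Mat_iff)
qed

lemma GL_K_UNIV: "GL K n \<subseteq> GL UNIV n" and GL_C_UNIV: "GL C n \<subseteq> GL UNIV n"
  by (rule GL_mono, simp)+

lemma Mat_C_K: "Mat C n \<subseteq> Mat K n"
  by (rule Mat_mono[OF C_subset_K])

lemma map_D_C: "T \<in> Mat C n \<Longrightarrow> map_mat D T = 0\<^sub>m n n"
  using mem_C_iff by (intro eq_matI) (auto simp: Mat_iff)

text \<open>Both matrices solve the same equation \<open>Y' = A Y\<close>; differentiating
  \<open>V = U T\<close> leaves \<open>U T' = 0\<close>.\<close>

lemma constant_quotient:
  assumes U: "U \<in> GL UNIV n" and V: "V \<in> GL UNIV n"
    and eq: "map_mat D U * minv U = map_mat D V * minv V"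
  shows "minv U * V \<in> GL C n"
proof -
  note UD = GL_D[OF U] and VD = GL_D[OF V]
  let ?T = "minv U * V" and ?A = "map_mat D U * minv U"
  have R: "is_subring (UNIV :: 'a set)" by (rule is_subring_subfield[OF UNIV_subfield])
  have DU: "map_mat D U \<in> carrier_mat n n" and DV: "map_mat D V \<in> carrier_mat n n" using UD VD by auto
  have Ac: "?A \<in> carrier_mat n n" using DU UD by simp
  have Tc: "?T \<in> carrier_mat n n" and DTc: "map_mat D ?T \<in> carrier_mat n n" using UD VD by auto
  have TU: "?T \<in> GL UNIV n" using GL_mult(1)[OF R UD(7) V] .
  have VT: "U * ?T = V" by (rule mult_minv_cancel(1)[OF U VD(2)])
  have AU: "?A * U = map_mat D U" by (rule mult_minv_cancel_right(2)[OF U DU])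
  have AV: "?A * V = map_mat D V" unfolding eq by (rule mult_minv_cancel_right(2)[OF V DV])
  have "?A * V = map_mat D (U * ?T)" by (simp only: VT AV)
  also have "\<dots> = map_mat D U * ?T + U * map_mat D ?T" by (rule map_mat_derivation_mult[OF D UD(2) Tc])
  also have "map_mat D U * ?T = ?A * V" using assoc_mult_mat[OF Ac UD(2) Tc] by (simp only: AU VT)
  finally have *: "?A * V = ?A * V + U * map_mat D ?T" .
  have AVc: "?A * V \<in> carrier_mat n n" and UTc: "U * map_mat D ?T \<in> carrier_mat n n" using Ac VD UD DTc by auto
  have "U * map_mat D ?T = 0\<^sub>m n n"
  proof (rule eq_matI)
    fix i j assume "i < dim_row (0\<^sub>m n n :: 'a mat)" "j < dim_col (0\<^sub>m n n :: 'a mat)"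
    then have ij: "i < n" "j < n" by auto
    have "(?A * V) $$ (i, j) = (?A * V + U * map_mat D ?T) $$ (i, j)"
      by (rule arg_cong[OF *, of "\<lambda>A. A $$ (i, j)"])
    also have "\<dots> = (?A * V) $$ (i, j) + (U * map_mat D ?T) $$ (i, j)"
      by (rule index_add_mat) (use UTc ij in auto)
    finally show "(U * map_mat D ?T) $$ (i, j) = 0\<^sub>m n n $$ (i, j)" using ij by simp
  qed (use UTc in auto)
  then have "map_mat D ?T = minv U * 0\<^sub>m n n" using mult_minv_cancel(2)[OF U DTc] by simp
  also have "\<dots> = 0\<^sub>m n n" by (rule right_mult_zero_mat[OF UD(4)])
  finally have DT: "map_mat D ?T = 0\<^sub>m n n" .
  have "?T \<in> Mat C n" unfolding Mat_iff
  proof (intro conjI allI impI Tc)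
    fix i j assume ij: "i < n" "j < n"
    have "D (?T $$ (i, j)) = map_mat D ?T $$ (i, j)"
      by (rule index_map_mat(1)[symmetric]) (use Tc ij in auto)
    also have "\<dots> = 0" unfolding DT using ij by simp
    finally show "?T $$ (i, j) \<in> C" unfolding mem_C_iff .
  qed
  then show ?thesis using TU by (simp add: GL_iff_det[OF C_subfield] GL_iff_det[OF UNIV_subfield])
qed

lemma map_D_dGal: "\<sigma> \<in> G \<Longrightarrow> map_mat D (map_mat \<sigma> U) = map_mat \<sigma> (map_mat D U)"
  by (intro eq_matI) (auto simp: dGalD(5))

lemma log_derivative_dGal:
  assumes \<sigma>: "\<sigma> \<in> G" and U: "U \<in> GL UNIV n"
  shows "map_mat D (map_mat \<sigma> U) * minv (map_mat \<sigma> U) = map_mat \<sigma> (map_mat D U * minv U)"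
  using map_dGal_mult[OF \<sigma>, of "map_mat D U" n n "minv U" n] GL_D[OF U] map_dGal_GL[OF \<sigma> U] map_D_dGal[OF \<sigma>]
  by simp

lemma log_derivative_mult_const:
  assumes U: "U \<in> GL UNIV n" and T: "T \<in> GL C n"
  shows "map_mat D (U * T) * minv (U * T) = map_mat D U * minv U"
proof -
  have TU: "T \<in> GL UNIV n" using T GL_C_UNIV by blast
  note UD = GL_D[OF U] and TD = GL_D[OF T]
  have DU: "map_mat D U \<in> carrier_mat n n" using UD by simp
  have DUT: "map_mat D (U * T) = map_mat D U * T"
    using map_mat_derivation_mult[OF D UD(2) TD(2)] map_D_C[OF TD(1)] UD TD DU by simp
  have "map_mat D U * T * (minv T * minv U) = map_mat D U * (T * (minv T * minv U))"
    by (rule assoc_mult_mat[OF DU TD(2) mult_carrier_mat[OF TD(4) UD(4)]])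
  also have "T * (minv T * minv U) = minv U" by (rule mult_minv_cancel(1)[OF T UD(4)])
  finally show ?thesis
    unfolding DUT using GL_mult(2)[OF is_subring_subfield[OF UNIV_subfield] U TU] by simp
qed

lemma cocycle_GL:
  assumes U: "U \<in> GL UNIV n" and A: "map_mat D U * minv U \<in> Mat K n" and \<sigma>: "\<sigma> \<in> G"
  shows "minv U * map_mat \<sigma> U \<in> GL C n"
proof (rule constant_quotient[OF U map_dGal_GL(1)[OF \<sigma> U]])
  show "map_mat D U * minv U = map_mat D (map_mat \<sigma> U) * minv (map_mat \<sigma> U)"
    unfolding log_derivative_dGal[OF \<sigma> U] map_dGal_Mat[OF \<sigma> A] ..
qed

lemma map_dGal_cocycle:
  assumes "U \<in> GL UNIV n" "\<sigma> \<in> G"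
  shows "map_mat \<sigma> U = U * (minv U * map_mat \<sigma> U)"
  using mult_minv_cancel(1)[OF assms(1), of "map_mat \<sigma> U" n] GL_D[OF assms(1)] by simp

text \<open>In a general cocycle relation \<sigma> would act on the second factor. Here that factor
  has entries in \<open>C\<close>, which \<sigma> fixes, so the cocycle is a homomorphism.\<close>

lemma cocycle_comp:
  assumes U: "U \<in> GL UNIV n" and A: "map_mat D U * minv U \<in> Mat K n" and \<sigma>: "\<sigma> \<in> G" and \<tau>: "\<tau> \<in> G"
  shows "minv U * map_mat (\<sigma> \<circ> \<tau>) U = (minv U * map_mat \<sigma> U) * (minv U * map_mat \<tau> U)"
proof -
  let ?S = "minv U * map_mat \<sigma> U" and ?T = "minv U * map_mat \<tau> U"
  note UD = GL_D[OF U]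
  have T: "?T \<in> GL C n" by (rule cocycle_GL[OF U A \<tau>])
  have TK: "?T \<in> Mat K n" using GL_D(1)[OF T] Mat_C_K by blast
  have "map_mat (\<sigma> \<circ> \<tau>) U = map_mat \<sigma> (map_mat \<tau> U)" by (intro eq_matI) auto
  also have "\<dots> = map_mat \<sigma> (U * ?T)" using map_dGal_cocycle[OF U \<tau>] by simp
  also have "\<dots> = map_mat \<sigma> U * ?T"
    using map_dGal_mult[OF \<sigma> UD(2) GL_D(2)[OF T]] map_dGal_Mat[OF \<sigma> TK] by simp
  finally have "map_mat (\<sigma> \<circ> \<tau>) U = map_mat \<sigma> U * ?T" .
  moreover have "minv U * (map_mat \<sigma> U * ?T) = ?S * ?T"
    by (rule assoc_mult_mat[symmetric, OF UD(4) _ GL_D(2)[OF T]]) (use UD in simp)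
  ultimately show ?thesis by simp
qed

definition galois_mat :: "('a \<Rightarrow> 'a) \<Rightarrow> 'a mat" where "galois_mat \<sigma> = minv F * map_mat \<sigma> F"

lemma log_derivative_F: "map_mat D F * minv F = B"
  unfolding D_F by (rule mult_minv_cancel_right(1)[OF F_GL MatD(1)[OF B_Mat]])

lemma galois_mat_GL: "\<sigma> \<in> G \<Longrightarrow> galois_mat \<sigma> \<in> GL C m"
  unfolding galois_mat_def by (rule cocycle_GL[OF F_GL]) (simp_all add: log_derivative_F B_Mat)

lemma map_F: "\<sigma> \<in> G \<Longrightarrow> map_mat \<sigma> F = F * galois_mat \<sigma>"
  unfolding galois_mat_def by (rule map_dGal_cocycle[OF F_GL])

lemma galois_mat_comp: "\<sigma> \<in> G \<Longrightarrow> \<tau> \<in> G \<Longrightarrow> galois_mat (\<sigma> \<circ> \<tau>) = galois_mat \<sigma> * galois_mat \<tau>"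
  unfolding galois_mat_def by (rule cocycle_comp[OF F_GL]) (simp_all add: log_derivative_F B_Mat)

lemma galois_mat_inv:
  assumes "\<sigma> \<in> G"
  shows "galois_mat (inv_into UNIV \<sigma>) = minv (galois_mat \<sigma>)"
proof -
  note i = dGal_inv[OF assms]
  have "map_mat id F = F" by (intro eq_matI) auto
  then have X1: "galois_mat id = 1\<^sub>m m" unfolding galois_mat_def using GL_D(6)[OF F_GL] by (simp only:)
  have "inv_into UNIV \<sigma> \<circ> \<sigma> = id" using i(3) by (auto simp: fun_eq_iff)
  moreover have "galois_mat (\<sigma> \<circ> inv_into UNIV \<sigma>) = galois_mat \<sigma> * galois_mat (inv_into UNIV \<sigma>)" "galois_mat (inv_into UNIV \<sigma> \<circ> \<sigma>) = galois_mat (inv_into UNIV \<sigma>) * galois_mat \<sigma>"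
    using galois_mat_comp assms i(1) by blast+
  ultimately have "galois_mat \<sigma> * galois_mat (inv_into UNIV \<sigma>) = 1\<^sub>m m" "galois_mat (inv_into UNIV \<sigma>) * galois_mat \<sigma> = 1\<^sub>m m"
    using i(4) X1 by simp_all
  then show ?thesis using GL_D(2)[OF galois_mat_GL] assms i(1) by (intro minv_unique[symmetric, of _ m]) auto
qed

text \<open>Artin's independence argument; it is the injectivity of \<open>L \<otimes>\<^sub>K L \<rightarrow> Map(G, L)\<close>.\<close>

lemma artin_independence:
  assumes e: "indep K r e"
  shows "(\<And>\<tau>. \<tau> \<in> G \<Longrightarrow> (\<Sum>k<r. e k * \<tau> (z k)) = 0) \<Longrightarrow> k < r \<Longrightarrow> z k = 0"
proof (induction "card {k. k < r \<and> z k \<noteq> 0}" arbitrary: z k rule: less_induct)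
  case less
  show ?case
  proof (rule ccontr)
    assume nz: "z k \<noteq> 0"
    let ?z = "\<lambda>j. z j / z k"
    have sum0: "(\<Sum>j<r. e j * \<tau> (?z j)) = 0" if \<tau>: "\<tau> \<in> G" for \<tau>
    proof -
      have "(\<Sum>j<r. e j * \<tau> (?z j)) = (\<Sum>j<r. e j * \<tau> (z j)) / \<tau> (z k)"
        by (simp add: dGalD(10)[OF \<tau>] sum_divide_distrib)
      then show ?thesis using less.prems(1)[OF \<tau>] by simp
    qed
    have inK: "?z j \<in> K" if "j < r" for j
    proof (rule fixed_field, rule ballI)
      fix \<sigma> assume \<sigma>: "\<sigma> \<in> G"
      \<comment> \<open>The same sums vanish for \<open>w\<close>, by the hypothesis at \<tau> and
        at \<open>\<tau> \<circ> \<sigma>\<close>, but \<open>w k = 0\<close> makes its support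
        smaller. So \<open>w\<close> is zero by induction, and the quotients are fixed by
        \<sigma>.\<close>
      define w where "w j = \<sigma> (?z j) - ?z j" for j
      have wk: "w k = 0" using nz dGalD(7)[OF \<sigma>] by (simp add: w_def)
      have w0: "w i = 0" if "z i = 0" for i using that dGalD(6)[OF \<sigma>] by (simp add: w_def)
      have "{j. j < r \<and> w j \<noteq> 0} \<subset> {j. j < r \<and> z j \<noteq> 0}" using less.prems(2) nz wk w0 by blast
      then have "card {j. j < r \<and> w j \<noteq> 0} < card {j. j < r \<and> z j \<noteq> 0}"
        by (intro psubset_card_mono) auto
      moreover have "(\<Sum>j<r. e j * \<tau> (w j)) = 0" if \<tau>: "\<tau> \<in> G" for \<tau>
      proof -
        have "(\<Sum>j<r. e j * \<tau> (w j)) = (\<Sum>j<r. e j * (\<tau> \<circ> \<sigma>) (?z j)) - (\<Sum>j<r. e j * \<tau> (?z j))"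
          by (simp add: w_def dGalD(9)[OF \<tau>] right_diff_distrib sum_subtractf)
        then show ?thesis using sum0[OF \<tau>] sum0[OF dGal_comp[OF \<tau> \<sigma>]] by simp
      qed
      ultimately have "w j = 0" using that by (rule less.hyps)
      then show "\<sigma> (?z j) = ?z j" by (simp add: w_def)
    qed
    \<comment> \<open>With all quotients in \<open>K\<close>, the sum for the identity automorphism
      is a linear relation over \<open>K\<close> among the \<open>e j\<close>, in which the
      coefficient at \<open>k\<close> is 1.\<close>
    have "(\<Sum>j<r. ?z j * e j) = 0" using sum0[OF dGal_id] by (simp add: mult.commute)
    then have "?z k = 0" using inK by (intro indepD[OF e _ _ less.prems(2), of ?z]) auto
    then show False using nz by simp
  qed
qed

end


section \<open>Regularity of the cocycle\<close>

lemma GL_regular_sum: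
  assumes "is_subfield S" "\<And>i. i \<in> I \<Longrightarrow> f i \<in> GL_regular S m"
  shows "(\<lambda>X. \<Sum>i\<in>I. f i X) \<in> GL_regular S m"
  using assms(2) by (induction I rule: infinite_finite_induct) 
    (auto intro: GL_regular.add GL_regular.const is_subfieldD[OF assms(1)])

lemma GL_regular_prod:
  assumes "is_subfield S" "\<And>i. i \<in> I \<Longrightarrow> f i \<in> GL_regular S m"
  shows "(\<lambda>X. \<Prod>i\<in>I. f i X) \<in> GL_regular S m"
  using assms(2) by (induction I rule: infinite_finite_induct) 
    (auto intro: GL_regular.mult GL_regular.const is_subfieldD[OF assms(1)])

lemma GL_regular_det:
  assumes S: "is_subfield S" and h: "\<And>i j. i < k \<Longrightarrow> j < k \<Longrightarrow> h i j \<in> GL_regular S m"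
  shows "(\<lambda>X. det (mat k k (\<lambda>(i, j). h i j X))) \<in> GL_regular S m"
proof -
  have "h i (p i) \<in> GL_regular S m" if "p permutes {0..<k}" "i < k" for p i
    using that permutes_in_image[OF that(1), of i] h by simp
  then show ?thesis unfolding det_mat_permutations
    using signof_in_subring[OF is_subring_subfield[OF S]]
    by (auto intro!: GL_regular_sum[OF S] GL_regular_prod[OF S] GL_regular.mult intro: GL_regular.const)
qed

lemma GL_regular_value:
  assumes S: "is_subfield S" and "f \<in> GL_regular S m" and X: "X \<in> GL S m"
  shows "f X \<in> S"
  using assms(2)
proof (induction rule: GL_regular.induct)
  case (entry i j)
  then show ?case using MatD(2)[OF GL_D(1)[OF X]] by blast
next
  case inverse_det
  then show ?case
    using is_subfieldD(6)[OF S det_in_subring[OF is_subring_subfield[OF S] GL_D(1)[OF X]]] .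
qed (auto simp: is_subfieldD[OF S])

text \<open>Cramer's rule: inversion is a morphism of \<open>GL\<close>, and it exchanges the
  determinant with its inverse.\<close>

lemma GL_regular_minv:
  assumes S: "is_subfield S" and "f \<in> GL_regular S m"
  shows "\<exists>g\<in>GL_regular S m. \<forall>X\<in>GL S m. f (minv X) = g X"
  using assms(2)
proof (induction rule: GL_regular.induct)
  case (const c)
  then show ?case by (intro bexI[of _ "\<lambda>X. c"]) (auto intro: GL_regular.const)
next
  case (entry i j)
  \<comment> \<open>Row \<open>j\<close> and column \<open>i\<close> are deleted, because the
    adjugate transposes the cofactors.\<close>
  let ?c = "\<lambda>X. mat (m - 1) (m - 1) (\<lambda>(a, b). X $$ (if a < j then a else Suc a, if b < i then b else Suc b))"
  let ?g = "\<lambda>X :: 'a mat. inverse (det X) * ((- 1) ^ (j + i) * det (?c X))"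
  have m1: "(- 1) ^ k \<in> S" for k using is_subringD(5,7,2)[OF is_subring_subfield[OF S]] by blast
  have "?g \<in> GL_regular S m"
    using entry m1
    by (intro GL_regular.mult GL_regular.inverse_det GL_regular.const GL_regular_det[OF S] GL_regular.entry) auto
  moreover have "minv X $$ (i, j) = ?g X" if X: "X \<in> GL S m" for X
  proof -
    have XU: "X \<in> GL UNIV m" using X GL_mono[of S UNIV m] by blast
    have Xc: "X \<in> carrier_mat m m" by (rule GL_D(2)[OF X])
    have "mat_delete X j i = ?c X" using Xc by (simp add: mat_delete_def)
    then show ?thesis
      unfolding minv_eq_adj[OF XU] using Xc entry by (simp add: adj_mat_def cofactor_def)
  qed
  ultimately show ?case by (intro bexI[of _ ?g] ballI)
next
  case inverse_det
  have "(\<lambda>X. det (mat m m (\<lambda>(i, j). X $$ (i, j)))) \<in> GL_regular S m"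
    by (intro GL_regular_det[OF S] GL_regular.entry)
  moreover have "inverse (det (minv X)) = det (mat m m (\<lambda>(i, j). X $$ (i, j)))" if X: "X \<in> GL S m" for X
  proof -
    have "mat m m (\<lambda>(i, j). X $$ (i, j)) = X" using GL_D(2)[OF X] by (intro eq_matI) auto
    moreover have "det X * det (minv X) = 1"
      using det_mult[OF GL_D(2)[OF X] GL_D(4)[OF X]] GL_D(5)[OF X] by simp
    then have "inverse (det (minv X)) = det X" by (metis inverse_unique mult.commute)
    ultimately show ?thesis by simp
  qed
  ultimately show ?case by (intro bexI[of _ "\<lambda>X. det (mat m m (\<lambda>(i, j). X $$ (i, j)))"] ballI)
next
  case (add f g)
  then obtain f' g' where *: "f' \<in> GL_regular S m" "g' \<in> GL_regular S m"
    "\<forall>X\<in>GL S m. f (minv X) = f' X" "\<forall>X\<in>GL S m. g (minv X) = g' X" by blast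
  then show ?case by (intro bexI[of _ "\<lambda>X. f' X + g' X"]) (auto intro: GL_regular.add)
next
  case (mult f g)
  then obtain f' g' where *: "f' \<in> GL_regular S m" "g' \<in> GL_regular S m"
    "\<forall>X\<in>GL S m. f (minv X) = f' X" "\<forall>X\<in>GL S m. g (minv X) = g' X" by blast
  then show ?case by (intro bexI[of _ "\<lambda>X. f' X * g' X"]) (auto intro: GL_regular.mult)
qed

text \<open>Functions on the Galois group are functions on a whole type. As \<open>V\<close>
  contains everything that vanishes on \<open>E\<close>, values off \<open>E\<close> may be changed
  freely.\<close>

lemma lspan_cong:
  assumes V: "\<And>h. \<forall>x\<in>E. h x = 0 \<Longrightarrow> h \<in> V" and f: "f \<in> lspan V" "\<forall>x\<in>E. f x = g x"
  shows "g \<in> lspan V"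
proof -
  have "(\<lambda>x. g x - f x) \<in> V" using f(2) by (intro V) simp
  from lspan.step[OF f(1) this, of 1] show ?thesis by simp
qed

context picard_vessiot_extension
begin

definition regular_maps :: "(('a \<Rightarrow> 'a) \<Rightarrow> 'a) set" where
  "regular_maps = {\<phi>. dGal_regular D K m F \<phi>}"

lemma regular_maps_iff: "\<phi> \<in> regular_maps \<longleftrightarrow> (\<exists>f\<in>GL_regular C m. \<forall>\<sigma>\<in>G. \<phi> \<sigma> = f (galois_mat \<sigma>))"
  by (simp add: regular_maps_def dGal_regular_def galois_mat_def)

lemma regular_maps_I: "f \<in> GL_regular C m \<Longrightarrow> (\<And>\<sigma>. \<sigma> \<in> G \<Longrightarrow> \<phi> \<sigma> = f (galois_mat \<sigma>)) \<Longrightarrow> \<phi> \<in> regular_maps"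
  unfolding regular_maps_iff by blast

lemma regular_maps_E:
  assumes "\<phi> \<in> regular_maps"
  obtains f where "f \<in> GL_regular C m" "\<And>\<sigma>. \<sigma> \<in> G \<Longrightarrow> \<phi> \<sigma> = f (galois_mat \<sigma>)"
  using assms unfolding regular_maps_iff by blast

lemma regular_maps_const: "c \<in> C \<Longrightarrow> (\<lambda>\<sigma>. c) \<in> regular_maps"
  by (rule regular_maps_I[OF GL_regular.const]) simp_all

lemma regular_maps_mult: "\<phi> \<in> regular_maps \<Longrightarrow> \<psi> \<in> regular_maps \<Longrightarrow> (\<lambda>\<sigma>. \<phi> \<sigma> * \<psi> \<sigma>) \<in> regular_maps"
  by (elim regular_maps_E, rule regular_maps_I[OF GL_regular.mult]) auto

lemma regular_maps_subspace: "fun_subspace C regular_maps"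
  unfolding fun_subspace_def
proof (intro conjI ballI)
  show "(\<lambda>x. 0) \<in> regular_maps" by (rule regular_maps_const[OF is_subfieldD(1)[OF C_subfield]])
  show "(\<lambda>\<sigma>. \<phi> \<sigma> + \<psi> \<sigma>) \<in> regular_maps" if "\<phi> \<in> regular_maps" "\<psi> \<in> regular_maps" for \<phi> \<psi>
    using that by (elim regular_maps_E, intro regular_maps_I[OF GL_regular.add]) auto
  show "(\<lambda>\<sigma>. c * \<phi> \<sigma>) \<in> regular_maps" if "c \<in> C" "\<phi> \<in> regular_maps" for c \<phi> by (rule regular_maps_mult[OF regular_maps_const]) fact+
qed

lemma regular_maps_value: "\<phi> \<in> regular_maps \<Longrightarrow> \<sigma> \<in> G \<Longrightarrow> \<phi> \<sigma> \<in> C"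
  by (elim regular_maps_E) (simp add: GL_regular_value[OF C_subfield _ galois_mat_GL])

lemma regular_maps_cong: "\<phi> \<in> regular_maps \<Longrightarrow> \<forall>\<sigma>\<in>G. \<phi> \<sigma> = \<psi> \<sigma> \<Longrightarrow> \<psi> \<in> regular_maps"
  by (elim regular_maps_E, rule regular_maps_I) auto

lemma lspan_regular_maps_cong: "\<phi> \<in> lspan regular_maps \<Longrightarrow> \<forall>\<sigma>\<in>G. \<phi> \<sigma> = \<psi> \<sigma> \<Longrightarrow> \<psi> \<in> lspan regular_maps"
  by (rule lspan_cong[of G regular_maps]) (auto intro: regular_maps_cong[OF fun_subspaceD(1)[OF regular_maps_subspace]])

lemma lspan_regular_maps_mult: "\<phi> \<in> lspan regular_maps \<Longrightarrow> \<psi> \<in> lspan regular_maps \<Longrightarrow> (\<lambda>\<sigma>. \<phi> \<sigma> * \<psi> \<sigma>) \<in> lspan regular_maps"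
  by (rule lspan_mult_closed[of regular_maps regular_maps regular_maps]) (auto intro: lspan_incl regular_maps_mult)

lemma regular_maps_inverse:
  assumes "\<phi> \<in> regular_maps"
  shows "(\<lambda>\<tau>. \<phi> (inv_into UNIV \<tau>)) \<in> regular_maps"
proof -
  obtain f where f: "f \<in> GL_regular C m" "\<And>\<sigma>. \<sigma> \<in> G \<Longrightarrow> \<phi> \<sigma> = f (galois_mat \<sigma>)"
    using assms unfolding regular_maps_iff by blast
  obtain g where g: "g \<in> GL_regular C m" "\<forall>X\<in>GL C m. f (minv X) = g X"
    using GL_regular_minv[OF C_subfield f(1)] by blast
  show ?thesis
    by (rule regular_maps_I[OF g(1)]) (use f(2) g(2) dGal_inv(1) galois_mat_inv galois_mat_GL in auto)
qed

text \<open>A \<open>C\<close>-linear projection of \<open>L\<close> onto \<open>C\<close> turns coefficients in \<open>L\<close> into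
  coefficients in \<open>C\<close> without changing the values.\<close>

lemma C_valued_regular:
  assumes \<phi>: "\<phi> \<in> lspan regular_maps" and val: "\<And>\<sigma>. \<sigma> \<in> G \<Longrightarrow> \<phi> \<sigma> \<in> C"
  shows "\<phi> \<in> regular_maps"
proof -
  have "subspace_over C {0}" by (auto simp: subspace_over_def)
  then obtain u where u: "linear_form C u" "u 1 = 1" using exists_linear_form[OF C_subfield, of "{0}" 1] by auto
  note uD = linear_formD[OF u(1)]
  have uC: "u c = c" if "c \<in> C" for c using uD(3)[OF that, of 1] u(2) by simp
  obtain r l g where g: "\<And>k. k < r \<Longrightarrow> g k \<in> regular_maps" "\<phi> = (\<lambda>x. \<Sum>k<(r::nat). l k * g k x)"
    using \<phi> by (rule lspan_repr) blast
  have "(\<lambda>\<sigma>. \<Sum>k<r. u (l k) * g k \<sigma>) \<in> regular_maps"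
    using g(1) uD(1) by (intro fun_subspace_sum[OF regular_maps_subspace] fun_subspaceD(3)[OF regular_maps_subspace]) auto
  moreover have "\<forall>\<sigma>\<in>G. (\<Sum>k<r. u (l k) * g k \<sigma>) = \<phi> \<sigma>"
  proof
    fix \<sigma> assume \<sigma>: "\<sigma> \<in> G"
    have "u (l k * g k \<sigma>) = u (l k) * g k \<sigma>" if "k < r" for k
      by (rule uD(4)[OF regular_maps_value[OF g(1)[OF that] \<open>\<sigma> \<in> G\<close>]])
    then have "(\<Sum>k<r. u (l k) * g k \<sigma>) = u (\<phi> \<sigma>)" unfolding g(2) by (simp add: uD(6))
    then show "(\<Sum>k<r. u (l k) * g k \<sigma>) = \<phi> \<sigma>" using uC[OF val[OF \<sigma>]] by simp
  qed
  ultimately show ?thesis by (rule regular_maps_cong)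
qed

section \<open>The ring \<open>K[F]\<close>, its orbit functions and denominators\<close>

definition pv_ring :: "'a set" where "pv_ring = {p (entries m F) | p. p \<in> polyfun K (m * m)}"

lemma pv_ring_subring: "is_subring pv_ring"
  unfolding is_subring_def
proof (intro conjI ballI)
  show "1 \<in> pv_ring" using polyfun.const[OF is_subfieldD(2)[OF K_subfield]] by (auto simp: pv_ring_def)
  fix x y assume "x \<in> pv_ring" "y \<in> pv_ring"
  then obtain p q where "p \<in> polyfun K (m * m)" "q \<in> polyfun K (m * m)" "x = p (entries m F)" "y = q (entries m F)"
    by (auto simp: pv_ring_def)
  then show "x - y \<in> pv_ring" "x * y \<in> pv_ring"
    using polyfun_diff[OF K_subfield, of p _ q] polyfun.mult[of p K _ q] by (auto simp: pv_ring_def)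
qed

lemma K_subset_pv_ring: "c \<in> K \<Longrightarrow> c \<in> pv_ring"
  unfolding pv_ring_def using polyfun.const by (intro CollectI exI[of _ "\<lambda>x. c"]) auto

lemma dGal_pv_ring:
  assumes "\<sigma> \<in> G" "r \<in> pv_ring"
  shows "\<sigma> r \<in> pv_ring"
proof -
  obtain p where p: "p \<in> polyfun K (m * m)" "r = p (entries m F)" using assms(2) by (auto simp: pv_ring_def)
  have XK: "galois_mat \<sigma> \<in> Mat K m" using GL_D(1)[OF galois_mat_GL[OF assms(1)]] Mat_C_K by blast
  have "(\<lambda>x. p (entries m (of_entries m x * galois_mat \<sigma>))) \<in> polyfun K (m * m)"
    by (rule polyfun_mult_right[OF K_subfield XK p(1) subset_refl])
  moreover have "\<sigma> r = p (entries m (of_entries m (entries m F) * galois_mat \<sigma>))"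
    unfolding p(2) dGal_polyfun_entries[OF assms(1) p(1) F_carrier] of_entries_entries[OF F_carrier]
    by (simp only: map_F[OF assms(1)])
  ultimately show ?thesis unfolding pv_ring_def
    by (intro CollectI exI[of _ "\<lambda>x. p (entries m (of_entries m x * galois_mat \<sigma>))"] conjI)
qed

text \<open>Since \<sigma>(F) is \<open>F * galois_mat \<sigma>\<close>, each entry of
  \<open>F\<close> is sent to an expression linear in the coordinates of the Galois matrix, with
  coefficients in \<open>L\<close>.\<close>

lemma pv_ring_lspan: "r \<in> pv_ring \<Longrightarrow> (\<lambda>\<sigma>. \<sigma> r) \<in> lspan regular_maps"
proof -
  assume "r \<in> pv_ring"
  then obtain p where p: "p \<in> polyfun K (m * m)" "r = p (entries m F)" by (auto simp: pv_ring_def)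
  have "(\<lambda>\<sigma>. \<sigma> (p (entries m F))) \<in> lspan regular_maps" using p(1)
  proof (induction rule: polyfun.induct)
    case (const c)
    show ?case
      by (rule lspan_regular_maps_cong[OF lspan_base[OF regular_maps_const[OF is_subfieldD(2)[OF C_subfield]], of c]])
        (simp add: dGalD(4) const)
  next
    case (var k)
    note kl = index_less_square[OF var]
    have "(\<lambda>\<sigma>. \<Sum>s<m. F $$ (k div m, s) * galois_mat \<sigma> $$ (s, k mod m)) \<in> lspan regular_maps"
      using kl by (intro lspan_sum lspan_base regular_maps_I[OF GL_regular.entry]) auto
    moreover have "\<forall>\<sigma>\<in>G. (\<Sum>s<m. F $$ (k div m, s) * galois_mat \<sigma> $$ (s, k mod m)) = \<sigma> (entries m F k)"
    proof
      fix \<sigma> assume \<sigma>: "\<sigma> \<in> G"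
      have "\<sigma> (entries m F k) = map_mat \<sigma> F $$ (k div m, k mod m)"
        using kl F_carrier by (simp add: entries_def)
      also have "\<dots> = (\<Sum>s<m. F $$ (k div m, s) * galois_mat \<sigma> $$ (s, k mod m))"
        unfolding map_F[OF \<sigma>] by (rule index_mult_mat_sum[OF F_carrier GL_D(2)[OF galois_mat_GL[OF \<sigma>]] kl])
      finally show "(\<Sum>s<m. F $$ (k div m, s) * galois_mat \<sigma> $$ (s, k mod m)) = \<sigma> (entries m F k)" ..
    qed
    ultimately show ?case by (rule lspan_regular_maps_cong)
  next
    case (add f g)
    show ?case by (rule lspan_regular_maps_cong[OF lspan_add[OF add.IH]]) (simp add: dGalD(2))
  next
    case (mult f g)
    show ?case by (rule lspan_regular_maps_cong[OF lspan_regular_maps_mult[OF mult.IH]]) (simp add: dGalD(3))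
  qed
  then show ?thesis by (simp add: p(2))
qed

lemma common_denominator:
  assumes "finite E"
  shows "\<exists>q\<in>pv_ring. q \<noteq> 0 \<and> (\<forall>u\<in>E. q * u \<in> pv_ring)"
  using assms
proof (induction E rule: finite_induct)
  case empty
  show ?case using is_subringD(2)[OF pv_ring_subring] by (intro bexI[of _ 1]) auto
next
  case (insert u E)
  then obtain q where q: "q \<in> pv_ring" "q \<noteq> 0" "\<forall>v\<in>E. q * v \<in> pv_ring" by blast
  obtain p s where ps: "p \<in> polyfun K (m * m)" "s \<in> polyfun K (m * m)" "s (entries m F) \<noteq> 0"
    "u = p (entries m F) / s (entries m F)" using F_fractions[of u] by (rule fractionsE)
  let ?s = "s (entries m F)"
  have sR: "?s \<in> pv_ring" "?s * u \<in> pv_ring" using ps by (auto simp: pv_ring_def)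
  note M = is_subringD(4)[OF pv_ring_subring]
  have "?s * q * v \<in> pv_ring" if "v \<in> insert u E" for v
  proof (cases "v = u")
    case True
    then show ?thesis using M[OF q(1) sR(2)] by (simp add: mult_ac)
  next
    case False
    then have "q * v \<in> pv_ring" using q(3) that by blast
    from M[OF sR(1) this] show ?thesis by (simp add: mult.assoc)
  qed
  then show ?case using M[OF sR(1) q(1)] q(2) ps(3) by (intro bexI[of _ "?s * q"]) auto
qed

text \<open>If the last coefficient lies in \<open>b\<close>, its term is split off. Otherwise a
  form vanishing on \<open>b\<close>, with value 1 at that coefficient, expresses the last regular
  function through the others on the group, and substitution removes it.\<close>

lemma coefficients_in_subspace:
  assumes b: "subspace_over C b"
  shows "(\<And>k. k < (r::nat) \<Longrightarrow> \<phi> k \<in> regular_maps) \<Longrightarrow> (\<And>\<sigma>. \<sigma> \<in> G \<Longrightarrow> (\<Sum>k<r. l k * \<phi> k \<sigma>) \<in> b) \<Longrightarrow>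
    \<exists>s c \<psi>. (\<forall>j<s. c j \<in> b \<and> \<psi> j \<in> regular_maps) \<and> (\<forall>\<sigma>\<in>G. (\<Sum>k<r. l k * \<phi> k \<sigma>) = (\<Sum>j<(s::nat). c j * \<psi> j \<sigma>))"
proof (induction r arbitrary: l)
  case 0
  show ?case by (intro exI[of _ 0]) simp
next
  case (Suc r)
  have bD: "x + y \<in> b" "c \<in> C \<Longrightarrow> c * x \<in> b" if "x \<in> b" "y \<in> b" for x y c
    using b that by (auto simp: subspace_over_def)
  note CD = is_subfieldD[OF C_subfield]
  show ?case
  proof (cases "l r \<in> b")
    case True
    have "(\<Sum>k<r. l k * \<phi> k \<sigma>) \<in> b" if \<sigma>: "\<sigma> \<in> G" for \<sigma>
    proof -
      have "- \<phi> r \<sigma> \<in> C" using CD(5) regular_maps_value[OF Suc.prems(1) \<sigma>] by simp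
      then have "(- \<phi> r \<sigma>) * l r \<in> b" using bD(2) True by blast
      from bD(1)[OF Suc.prems(2)[OF \<sigma>] this] show ?thesis by (simp add: mult.commute)
    qed
    then obtain s c \<psi> where *: "\<forall>j<s. c j \<in> b \<and> \<psi> j \<in> regular_maps" "\<forall>\<sigma>\<in>G. (\<Sum>k<r. l k * \<phi> k \<sigma>) = (\<Sum>j<(s::nat). c j * \<psi> j \<sigma>)"
      using Suc.IH[of l] Suc.prems(1) by auto
    show ?thesis using * True Suc.prems(1)
      by (intro exI[of _ "Suc s"] exI[of _ "c(s := l r)"] exI[of _ "\<psi>(s := \<phi> r)"]) (auto simp: less_Suc_eq)
  next
    case False
    obtain u where u: "linear_form C u" "u (l r) = 1" "\<forall>w\<in>b. u w = 0"
      using exists_linear_form[OF C_subfield b False] by blast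
    note uD = linear_formD[OF u(1)]
    let ?l = "\<lambda>k. l k - u (l k) * l r"
    have eq: "(\<Sum>k<Suc r. l k * \<phi> k \<sigma>) = (\<Sum>k<r. ?l k * \<phi> k \<sigma>)" if \<sigma>: "\<sigma> \<in> G" for \<sigma>
    proof -
      have "u (l k * \<phi> k \<sigma>) = u (l k) * \<phi> k \<sigma>" if "k < Suc r" for k
        by (rule uD(4)[OF regular_maps_value[OF Suc.prems(1)[OF that] \<sigma>]])
      then have "u (\<Sum>k<Suc r. l k * \<phi> k \<sigma>) = (\<Sum>k<Suc r. u (l k) * \<phi> k \<sigma>)"
        unfolding uD(6) by (intro sum.cong) auto
      then have "(\<Sum>k<r. u (l k) * \<phi> k \<sigma>) + \<phi> r \<sigma> = 0"
        using u(2,3) Suc.prems(2)[OF \<sigma>] by simp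
      then have "\<phi> r \<sigma> = - (\<Sum>k<r. u (l k) * \<phi> k \<sigma>)" by (simp add: eq_neg_iff_add_eq_0 add.commute)
      then have "l r * \<phi> r \<sigma> = - (\<Sum>k<r. u (l k) * l r * \<phi> k \<sigma>)"
        by (simp add: sum_distrib_left mult_ac)
      then show ?thesis by (simp add: left_diff_distrib sum_subtractf)
    qed
    have "(\<Sum>k<r. ?l k * \<phi> k \<sigma>) \<in> b" if \<sigma>: "\<sigma> \<in> G" for \<sigma>
      using Suc.prems(2)[OF \<sigma>] unfolding eq[OF \<sigma>] .
    then show ?thesis using Suc.IH[of ?l] Suc.prems(1) eq by simp
  qed
qed

text \<open>The denominators \<open>b\<close> of the entries of \<open>U\<close> are stable under the Galois group. Writing
  \<open>\<sigma>(q) = \<Sum>\<^sub>j c\<^sub>j \<psi>\<^sub>j(\<sigma>)\<close> for a denominator \<open>q\<close> with \<open>c\<^sub>j \<in> b\<close>, and applying \<open>\<tau>\<close> at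
  \<open>\<sigma> = \<tau>\<^sup>-\<^sup>1\<close>, expresses \<open>q\<close> through denominators of the representation.\<close>

lemma representation_regular:
  assumes U: "U \<in> GL UNIV n" and \<rho>: "\<And>\<sigma>. \<sigma> \<in> G \<Longrightarrow> \<rho> \<sigma> \<in> GL C n"
    and eq: "\<And>\<sigma>. \<sigma> \<in> G \<Longrightarrow> map_mat \<sigma> U = U * \<rho> \<sigma>" and ij: "i < n" "j < n"
  shows "(\<lambda>\<sigma>. \<rho> \<sigma> $$ (i, j)) \<in> regular_maps"
proof -
  note UD = GL_D[OF U]
  define b where "b = {r. \<forall>i<n. \<forall>j<n. r * U $$ (i, j) \<in> pv_ring}"
  note R = is_subringD[OF pv_ring_subring]
  have bI: "r * U $$ (i, j) \<in> pv_ring" if "r \<in> b" "i < n" "j < n" for r i j using that by (simp add: b_def)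
  have b: "subspace_over C b"
    unfolding subspace_over_def b_def using R(1,4,6) K_subset_pv_ring C_subset_K
    by (auto simp: distrib_right mult.assoc)
  have "finite ((\<lambda>(i, j). U $$ (i, j)) ` ({..<n} \<times> {..<n}))" by simp
  from common_denominator[OF this] obtain q where q: "q \<in> pv_ring" "q \<noteq> 0" "q \<in> b" by (auto simp: b_def)
  have stable: "\<sigma> r \<in> b" if \<sigma>: "\<sigma> \<in> G" and r: "r \<in> b" for \<sigma> r
    unfolding b_def
  proof (intro CollectI allI impI)
    fix i j assume ij: "i < n" "j < n"
    have \<sigma>U: "map_mat \<sigma> U \<in> carrier_mat n n" using UD by simp
    note P = GL_D[OF \<rho>[OF \<sigma>]]
    have "U = map_mat \<sigma> U * minv (\<rho> \<sigma>)" unfolding eq[OF \<sigma>]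
      by (rule mult_minv_cancel_right(1)[OF \<rho>[OF \<sigma>] UD(2), symmetric])
    then have "U $$ (i, j) = (map_mat \<sigma> U * minv (\<rho> \<sigma>)) $$ (i, j)" by simp
    also have "\<dots> = (\<Sum>s<n. \<sigma> (U $$ (i, s)) * minv (\<rho> \<sigma>) $$ (s, j))"
      unfolding index_mult_mat_sum[OF \<sigma>U P(4) ij] using UD ij by simp
    finally have "\<sigma> r * U $$ (i, j) = (\<Sum>s<n. \<sigma> (r * U $$ (i, s)) * minv (\<rho> \<sigma>) $$ (s, j))"
      by (simp add: dGalD(3)[OF \<sigma>] sum_distrib_left mult.assoc)
    also have "\<dots> \<in> pv_ring"
    proof (intro is_subring_sum[OF pv_ring_subring] R(4))
      fix s assume "s \<in> {..<n}"
      then have s: "s < n" by simp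
      show "\<sigma> (r * U $$ (i, s)) \<in> pv_ring" by (rule dGal_pv_ring[OF \<sigma> bI[OF r ij(1) s]])
      show "minv (\<rho> \<sigma>) $$ (s, j) \<in> pv_ring" using MatD(2)[OF P(3) s ij(2)] C_subset_K K_subset_pv_ring by blast
    qed
    finally show "\<sigma> r * U $$ (i, j) \<in> pv_ring" .
  qed
  \<comment> \<open>The matrix \<open>r * U\<close> has entries in \<open>pv_ring\<close>, and
    \<tau>(r) \<rho>(\<tau>) is \<open>minv U\<close> times its image under \<tau>.\<close>
  have bR: "(\<lambda>\<tau>. \<tau> r * \<rho> \<tau> $$ (i, j)) \<in> lspan regular_maps" if r: "r \<in> b" for r
  proof -
    have "(\<lambda>\<tau>. \<Sum>s<n. minv U $$ (i, s) * \<tau> (r * U $$ (s, j))) \<in> lspan regular_maps"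
      by (intro lspan_sum lspan_scale pv_ring_lspan bI[OF r _ ij(2)]) simp
    moreover have "(\<Sum>s<n. minv U $$ (i, s) * \<tau> (r * U $$ (s, j))) = \<tau> r * \<rho> \<tau> $$ (i, j)" if \<tau>: "\<tau> \<in> G" for \<tau>
    proof -
      have \<tau>U: "map_mat \<tau> U \<in> carrier_mat n n" using UD by simp
      have "\<rho> \<tau> = minv U * map_mat \<tau> U" unfolding eq[OF \<tau>]
        by (rule mult_minv_cancel(2)[OF U GL_D(2)[OF \<rho>[OF \<tau>]], symmetric])
      then have "\<rho> \<tau> $$ (i, j) = (minv U * map_mat \<tau> U) $$ (i, j)" by simp
      also have "\<dots> = (\<Sum>s<n. minv U $$ (i, s) * \<tau> (U $$ (s, j)))"
        unfolding index_mult_mat_sum[OF UD(4) \<tau>U ij] using UD ij by simp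
      finally show ?thesis by (simp add: dGalD(3)[OF \<tau>] sum_distrib_left mult_ac)
    qed
    ultimately show ?thesis by (rule lspan_regular_maps_cong[OF _ ballI])
  qed
  obtain r l \<phi> where \<phi>: "\<And>k. k < r \<Longrightarrow> \<phi> k \<in> regular_maps" "(\<lambda>\<sigma>. \<sigma> q) = (\<lambda>\<sigma>. \<Sum>k<(r::nat). l k * \<phi> k \<sigma>)"
    using pv_ring_lspan[OF q(1)] by (rule lspan_repr) blast
  have \<phi>q: "(\<Sum>k<r. l k * \<phi> k \<sigma>) = \<sigma> q" for \<sigma> using fun_cong[OF \<phi>(2), of \<sigma>] by simp
  have "\<exists>s c \<psi>. (\<forall>j<s. c j \<in> b \<and> \<psi> j \<in> regular_maps) \<and> (\<forall>\<sigma>\<in>G. (\<Sum>k<r. l k * \<phi> k \<sigma>) = (\<Sum>j<(s::nat). c j * \<psi> j \<sigma>))"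
    by (rule coefficients_in_subspace[OF b]) (use \<phi>(1) \<phi>q stable q(3) in auto)
  then obtain s c \<psi> where \<psi>: "\<And>j. j < s \<Longrightarrow> c j \<in> b" "\<And>j. j < s \<Longrightarrow> \<psi> j \<in> regular_maps"
    "\<And>\<sigma>. \<sigma> \<in> G \<Longrightarrow> \<sigma> q = (\<Sum>j<(s::nat). c j * \<psi> j \<sigma>)" unfolding \<phi>q by blast
  let ?i = "\<lambda>\<tau>. inv_into UNIV \<tau> :: 'a \<Rightarrow> 'a"
  have "(\<lambda>\<tau>. \<Sum>k<s. (\<tau> (c k) * \<rho> \<tau> $$ (i, j)) * \<psi> k (?i \<tau>)) \<in> lspan regular_maps"
    using \<psi>(1,2) by (intro lspan_sum lspan_regular_maps_mult bR lspan_incl regular_maps_inverse) auto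
  \<comment> \<open>Here \<open>q\<close> is one fixed element of \<open>L\<close> and not a
    function of \<tau>, so dividing by it stays within the span over \<open>L\<close>.\<close>
  from lspan_scale[OF this, of "inverse q"]
  have "(\<lambda>\<tau>. inverse q * (\<Sum>k<s. (\<tau> (c k) * \<rho> \<tau> $$ (i, j)) * \<psi> k (?i \<tau>))) \<in> lspan regular_maps" .
  moreover have "inverse q * (\<Sum>k<s. (\<tau> (c k) * \<rho> \<tau> $$ (i, j)) * \<psi> k (?i \<tau>)) = \<rho> \<tau> $$ (i, j)" if \<tau>: "\<tau> \<in> G" for \<tau>
  proof -
    note it = dGal_inv[OF \<tau>]
    have const: "\<tau> (\<psi> k (?i \<tau>)) = \<psi> k (?i \<tau>)" if "k < s" for k
      using dGalD(4)[OF \<tau>] regular_maps_value[OF \<psi>(2)[OF that] it(1)] C_subset_K by blast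
    have "q = \<tau> (?i \<tau> q)" using it(2) by simp
    also have "\<dots> = (\<Sum>k<s. \<tau> (c k) * \<psi> k (?i \<tau>))"
      unfolding \<psi>(3)[OF it(1)] dGalD(12)[OF \<tau>] using const by (intro sum.cong) (auto simp: dGalD(3)[OF \<tau>])
    finally have q_eq: "q = (\<Sum>k<s. \<tau> (c k) * \<psi> k (?i \<tau>))" .
    have "(\<Sum>k<s. (\<tau> (c k) * \<rho> \<tau> $$ (i, j)) * \<psi> k (?i \<tau>)) = q * \<rho> \<tau> $$ (i, j)"
      unfolding q_eq sum_distrib_right by (intro sum.cong) (simp_all add: mult_ac)
    then show ?thesis using q(2) by simp
  qed
  ultimately have "(\<lambda>\<tau>. \<rho> \<tau> $$ (i, j)) \<in> lspan regular_maps" by (rule lspan_regular_maps_cong[OF _ ballI])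
  then show ?thesis
    by (rule C_valued_regular) (use MatD(2)[OF GL_D(1)[OF \<rho>] ij] in auto)
qed

end


section \<open>Realizing representations\<close>

context picard_vessiot_extension
begin

text \<open>The span over \<open>L\<close> of these maps is, on the Galois group, the image of the
  tensor square of \<open>L\<close> over \<open>K\<close>, where \<open>x \<otimes> r\<close> goes
  to the map taking \<tau> to x \<tau>(r).\<close>

definition orbit_maps :: "(('a \<Rightarrow> 'a) \<Rightarrow> 'a) set" where
  "orbit_maps = {g. \<exists>r. \<forall>\<tau>\<in>G. g \<tau> = \<tau> r}"

lemma orbit_maps_I: "(\<And>\<tau>. \<tau> \<in> G \<Longrightarrow> g \<tau> = \<tau> r) \<Longrightarrow> g \<in> orbit_maps"
  by (auto simp: orbit_maps_def)

lemma orbit_maps_subspace: "fun_subspace K orbit_maps"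
  unfolding fun_subspace_def
proof (intro conjI ballI)
  show "(\<lambda>x. 0) \<in> orbit_maps" by (rule orbit_maps_I[of _ 0]) (simp add: dGalD(6))
  show "(\<lambda>x. f x + g x) \<in> orbit_maps" if fg: "f \<in> orbit_maps" "g \<in> orbit_maps" for f g
  proof -
    obtain r s where "\<forall>\<tau>\<in>G. f \<tau> = \<tau> r" "\<forall>\<tau>\<in>G. g \<tau> = \<tau> s" using fg by (auto simp: orbit_maps_def)
    then show ?thesis by (intro orbit_maps_I[of _ "r + s"]) (simp add: dGalD(2))
  qed
  show "(\<lambda>x. c * f x) \<in> orbit_maps" if cf: "c \<in> K" "f \<in> orbit_maps" for c f
  proof -
    obtain r where "\<forall>\<tau>\<in>G. f \<tau> = \<tau> r" using cf by (auto simp: orbit_maps_def)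
    then show ?thesis using cf(1) by (intro orbit_maps_I[of _ "c * r"]) (simp add: dGalD(3,4))
  qed
qed

lemma lspan_orbit_maps_cong: "f \<in> lspan orbit_maps \<Longrightarrow> \<forall>\<tau>\<in>G. f \<tau> = g \<tau> \<Longrightarrow> g \<in> lspan orbit_maps"
  by (rule lspan_cong[of G orbit_maps]) (auto intro!: orbit_maps_I[of _ 0] simp: dGalD(6))

lemma lspan_orbit_maps_mult: "f \<in> lspan orbit_maps \<Longrightarrow> g \<in> lspan orbit_maps \<Longrightarrow> (\<lambda>\<tau>. f \<tau> * g \<tau>) \<in> lspan orbit_maps"
proof (rule lspan_mult_closed[of orbit_maps orbit_maps orbit_maps])
  fix f g assume fg: "f \<in> orbit_maps" "g \<in> orbit_maps"
  then obtain r s where "\<forall>\<tau>\<in>G. f \<tau> = \<tau> r" "\<forall>\<tau>\<in>G. g \<tau> = \<tau> s" by (auto simp: orbit_maps_def)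
  then show "(\<lambda>\<tau>. f \<tau> * g \<tau>) \<in> lspan orbit_maps" by (intro lspan_incl orbit_maps_I[of _ "r * s"]) (simp add: dGalD(3))
qed

text \<open>The Galois matrix is \<open>minv F\<close> times \<tau>(F), so its entries and its
  inverse determinant are combinations over \<open>L\<close> of orbit maps; products stay in the
  span because \<tau> is multiplicative.\<close>

lemma regular_lspan_orbit_maps: "f \<in> GL_regular C m \<Longrightarrow> (\<lambda>\<tau>. f (galois_mat \<tau>)) \<in> lspan orbit_maps"
proof (induction rule: GL_regular.induct)
  case (const c)
  then show ?case using C_subset_K by (intro lspan_incl orbit_maps_I[of _ c]) (auto simp: dGalD(4))
next
  case (entry i j)
  have "(\<lambda>\<tau>. \<Sum>s<m. minv F $$ (i, s) * \<tau> (F $$ (s, j))) \<in> lspan orbit_maps"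
    by (intro lspan_sum lspan_base orbit_maps_I) (rule refl)
  moreover have "\<forall>\<tau>\<in>G. (\<Sum>s<m. minv F $$ (i, s) * \<tau> (F $$ (s, j))) = galois_mat \<tau> $$ (i, j)"
  proof
    fix \<tau> assume "\<tau> \<in> G"
    have "map_mat \<tau> F \<in> carrier_mat m m" using F_carrier by simp
    from index_mult_mat_sum[OF GL_D(4)[OF F_GL] this entry]
    show "(\<Sum>s<m. minv F $$ (i, s) * \<tau> (F $$ (s, j))) = galois_mat \<tau> $$ (i, j)"
      unfolding galois_mat_def using F_carrier entry by simp
  qed
  ultimately show ?case by (rule lspan_orbit_maps_cong)
next
  case inverse_det
  have "(\<lambda>\<tau>. inverse (det (minv F)) * \<tau> (inverse (det F))) \<in> lspan orbit_maps"
    by (intro lspan_base orbit_maps_I) (rule refl)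
  moreover have "\<forall>\<tau>\<in>G. inverse (det (minv F)) * \<tau> (inverse (det F)) = inverse (det (galois_mat \<tau>))"
  proof
    fix \<tau> assume \<tau>: "\<tau> \<in> G"
    have "map_mat \<tau> F \<in> carrier_mat m m" using F_carrier by simp
    from det_mult[OF GL_D(4)[OF F_GL] this]
    have "det (galois_mat \<tau>) = det (minv F) * \<tau> (det F)" unfolding galois_mat_def by (simp only: map_dGal_det[OF \<tau>])
    moreover have "\<tau> (inverse (det F)) = inverse (\<tau> (det F))"
      using dGalD(10)[OF \<tau>, of 1 "det F"] dGalD(7)[OF \<tau>] by (simp add: divide_inverse)
    ultimately show "inverse (det (minv F)) * \<tau> (inverse (det F)) = inverse (det (galois_mat \<tau>))" by simp
  qed
  ultimately show ?case by (rule lspan_orbit_maps_cong)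
next
  case (add f g)
  show ?case by (rule lspan_add[OF add.IH])
next
  case (mult f g)
  show ?case by (rule lspan_orbit_maps_mult[OF mult.IH])
qed

text \<open>Writing \<open>\<rho>(\<tau>) = \<Sum>\<^sub>k e\<^sub>k \<tau>(R\<^sub>k)\<close> with \<open>K\<close>-independent \<open>e\<^sub>k\<close>, Artin's argument turns
  multiplicativity into \<open>\<sigma>(R\<^sub>k) = R\<^sub>k \<rho>(\<sigma>)\<close>. As \<open>det (\<Sum>\<^sub>k x\<^sub>k R\<^sub>k)\<close> is \<open>1\<close> at \<open>x = e\<close> and \<open>K\<close> is
  infinite, it is nonzero at some \<open>x\<close> in \<open>K\<close>.\<close>

lemma representation_realized:
  assumes \<rho>: "\<And>\<sigma>. \<sigma> \<in> G \<Longrightarrow> \<rho> \<sigma> \<in> GL C n"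
    and mult: "\<And>\<sigma> \<tau>. \<sigma> \<in> G \<Longrightarrow> \<tau> \<in> G \<Longrightarrow> \<rho> (\<sigma> \<circ> \<tau>) = \<rho> \<sigma> * \<rho> \<tau>"
    and reg: "\<And>i j. i < n \<Longrightarrow> j < n \<Longrightarrow> (\<lambda>\<sigma>. \<rho> \<sigma> $$ (i, j)) \<in> regular_maps"
  obtains U where "U \<in> GL UNIV n" "\<And>\<sigma>. \<sigma> \<in> G \<Longrightarrow> map_mat \<sigma> U = U * \<rho> \<sigma>"
proof -
  let ?f = "\<lambda>(i, j) \<tau>. \<rho> \<tau> $$ (i, j)"
  have "?f ij \<in> lspan orbit_maps" if ij: "ij \<in> {..<n} \<times> {..<n}" for ij
  proof -
    obtain i j where ij': "ij = (i, j)" "i < n" "j < n" using ij by auto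
    obtain f where f: "f \<in> GL_regular C m" "\<And>\<sigma>. \<sigma> \<in> G \<Longrightarrow> \<rho> \<sigma> $$ (i, j) = f (galois_mat \<sigma>)"
      using reg[OF ij'(2,3)] unfolding regular_maps_iff by blast
    show ?thesis by (rule lspan_orbit_maps_cong[OF regular_lspan_orbit_maps[OF f(1)]]) (simp add: f(2) ij')
  qed
  then have "?f ` ({..<n} \<times> {..<n}) \<subseteq> lspan orbit_maps" by blast
  then obtain r e where e: "indep K r e"
    "\<And>f. f \<in> ?f ` ({..<n} \<times> {..<n}) \<Longrightarrow> \<exists>g. (\<forall>k<r. g k \<in> orbit_maps) \<and> f = (\<lambda>x. \<Sum>k<r. e k * g k x)"
    using lspan_common_basis[OF K_subfield orbit_maps_subspace, of "?f ` ({..<n} \<times> {..<n})"] by blast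
  have "\<exists>z. \<forall>\<tau>\<in>G. \<rho> \<tau> $$ (i, j) = (\<Sum>k<r. e k * \<tau> (z k))" if ij: "i < n" "j < n" for i j
  proof -
    have "(\<lambda>\<tau>. \<rho> \<tau> $$ (i, j)) \<in> ?f ` ({..<n} \<times> {..<n})" using ij by (intro image_eqI[of _ _ "(i, j)"]) auto
    from e(2)[OF this] obtain g where g: "\<forall>k<r. g k \<in> orbit_maps" "(\<lambda>\<tau>. \<rho> \<tau> $$ (i, j)) = (\<lambda>x. \<Sum>k<r. e k * g k x)" by blast
    have "\<forall>k. \<exists>z. k < r \<longrightarrow> (\<forall>\<tau>\<in>G. g k \<tau> = \<tau> z)" using g(1) by (auto simp: orbit_maps_def)
    from choice[OF this] obtain z where z: "\<And>k \<tau>. k < r \<Longrightarrow> \<tau> \<in> G \<Longrightarrow> g k \<tau> = \<tau> (z k)" by blast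
    show ?thesis using fun_cong[OF g(2)] z by (intro exI[of _ z]) simp
  qed
  then have "\<forall>i j. \<exists>z. i < n \<longrightarrow> j < n \<longrightarrow> (\<forall>\<tau>\<in>G. \<rho> \<tau> $$ (i, j) = (\<Sum>k<r. e k * \<tau> (z k)))" by blast
  then have "\<exists>z. \<forall>i j. i < n \<longrightarrow> j < n \<longrightarrow> (\<forall>\<tau>\<in>G. \<rho> \<tau> $$ (i, j) = (\<Sum>k<r. e k * \<tau> (z i j k)))"
    unfolding choice_iff .
  then obtain z where z: "\<And>i j \<tau>. i < n \<Longrightarrow> j < n \<Longrightarrow> \<tau> \<in> G \<Longrightarrow> \<rho> \<tau> $$ (i, j) = (\<Sum>k<r. e k * \<tau> (z i j k))"
    by blast
  have \<rho>C: "\<rho> \<sigma> $$ (i, j) \<in> C" if "\<sigma> \<in> G" "i < n" "j < n" for \<sigma> i j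
    using MatD(2)[OF GL_D(1)[OF \<rho>[OF that(1)]] that(2,3)] .
  have equivariant: "\<sigma> (z i j k) = (\<Sum>s<n. z i s k * \<rho> \<sigma> $$ (s, j))"
    if \<sigma>: "\<sigma> \<in> G" and ij: "i < n" "j < n" and k: "k < r" for \<sigma> i j k
  proof -
    \<comment> \<open>By \<open>artin_independence\<close> it suffices that the sums formed with
      these differences vanish for every \<tau>, which is \<open>\<rho> (\<tau> \<circ> \<sigma>) =
      \<rho> \<tau> * \<rho> \<sigma>\<close> written out along \<open>e\<close>.\<close>
    let ?w = "\<lambda>k. \<sigma> (z i j k) - (\<Sum>s<n. z i s k * \<rho> \<sigma> $$ (s, j))"
    have "(\<Sum>k<r. e k * \<tau> (?w k)) = 0" if \<tau>: "\<tau> \<in> G" for \<tau>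
    proof -
      note \<tau>D = dGalD[OF \<tau>]
      have fix_\<rho>: "\<tau> (\<rho> \<sigma> $$ (s, j)) = \<rho> \<sigma> $$ (s, j)" if "s < n" for s
        using \<rho>C[OF \<sigma> that ij(2)] C_subset_K by (intro \<tau>D(4)) blast
      have "(\<Sum>k<r. e k * \<tau> (?w k)) = (\<Sum>k<r. e k * (\<tau> \<circ> \<sigma>) (z i j k))
          - (\<Sum>k<r. \<Sum>s<n. e k * \<tau> (z i s k) * \<rho> \<sigma> $$ (s, j))"
        by (simp add: \<tau>D(9,12,3) fix_\<rho> right_diff_distrib sum_subtractf sum_distrib_left mult.assoc)
      also have "(\<Sum>k<r. e k * (\<tau> \<circ> \<sigma>) (z i j k)) = \<rho> (\<tau> \<circ> \<sigma>) $$ (i, j)"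
        by (rule z[OF ij dGal_comp[OF \<tau> \<sigma>], symmetric])
      also have "\<dots> = (\<Sum>s<n. \<rho> \<tau> $$ (i, s) * \<rho> \<sigma> $$ (s, j))"
        unfolding mult[OF \<tau> \<sigma>] by (rule index_mult_mat_sum[OF GL_D(2)[OF \<rho>[OF \<tau>]] GL_D(2)[OF \<rho>[OF \<sigma>]] ij])
      also have "\<dots> = (\<Sum>s<n. \<Sum>k<r. e k * \<tau> (z i s k) * \<rho> \<sigma> $$ (s, j))"
        using z[OF ij(1) _ \<tau>] by (simp add: sum_distrib_right)
      also have "\<dots> = (\<Sum>k<r. \<Sum>s<n. e k * \<tau> (z i s k) * \<rho> \<sigma> $$ (s, j))" by (rule sum.swap)
      finally show ?thesis by simp
    qed
    from artin_independence[where z = ?w, OF e(1) this k] show ?thesis by simp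
  qed
  let ?R = "\<lambda>x. mat n n (\<lambda>(i, j). \<Sum>k<r. z i j k * x k)"
  \<comment> \<open>An idempotent invertible matrix is the identity.\<close>
  have \<rho>1: "\<rho> id = 1\<^sub>m n"
  proof -
    note P = GL_D[OF \<rho>[OF dGal_id]]
    have "\<rho> id = \<rho> id * \<rho> id" using mult[OF dGal_id dGal_id] by simp
    then have "minv (\<rho> id) * \<rho> id = minv (\<rho> id) * (\<rho> id * \<rho> id)" by simp
    then show ?thesis unfolding mult_minv_cancel(2)[OF \<rho>[OF dGal_id] P(2)] P(6) ..
  qed
  have "?R e = 1\<^sub>m n"
  proof (rule eq_matI)
    fix i j assume "i < dim_row (1\<^sub>m n :: 'a mat)" "j < dim_col (1\<^sub>m n :: 'a mat)"
    then have ij: "i < n" "j < n" by auto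
    have "?R e $$ (i, j) = \<rho> id $$ (i, j)" using z[OF ij dGal_id] ij by (simp add: mult.commute)
    then show "?R e $$ (i, j) = 1\<^sub>m n $$ (i, j)" unfolding \<rho>1 .
  qed auto
  then have "det (?R e) \<noteq> 0" by simp
  moreover have "(\<lambda>x. det (?R x)) \<in> polyfun UNIV r"
    by (intro polyfun_det[OF UNIV_subfield] polyfun_sum[OF UNIV_subfield] polyfun.mult polyfun.const polyfun.var) auto
  moreover have "infinite K" using infinite_algebraically_closed[OF C_closed] C_subset_K finite_subset by blast
  ultimately obtain x where x: "\<And>k. k < r \<Longrightarrow> x k \<in> K" "det (?R x) \<noteq> 0"
    using polyfun_eq_zero by blast
  have "map_mat \<sigma> (?R x) = ?R x * \<rho> \<sigma>" if \<sigma>: "\<sigma> \<in> G" for \<sigma>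
  proof (rule eq_matI)
    note P = GL_D[OF \<rho>[OF \<sigma>]]
    fix i j assume "i < dim_row (?R x * \<rho> \<sigma>)" "j < dim_col (?R x * \<rho> \<sigma>)"
    then have ij: "i < n" "j < n" using P by auto
    have "map_mat \<sigma> (?R x) $$ (i, j) = (\<Sum>k<r. \<sigma> (z i j k) * x k)"
      using ij x(1) by (simp add: dGalD(3,4,12)[OF \<sigma>])
    also have "\<dots> = (\<Sum>k<r. \<Sum>s<n. z i s k * x k * \<rho> \<sigma> $$ (s, j))"
      using equivariant[OF \<sigma> ij] by (simp add: sum_distrib_left sum_distrib_right mult_ac)
    also have "\<dots> = (\<Sum>s<n. \<Sum>k<r. z i s k * x k * \<rho> \<sigma> $$ (s, j))" by (rule sum.swap)
    also have "\<dots> = (\<Sum>s<n. ?R x $$ (i, s) * \<rho> \<sigma> $$ (s, j))"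
      using ij by (simp add: sum_distrib_right)
    also have "\<dots> = (?R x * \<rho> \<sigma>) $$ (i, j)"
      by (rule index_mult_mat_sum[symmetric, OF _ P(2) ij]) simp
    finally show "map_mat \<sigma> (?R x) $$ (i, j) = (?R x * \<rho> \<sigma>) $$ (i, j)" .
  qed (use GL_D(2)[OF \<rho>[OF \<sigma>]] in auto)
  moreover have "?R x \<in> GL UNIV n" using x(2) by (simp add: GL_iff_det[OF UNIV_subfield] Mat_iff)
  ultimately show ?thesis by (intro that[of "?R x"])
qed

text \<open>Right multiplication of \<open>U\<close> by the constant matrix \<rho>(\<sigma>) leaves
  the logarithmic derivative unchanged, so its entries are fixed by the Galois group.\<close>

lemma log_derivative_in_K:
  assumes U: "U \<in> GL UNIV n" and \<rho>: "\<And>\<sigma>. \<sigma> \<in> G \<Longrightarrow> \<rho> \<sigma> \<in> GL C n"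
    and eq: "\<And>\<sigma>. \<sigma> \<in> G \<Longrightarrow> map_mat \<sigma> U = U * \<rho> \<sigma>"
  shows "map_mat D U * minv U \<in> Mat K n"
  unfolding Mat_iff
proof (intro conjI allI impI)
  note UD = GL_D[OF U]
  show c: "map_mat D U * minv U \<in> carrier_mat n n" using UD by simp
  fix i j assume ij: "i < n" "j < n"
  show "(map_mat D U * minv U) $$ (i, j) \<in> K"
  proof (rule fixed_field, rule ballI)
    fix \<sigma> assume \<sigma>: "\<sigma> \<in> G"
    have "map_mat \<sigma> (map_mat D U * minv U) = map_mat D U * minv U"
      using log_derivative_dGal[OF \<sigma> U] log_derivative_mult_const[OF U \<rho>[OF \<sigma>]] unfolding eq[OF \<sigma>] by simp
    then have "map_mat \<sigma> (map_mat D U * minv U) $$ (i, j) = (map_mat D U * minv U) $$ (i, j)" by simp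
    moreover have "map_mat \<sigma> (map_mat D U * minv U) $$ (i, j) = \<sigma> ((map_mat D U * minv U) $$ (i, j))"
      by (rule index_map_mat(1)) (use c ij in auto)
    ultimately show "\<sigma> ((map_mat D U * minv U) $$ (i, j)) = (map_mat D U * minv U) $$ (i, j)" by simp
  qed
qed

end


section \<open>Gauge classes and conjugacy classes\<close>

lemma gauge_one:
  assumes "derivation D" "A \<in> carrier_mat n n"
  shows "gauge D (1\<^sub>m n) A = A"
proof -
  have "map_mat D (1\<^sub>m n) = 0\<^sub>m n n" using derivation_simps(3,4)[OF assms(1)] by (intro eq_matI) auto
  moreover have "minv (1\<^sub>m n :: 'a mat) = 1\<^sub>m n" by (rule minv_unique[of _ n]) auto
  ultimately show ?thesis using assms(2) by (simp add: gauge_def)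
qed

lemma gauge_mult:
  assumes D: "derivation D" and U: "U \<in> GL UNIV n" and V: "V \<in> GL UNIV n" and A: "A \<in> carrier_mat n n"
  shows "gauge D V (gauge D U A) = gauge D (V * U) A"
proof -
  note UD = GL_D[OF U] and VD = GL_D[OF V]
  have S: "is_subring (UNIV :: 'a set)" by (simp add: is_subring_def)
  let ?U' = "map_mat D U" and ?V' = "map_mat D V"
  have c: "U \<in> carrier_mat n n" "V \<in> carrier_mat n n" "minv U \<in> carrier_mat n n" "minv V \<in> carrier_mat n n"
    "?U' \<in> carrier_mat n n" "?V' \<in> carrier_mat n n" using UD VD by auto
  have "?V' * U * (minv U * minv V) = ?V' * (U * (minv U * minv V))"
    using c by (intro assoc_mult_mat) auto
  also have "U * (minv U * minv V) = minv V" by (rule mult_minv_cancel(1)[OF U c(4)])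
  finally have 1: "?V' * U * (minv U * minv V) = ?V' * minv V" .
  have "gauge D (V * U) A = (?V' * U + V * ?U') * (minv U * minv V) + V * U * A * (minv U * minv V)"
    unfolding gauge_def map_mat_derivation_mult[OF D c(2,1)] GL_mult(2)[OF S V U] ..
  also have "(?V' * U + V * ?U') * (minv U * minv V) = ?V' * minv V + V * ?U' * (minv U * minv V)"
    using c by (simp add: add_mult_distrib_mat[of _ n n _ _ n] 1)
  finally have "gauge D (V * U) A = ?V' * minv V + V * ?U' * (minv U * minv V) + V * U * A * (minv U * minv V)" .
  moreover have "gauge D V (gauge D U A) = ?V' * minv V + (V * (?U' * minv U) + V * (U * A * minv U)) * minv V"
    unfolding gauge_def using c A by (simp add: mult_add_distrib_mat[of _ n n _ n])
  moreover have "(V * (?U' * minv U) + V * (U * A * minv U)) * minv V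
    = V * ?U' * (minv U * minv V) + V * U * A * (minv U * minv V)"
    using c A by (simp add: add_mult_distrib_mat[of _ n n _ _ n] assoc_mult_mat[of _ n n _ n _ n])
  moreover have "?V' * minv V + V * ?U' * (minv U * minv V) + V * U * A * (minv U * minv V)
    = ?V' * minv V + (V * ?U' * (minv U * minv V) + V * U * A * (minv U * minv V))"
    by (rule assoc_add_mat[of _ n n]) (use c A in auto)
  ultimately show ?thesis by (simp only:)
qed

lemma gauge_zero:
  assumes "U \<in> GL S n"
  shows "gauge D U (0\<^sub>m n n) = map_mat D U * minv U"
  using GL_D(2,4)[OF assms] by (simp add: gauge_def)

lemma gauge_rel_equiv:
  assumes D: "derivation D" and S: "diff_subfield D S"
  shows "equiv (Mat S n) (gauge_rel D S n)"
proof (rule equivI)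
  have R: "is_subring S" using S by (simp add: diff_subfield_def is_subring_subfield)
  have GU: "U \<in> GL UNIV n" if "U \<in> GL S n" for U using that GL_mono[of S UNIV n] by blast
  show "gauge_rel D S n \<subseteq> Mat S n \<times> Mat S n" by (auto simp: gauge_rel_def)
  show "refl_on (Mat S n) (gauge_rel D S n)"
    using GL_one(1)[OF R, of n] gauge_one[OF D MatD(1), symmetric] by (auto simp: refl_on_def gauge_rel_def)
  show "sym (gauge_rel D S n)"
  proof (rule symI)
    fix A B assume "(A, B) \<in> gauge_rel D S n"
    then obtain U where *: "A \<in> Mat S n" "B \<in> Mat S n" "U \<in> GL S n" "B = gauge D U A" by (auto simp: gauge_rel_def)
    note UD = GL_D[OF *(3)]
    have "gauge D (minv U) B = gauge D (minv U * U) A"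
      unfolding *(4) by (rule gauge_mult[OF D GU[OF *(3)] GU[OF UD(7)] MatD(1)[OF *(1)]])
    then have "A = gauge D (minv U) B" using gauge_one[OF D MatD(1)[OF *(1)]] UD(6) by simp
    then show "(B, A) \<in> gauge_rel D S n" using * UD(7) by (auto simp: gauge_rel_def)
  qed
  show "trans (gauge_rel D S n)"
  proof (rule transI)
    fix A B E assume "(A, B) \<in> gauge_rel D S n" "(B, E) \<in> gauge_rel D S n"
    then obtain U V where *: "A \<in> Mat S n" "E \<in> Mat S n" "U \<in> GL S n" "B = gauge D U A" "V \<in> GL S n" "E = gauge D V B"
      by (auto simp: gauge_rel_def)
    then have "E = gauge D (V * U) A" using gauge_mult[OF D GU GU MatD(1)[OF *(1)]] by simp
    then show "(A, E) \<in> gauge_rel D S n" using * GL_mult(1)[OF R *(5,3)] by (auto simp: gauge_rel_def)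
  qed
qed

section \<open>Gauge equivalence against conjugacy, and the bijection\<close>

context picard_vessiot_extension
begin

lemma UNIV_diff_subfield: "diff_subfield D UNIV"
  by (simp add: diff_subfield_def UNIV_subfield)

lemma C_ring: "is_subring C" and UNIV_ring: "is_subring (UNIV :: 'a set)"
  by (rule is_subring_subfield[OF C_subfield] is_subring_subfield[OF UNIV_subfield])+

lemma rep_of_apply: "\<sigma> \<in> G \<Longrightarrow> rep_of D K U \<sigma> = minv U * map_mat \<sigma> U"
  by (simp add: rep_of_def)

lemma rep_of_rational:
  assumes U: "U \<in> GL UNIV n" and A: "map_mat D U * minv U \<in> Mat K n"
  shows "rep_of D K U \<in> rational_reps D K m F n"
proof -
  let ?\<rho> = "\<lambda>\<sigma>. minv U * map_mat \<sigma> U"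
  have \<rho>: "?\<rho> \<sigma> \<in> GL C n" if "\<sigma> \<in> G" for \<sigma> by (rule cocycle_GL[OF U A that])
  have "rep_of D K U \<in> G \<rightarrow>\<^sub>E GL C n" unfolding rep_of_def using \<rho> by auto
  moreover have "rep_of D K U (\<sigma> \<circ> \<tau>) = rep_of D K U \<sigma> * rep_of D K U \<tau>" if "\<sigma> \<in> G" "\<tau> \<in> G" for \<sigma> \<tau>
    using cocycle_comp[OF U A that] that dGal_comp[OF that] by (simp only: rep_of_apply)
  moreover have "dGal_regular D K m F (\<lambda>\<sigma>. rep_of D K U \<sigma> $$ (i, j))" if "i < n" "j < n" for i j
  proof -
    have "(\<lambda>\<sigma>. ?\<rho> \<sigma> $$ (i, j)) \<in> regular_maps"
      by (rule representation_regular[OF U \<rho> map_dGal_cocycle[OF U] that])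
    then have "(\<lambda>\<sigma>. rep_of D K U \<sigma> $$ (i, j)) \<in> regular_maps" by (rule regular_maps_cong) (simp add: rep_of_apply)
    then show ?thesis by (simp add: regular_maps_def)
  qed
  ultimately show ?thesis by (auto simp: rational_reps_def)
qed

lemma rational_repsD:
  assumes "\<rho> \<in> rational_reps D K m F n"
  shows "\<sigma> \<in> G \<Longrightarrow> \<rho> \<sigma> \<in> GL C n" "\<sigma> \<in> G \<Longrightarrow> \<tau> \<in> G \<Longrightarrow> \<rho> (\<sigma> \<circ> \<tau>) = \<rho> \<sigma> * \<rho> \<tau>"
    "i < n \<Longrightarrow> j < n \<Longrightarrow> (\<lambda>\<sigma>. \<rho> \<sigma> $$ (i, j)) \<in> regular_maps" "\<sigma> \<notin> G \<Longrightarrow> \<rho> \<sigma> = undefined"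
  using assms unfolding rational_reps_def regular_maps_def by (auto simp: PiE_iff extensional_def)

lemma conj_rel_equiv: "equiv (rational_reps D K m F n) (conj_rel D K m F n)"
proof (rule equivI)
  let ?R = "conj_rel D K m F n"
  show "?R \<subseteq> rational_reps D K m F n \<times> rational_reps D K m F n" by (auto simp: conj_rel_def)
  show "refl_on (rational_reps D K m F n) ?R"
  proof (rule refl_onI)
    fix \<rho> assume \<rho>: "\<rho> \<in> rational_reps D K m F n"
    have "\<rho> \<sigma> = 1\<^sub>m n * \<rho> \<sigma> * minv (1\<^sub>m n)" if "\<sigma> \<in> G" for \<sigma>
      using GL_D(2)[OF rational_repsD(1)[OF \<rho> that]] by (simp add: GL_one(2))
    then show "(\<rho>, \<rho>) \<in> ?R" using \<rho> GL_one(1)[OF C_ring] by (auto simp: conj_rel_def)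
  qed
  show "sym ?R"
  proof (rule symI)
    fix \<rho> \<rho>' assume "(\<rho>, \<rho>') \<in> ?R"
    then obtain T where *: "\<rho> \<in> rational_reps D K m F n" "\<rho>' \<in> rational_reps D K m F n" "T \<in> GL C n"
      "\<And>\<sigma>. \<sigma> \<in> G \<Longrightarrow> \<rho>' \<sigma> = T * \<rho> \<sigma> * minv T" by (auto simp: conj_rel_def)
    note TD = GL_D[OF *(3)]
    have "\<rho> \<sigma> = minv T * \<rho>' \<sigma> * minv (minv T)" if "\<sigma> \<in> G" for \<sigma>
    proof -
      note c = GL_D(2)[OF rational_repsD(1)[OF *(1) that]]
      have "minv T * (T * \<rho> \<sigma> * minv T) = minv T * (T * (\<rho> \<sigma> * minv T))"
        using c TD by (simp add: assoc_mult_mat[of _ n n _ n _ n])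
      also have "\<dots> = \<rho> \<sigma> * minv T" by (rule mult_minv_cancel(2)[OF *(3) mult_carrier_mat[OF c TD(4)]])
      finally show ?thesis unfolding *(4)[OF that] TD(8)
        using mult_minv_cancel_right(2)[OF *(3) c] by simp
    qed
    then show "(\<rho>', \<rho>) \<in> ?R" using * TD(7) by (auto simp: conj_rel_def)
  qed
  show "trans ?R"
  proof (rule transI)
    fix \<rho> \<rho>' \<rho>'' assume "(\<rho>, \<rho>') \<in> ?R" "(\<rho>', \<rho>'') \<in> ?R"
    then obtain T S where *: "\<rho> \<in> rational_reps D K m F n" "\<rho>'' \<in> rational_reps D K m F n" "T \<in> GL C n" "S \<in> GL C n"
      "\<And>\<sigma>. \<sigma> \<in> G \<Longrightarrow> \<rho>' \<sigma> = T * \<rho> \<sigma> * minv T" "\<And>\<sigma>. \<sigma> \<in> G \<Longrightarrow> \<rho>'' \<sigma> = S * \<rho>' \<sigma> * minv S" by (auto simp: conj_rel_def)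
    have "\<rho>'' \<sigma> = S * T * \<rho> \<sigma> * minv (S * T)" if "\<sigma> \<in> G" for \<sigma>
      using GL_D(2)[OF rational_repsD(1)[OF *(1) that]] GL_D(2,4)[OF *(3)] GL_D(2,4)[OF *(4)]
      unfolding *(6)[OF that] *(5)[OF that] GL_mult(2)[OF C_ring *(4,3)]
      by (simp add: assoc_mult_mat[of _ n n _ n _ n])
    then show "(\<rho>, \<rho>'') \<in> ?R" using * GL_mult(1)[OF C_ring *(4,3)] by (auto simp: conj_rel_def)
  qed
qed

text \<open>If \<open>W\<close> over \<open>K\<close> carries one equation to the other, then
  \<open>W U\<close> and \<open>V\<close> solve the same equation and \<open>W U = V T\<close> with
  \<open>T\<close> constant. Every \<sigma> fixes \<open>W\<close> and \<open>T\<close>, so applying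
  it to this equality exhibits \<open>T\<close> as the conjugating matrix.\<close>

lemma conj_rel_of_gauge_rel:
  assumes U: "U \<in> GL UNIV n" and V: "V \<in> GL UNIV n"
    and rel: "(map_mat D U * minv U, map_mat D V * minv V) \<in> gauge_rel D K n"
  shows "(rep_of D K U, rep_of D K V) \<in> conj_rel D K m F n"
proof -
  note UD = GL_D[OF U] and VD = GL_D[OF V]
  let ?A = "map_mat D U * minv U" and ?A' = "map_mat D V * minv V"
  from rel obtain W where *: "?A \<in> Mat K n" "?A' \<in> Mat K n" "W \<in> GL K n" "?A' = gauge D W ?A"
    by (auto simp: gauge_rel_def)
  have W: "W \<in> GL UNIV n" using *(3) GL_K_UNIV by blast
  note WD = GL_D[OF W]
  have WU: "W * U \<in> GL UNIV n" by (rule GL_mult(1)[OF UNIV_ring W U])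
  have "?A' = gauge D (W * U) (0\<^sub>m n n)"
    using *(4) gauge_mult[OF D U W zero_carrier_mat] unfolding gauge_zero[OF U] by simp
  then have eq: "map_mat D V * minv V = map_mat D (W * U) * minv (W * U)" unfolding gauge_zero[OF WU] .
  define T where "T = minv V * (W * U)"
  have T: "T \<in> GL C n" unfolding T_def by (rule constant_quotient[OF V WU eq])
  note TD = GL_D[OF T]
  have VT: "V * T = W * U" unfolding T_def by (rule mult_minv_cancel(1)[OF V GL_D(2)[OF WU]])
  have "rep_of D K V \<sigma> = T * rep_of D K U \<sigma> * minv T" if \<sigma>: "\<sigma> \<in> G" for \<sigma>
  proof -
    let ?s = "\<lambda>Y. map_mat \<sigma> Y"
    have sU: "?s U \<in> carrier_mat n n" and sV: "?s V \<in> carrier_mat n n" using UD VD by auto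
    have "?s T = T" by (rule map_dGal_Mat[OF \<sigma> subsetD[OF Mat_C_K TD(1)]])
    then have "?s V * T = ?s V * ?s T" by simp
    also have "\<dots> = ?s (V * T)" by (rule map_dGal_mult[OF \<sigma> VD(2) TD(2), symmetric])
    also have "\<dots> = ?s W * ?s U" unfolding VT by (rule map_dGal_mult[OF \<sigma> WD(2) UD(2)])
    also have "?s W = W" by (rule map_dGal_Mat[OF \<sigma> GL_D(1)[OF *(3)]])
    finally have sVT: "?s V * T = W * ?s U" .
    have "minv V * ?s V = minv V * (?s V * T * minv T)"
      using mult_minv_cancel_right(1)[OF T sV] by simp
    also have "\<dots> = minv V * (W * (U * (minv U * ?s U)) * minv T)"
      unfolding sVT mult_minv_cancel(1)[OF U sU] ..
    also have "\<dots> = T * (minv U * ?s U) * minv T"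
      unfolding T_def using UD VD WD TD(4) sU by (simp add: assoc_mult_mat[of _ n n _ n _ n] T_def)
    finally show ?thesis unfolding rep_of_apply[OF \<sigma>] .
  qed
  then show ?thesis unfolding conj_rel_def using rep_of_rational[OF U *(1)] rep_of_rational[OF V *(2)] T by blast
qed

lemma gauge_rel_of_conj_rel:
  assumes U: "U \<in> GL UNIV n" and A: "map_mat D U * minv U \<in> Mat K n"
    and V: "V \<in> GL UNIV n" and A': "map_mat D V * minv V \<in> Mat K n"
    and rel: "(rep_of D K U, rep_of D K V) \<in> conj_rel D K m F n"
  shows "(map_mat D U * minv U, map_mat D V * minv V) \<in> gauge_rel D K n"
proof -
  note UD = GL_D[OF U] and VD = GL_D[OF V]
  from rel obtain T where T: "T \<in> GL C n" "\<And>\<sigma>. \<sigma> \<in> G \<Longrightarrow> rep_of D K V \<sigma> = T * rep_of D K U \<sigma> * minv T"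
    by (auto simp: conj_rel_def)
  note TD = GL_D[OF T(1)]
  have TU: "T \<in> GL UNIV n" using T(1) GL_C_UNIV by blast
  define W where "W = V * T * minv U"
  have VT: "V * T \<in> GL UNIV n" by (rule GL_mult(1)[OF UNIV_ring V TU])
  have W: "W \<in> GL UNIV n" unfolding W_def by (rule GL_mult(1)[OF UNIV_ring VT UD(7)])
  note WD = GL_D[OF W]
  have WU: "W * U = V * T" unfolding W_def by (rule mult_minv_cancel_right(2)[OF U GL_D(2)[OF VT]])
  have fixed: "map_mat \<sigma> W = W" if \<sigma>: "\<sigma> \<in> G" for \<sigma>
  proof -
    let ?s = "\<lambda>Y. map_mat \<sigma> Y"
    let ?\<rho> = "rep_of D K U \<sigma>" and ?\<rho>' = "rep_of D K V \<sigma>"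
    note sU = GL_D[OF map_dGal_GL(1)[OF \<sigma> U]] and sV = GL_D[OF map_dGal_GL(1)[OF \<sigma> V]]
    have \<rho>: "?\<rho> \<in> carrier_mat n n" using UD sU by (simp add: rep_of_apply[OF \<sigma>])
    have "?s V * T = V * ?\<rho>' * T" using map_dGal_cocycle[OF V \<sigma>] by (simp only: rep_of_apply[OF \<sigma>])
    also have "\<dots> = V * (T * ?\<rho>)"
      unfolding T(2)[OF \<sigma>] using VD TD \<rho> mult_minv_cancel_right(2)[OF T(1), of "T * ?\<rho>" n]
      by (simp add: assoc_mult_mat[of _ n n _ n _ n])
    also have "\<dots> = V * T * ?\<rho>" using VD TD \<rho> by (simp add: assoc_mult_mat[of _ n n _ n _ n])
    also have "\<dots> = W * U * ?\<rho>" unfolding WU ..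
    also have "\<dots> = W * (U * ?\<rho>)" by (rule assoc_mult_mat[OF WD(2) UD(2) \<rho>])
    also have "U * ?\<rho> = ?s U" using map_dGal_cocycle[OF U \<sigma>] by (simp only: rep_of_apply[OF \<sigma>])
    finally have 1: "?s V * T = W * ?s U" .
    have "?s W * ?s U = ?s (W * U)" by (rule map_dGal_mult[OF \<sigma> WD(2) UD(2), symmetric])
    also have "\<dots> = ?s V * ?s T" unfolding WU by (rule map_dGal_mult[OF \<sigma> VD(2) TD(2)])
    also have "?s T = T" by (rule map_dGal_Mat[OF \<sigma> subsetD[OF Mat_C_K TD(1)]])
    finally have "?s W * ?s U = W * ?s U" using 1 by simp
    then have "?s W * ?s U * minv (?s U) = W * ?s U * minv (?s U)" by simp
    moreover have "?s W \<in> carrier_mat n n" using WD by simp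
    ultimately show ?thesis
      using mult_minv_cancel_right(1)[OF map_dGal_GL(1)[OF \<sigma> U]] WD(2) by simp
  qed
  have "W $$ (i, j) \<in> K" if ij: "i < n" "j < n" for i j
  proof (rule fixed_field, rule ballI)
    fix \<sigma> assume "\<sigma> \<in> G"
    have "\<sigma> (W $$ (i, j)) = map_mat \<sigma> W $$ (i, j)" using WD(2) ij by simp
    then show "\<sigma> (W $$ (i, j)) = W $$ (i, j)" using fixed[OF \<open>\<sigma> \<in> G\<close>] by simp
  qed
  then have WK: "W \<in> GL K n" using W by (simp add: GL_iff_det[OF K_subfield] GL_iff_det[OF UNIV_subfield] Mat_iff)
  \<comment> \<open>\<open>W U = V T\<close> with \<open>T\<close> constant, so its logarithmic
    derivative is that of \<open>V\<close>.\<close>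
  have "gauge D W (map_mat D U * minv U) = gauge D (W * U) (0\<^sub>m n n)"
    using gauge_mult[OF D U W zero_carrier_mat] unfolding gauge_zero[OF U] .
  also have "\<dots> = map_mat D V * minv V"
    unfolding WU gauge_zero[OF VT] by (rule log_derivative_mult_const[OF V T(1)])
  finally show ?thesis unfolding gauge_rel_def using A A' WK by (auto intro!: bexI[of _ W])
qed

lemma gauge_orbit_in_Z_rel:
  assumes U: "U \<in> GL UNIV n" and A: "A \<in> Mat K n" "A = map_mat D U * minv U"
  shows "gauge_orbit D K n A \<in> Z_rel D K n"
proof -
  have "gauge_orbit D K n A \<in> Z D K n" unfolding Z_def gauge_orbit_def by (rule quotientI[OF A(1)])
  moreover have "Z_extend D n (gauge_orbit D K n A) = gauge_orbit D UNIV n (0\<^sub>m n n)"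
  proof -
    let ?L = "gauge_rel D UNIV n"
    note eqL = gauge_rel_equiv[OF D UNIV_diff_subfield, of n]
    have sub: "gauge_rel D K n \<subseteq> ?L"
      using GL_K_UNIV[of n] by (auto simp: gauge_rel_def Mat_iff)
    have "(0\<^sub>m n n, A) \<in> ?L" unfolding gauge_rel_def
      using U A(2) gauge_zero[OF U, of D] MatD(1)[OF A(1)] by (auto simp: Mat_iff intro!: bexI[of _ U])
    then have A0: "?L `` {A} = ?L `` {0\<^sub>m n n}" using equiv_class_eq[OF eqL] by metis
    have "?L `` (gauge_rel D K n `` {A}) = ?L `` {A}"
    proof
      show "?L `` (gauge_rel D K n `` {A}) \<subseteq> ?L `` {A}"
        using sub eqL by (auto simp: equiv_def dest: transD)
      have "(A, A) \<in> gauge_rel D K n"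
        using gauge_rel_equiv[OF D diff_K, of n] A(1) by (auto simp: equiv_def refl_on_def)
      then show "?L `` {A} \<subseteq> ?L `` (gauge_rel D K n `` {A})" by blast
    qed
    then show ?thesis unfolding Z_extend_def gauge_orbit_def using A0 by simp
  qed
  ultimately show ?thesis by (simp add: Z_rel_def)
qed

lemma Z_relE:
  assumes "a \<in> Z_rel D K n"
  obtains U where "U \<in> GL UNIV n" "map_mat D U * minv U \<in> Mat K n"
    "a = gauge_orbit D K n (map_mat D U * minv U)"
proof -
  from assms obtain A where A: "A \<in> Mat K n" "a = gauge_rel D K n `` {A}"
    and ext: "gauge_rel D UNIV n `` a = gauge_orbit D UNIV n (0\<^sub>m n n)"
    by (auto simp: Z_rel_def Z_def Z_extend_def quotient_def)
  have "(A, A) \<in> gauge_rel D K n"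
    using gauge_rel_equiv[OF D diff_K, of n] A(1) by (auto simp: equiv_def refl_on_def)
  moreover have "(A, A) \<in> gauge_rel D UNIV n"
    using gauge_rel_equiv[OF D UNIV_diff_subfield, of n] MatD(1)[OF A(1)] by (auto simp: equiv_def refl_on_def Mat_iff)
  ultimately have "A \<in> gauge_orbit D UNIV n (0\<^sub>m n n)" unfolding ext[symmetric] A(2) by blast
  then obtain U where "U \<in> GL UNIV n" "A = gauge D U (0\<^sub>m n n)" by (auto simp: gauge_orbit_def gauge_rel_def)
  then show ?thesis using that[of U] A gauge_zero[of U UNIV n D] by (simp add: gauge_orbit_def)
qed

text \<open>The matrix picked by \<open>SOME\<close> may belong to another representative of the
  orbit, and to another solution for it; \<open>conj_rel_of_gauge_rel\<close> absorbs both
  ambiguities.\<close>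

lemma rep_class_gauge_orbit:
  assumes U: "U \<in> GL UNIV n" and A: "map_mat D U * minv U \<in> Mat K n"
  shows "rep_class D K m F n (gauge_orbit D K n (map_mat D U * minv U)) = conj_rel D K m F n `` {rep_of D K U}"
proof -
  let ?a = "gauge_orbit D K n (map_mat D U * minv U)"
  let ?P = "\<lambda>U. U \<in> GL UNIV n \<and> map_mat D U * minv U \<in> ?a"
  have "map_mat D U * minv U \<in> ?a" unfolding gauge_orbit_def
    using gauge_rel_equiv[OF D diff_K, of n] A by (auto simp: equiv_def refl_on_def)
  then have U_P: "?P U" using U by simp
  define V where "V = (SOME U. ?P U)"
  have V: "?P V" unfolding V_def using U_P by (rule someI)
  have "(rep_of D K U, rep_of D K V) \<in> conj_rel D K m F n"
    by (rule conj_rel_of_gauge_rel[OF U]) (use V in \<open>auto simp: gauge_orbit_def\<close>)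
  from equiv_class_eq[OF conj_rel_equiv this] show ?thesis
    unfolding rep_class_def V_def by simp
qed

lemma rep_class_bij: "bij_betw (rep_class D K m F n) (Z_rel D K n) (Rep D K m F n)"
proof (rule bij_betw_imageI)
  show "inj_on (rep_class D K m F n) (Z_rel D K n)"
  proof (rule inj_onI)
    fix a b assume a: "a \<in> Z_rel D K n" and b: "b \<in> Z_rel D K n"
      and eq: "rep_class D K m F n a = rep_class D K m F n b"
    from a obtain U where U: "U \<in> GL UNIV n" "map_mat D U * minv U \<in> Mat K n"
      "a = gauge_orbit D K n (map_mat D U * minv U)" by (rule Z_relE)
    from b obtain V where V: "V \<in> GL UNIV n" "map_mat D V * minv V \<in> Mat K n"
      "b = gauge_orbit D K n (map_mat D V * minv V)" by (rule Z_relE)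
    have "conj_rel D K m F n `` {rep_of D K U} = conj_rel D K m F n `` {rep_of D K V}"
      using eq rep_class_gauge_orbit[OF U(1,2)] rep_class_gauge_orbit[OF V(1,2)] unfolding U(3) V(3) by simp
    then have "(rep_of D K U, rep_of D K V) \<in> conj_rel D K m F n"
      using eq_equiv_class[OF _ conj_rel_equiv rep_of_rational[OF V(1,2)]] by blast
    from gauge_rel_of_conj_rel[OF U(1,2) V(1,2) this]
    show "a = b" unfolding U(3) V(3) gauge_orbit_def by (rule equiv_class_eq[OF gauge_rel_equiv[OF D diff_K]])
  qed
  show "rep_class D K m F n ` Z_rel D K n = Rep D K m F n"
  proof
    show "rep_class D K m F n ` Z_rel D K n \<subseteq> Rep D K m F n"
    proof
      fix c assume "c \<in> rep_class D K m F n ` Z_rel D K n"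
      then obtain a where a: "a \<in> Z_rel D K n" "c = rep_class D K m F n a" by blast
      from a(1) obtain U where U: "U \<in> GL UNIV n" "map_mat D U * minv U \<in> Mat K n"
        "a = gauge_orbit D K n (map_mat D U * minv U)" by (rule Z_relE)
      show "c \<in> Rep D K m F n" unfolding a(2) U(3) rep_class_gauge_orbit[OF U(1,2)] Rep_def
        by (rule quotientI[OF rep_of_rational[OF U(1,2)]])
    qed
    show "Rep D K m F n \<subseteq> rep_class D K m F n ` Z_rel D K n"
    proof
      fix c assume "c \<in> Rep D K m F n"
      then obtain \<rho> where \<rho>: "\<rho> \<in> rational_reps D K m F n" "c = conj_rel D K m F n `` {\<rho>}"
        unfolding Rep_def by (rule quotientE)
      note \<rho>D = rational_repsD[OF \<rho>(1)]
      obtain U where U: "U \<in> GL UNIV n" "\<And>\<sigma>. \<sigma> \<in> G \<Longrightarrow> map_mat \<sigma> U = U * \<rho> \<sigma>"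
        using representation_realized[OF \<rho>D(1,2,3)] by blast
      have A: "map_mat D U * minv U \<in> Mat K n" by (rule log_derivative_in_K[OF U(1) \<rho>D(1) U(2)])
      have "rep_of D K U = \<rho>"
      proof
        fix \<sigma> show "rep_of D K U \<sigma> = \<rho> \<sigma>"
        proof (cases "\<sigma> \<in> G")
          case True
          show ?thesis unfolding rep_of_apply[OF True] U(2)[OF True]
            by (rule mult_minv_cancel(2)[OF U(1) GL_D(2)[OF \<rho>D(1)[OF True]]])
        next
          \<comment> \<open>Both functions are \<open>undefined\<close> here, since representations
            are extensional.\<close>
          case False
          then show ?thesis using \<rho>D(4) by (simp add: rep_of_def)
        qed
      qed
      then have "c = rep_class D K m F n (gauge_orbit D K n (map_mat D U * minv U))"
        using \<rho>(2) rep_class_gauge_orbit[OF U(1) A] by simp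
      then show "c \<in> rep_class D K m F n ` Z_rel D K n"
        using gauge_orbit_in_Z_rel[OF U(1) A refl] by blast
    qed
  qed
qed

end

theorem theorem1p1:
  fixes D :: "'a::field \<Rightarrow> 'a" and K :: "'a set" and m n :: nat and F :: "'a mat"
  assumes "derivation D"
    and "diff_subfield D K"
    and "algebraically_closed_subfield (constants D K)"
    and "picard_vessiot D K m F"
    and "n \<ge> 1"
  shows "(\<forall>A \<in> Mat K n. \<forall>U \<in> GL UNIV n. A = map_mat D U * minv U \<longrightarrow>
            gauge_orbit D K n A \<in> Z_rel D K n \<and>
            rep_of D K U \<in> rational_reps D K m F n \<and>
            rep_class D K m F n (gauge_orbit D K n A) = conj_rel D K m F n `` {rep_of D K U})
       \<and> bij_betw (rep_class D K m F n) (Z_rel D K n) (Rep D K m F n)"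
proof -
  interpret picard_vessiot_extension D K m F
    by standard (fact assms)+
  show ?thesis
    using gauge_orbit_in_Z_rel rep_of_rational rep_class_gauge_orbit rep_class_bij by blast
qed

end
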